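(* Let $\mathfrak{g}$ be a finite-dimensional simple Lie algebra over $\mathbb{C}$ of type $X_\ell$, where $X_\ell$ is one of $A_\ell, B_\ell, C_\ell, D_\ell, E_6, E_7$. Let $k$ be a positive integer and let $\lambda\in P_+$ be a dominant integral weight with $\langle\lambda,\theta\rangle\le k$. Let $H^{(i)}$ be a minuscule fundamental coweight, i.e. $i\in\{1,\dots,\ell\}$ for type $A_\ell$; $i=1$ for $B_\ell$; $i=\ell$ for $C_\ell$; $i\in\{1,\ell-1,\ell\}$ for $D_\ell$; $i\in\{1,6\}$ for $E_6$; $i=7$ for $E_7$. Let $\sigma_X^{(i)}$ be the Weyl group element attached to $(X_\ell,i)$ in the list given in the context, and let $\mathbf{v}\in L(\lambda)\subset L(k,\lambda)$ be a highest weight vector of $L(k,\lambda)$. Then $\sigma_X^{(i)}(\mathbf{v})$ is a highest weight vector for the $\hat{\mathfrak{g}}$-module $(L(k,\lambda))^{(i)}=(L(k,\lambda))^{(H^{(i)})}$.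
   Context: **Finite-dimensional notation.** $\mathfrak{g}$ has rank $\ell$, Cartan subalgebra $\mathfrak{h}$, and invariant form $\langle\cdot,\cdot\rangle$ normalized so that long roots satisfy $\langle\alpha,\alpha\rangle=2$ (the form is transported between $\mathfrak{h}$ and $\mathfrak{h}^*$). Simple roots are $\alpha_1,\dots,\alpha_\ell$, simple coroots $H_1,\dots,H_\ell$, Chevalley generators $E_i,F_i,H_i$, with nodes numbered as in Bourbaki/Humphreys (in $B_\ell$, $\alpha_\ell$ is the short simple root; in $C_\ell$, $\alpha_\ell$ is the long simple root; in $D_\ell$, nodes $\ell-1,\ell$ are both joined to $\ell-2$; in $E_6,E_7$, the chain is $1,3,4,5,6,(7)$ and node $2$ is joined to $4$). Fundamental weights $\lambda_i$ satisfy $\lambda_i(H_j)=\delta_{ij}$, fundamental coweights $H^{(i)}$ satisfy $\alpha_i(H^{(j)})=\delta_{ij}$; $P^\vee=\bigoplus_i\mathbb{Z}H^{(i)}$; $P_+=\{\lambda\in\mathfrak{h}^*:\lambda(H_i)\in\mathbb{Z}_{\ge0}\ \forall i\}$. $\theta$ is the highest (long) root. $L(\lambda)$ is the irreducible $\mathfrak{g}$-module of highest weight $\lambda$. **Affine notation.** $\hat{\mathfrak{g}}=\mathfrak{g}\otimes\mathbb{C}[t,t^{-1}]\oplus\mathbb{C}c$ with $[a\otimes t^m,b\otimes t^n]=[a,b]\otimes t^{m+n}+m\langle a,b\rangle\delta_{m+n,0}c$ and $c$ central; $a(n)$ denotes the action of $a\otimes t^n$ on a module. Choose $E_\theta\in\mathfrak{g}_\theta$,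 $F_\theta\in\mathfrak{g}_{-\theta}$ with $\langle E_\theta,F_\theta\rangle=1$. The Chevalley generators $e_0,\dots,e_\ell$ of $\hat{\mathfrak{g}}$ are $e_0=F_\theta\otimes t$ and $e_i=E_i\otimes1$ ($1\le i\le\ell$). A highest weight vector of a $\hat{\mathfrak{g}}$-module is a nonzero vector that is a simultaneous eigenvector for $\mathfrak{h}\otimes 1$ and $c$ and is annihilated by $e_0,\dots,e_\ell$. $V(k,\lambda)=U(\hat{\mathfrak{g}})\otimes_{U(\mathfrak{g}\otimes\mathbb{C}[t]\oplus\mathbb{C}c)}L(\lambda)$, where $\mathfrak{g}\otimes t\mathbb{C}[t]$ acts on $L(\lambda)$ by $0$ and $c$ by $k$; $L(k,\lambda)$ is the quotient of $V(k,\lambda)$ by its maximal proper submodule. $L(\lambda)$ is identified with its copy in $L(k,\lambda)$ (the lowest conformal weight space). $L(k,0)$ is a vertex operator algebra with vacuum $\mathbf{1}$ (with $\mathfrak{g}$ identified with $\{a(-1)\mathbf{1}\}$ and $Y(a,x)=\sum_n a(n)x^{-n-1}$), and for $\lambda\in P_+$ with $\langle\lambda,\theta\rangle\le k$, $L(k,\lambda)$ is an irreducible $L(k,0)$-module. **Li's operators.** For $H\in P^\vee$ set $$\Delta(H,x)=x^{H(0)}\exp\Big(\sum_{n\ge1}\frac{H(n)}{-n}(-x)^{-n}\Big).$$ $(L(k,\lambda))^{(H)}$ is the $L(k,0)$-module with the same underlying vector space as $L(k,\lambda)$ and vertex operator map $Y^{(H)}(v,x)=Y(\Delta(H,x)v,x)$,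 $v\in L(k,0)$. It is a $\hat{\mathfrak{g}}$-module of level $k$ with $a\otimes t^n$ ($a\in\mathfrak{g}$) acting as the coefficient of $x^{-n-1}$ in $Y^{(H)}(a(-1)\mathbf{1},x)$. Write $(L(k,\lambda))^{(i)}=(L(k,\lambda))^{(H^{(i)})}$. **Weyl group.** $\sigma_i$ is the simple reflection in $\alpha_i$; products are compositions (rightmost acts first). For a Weyl group element $w$ and a highest weight vector $\mathbf{v}\in L(\lambda)_\lambda$, $w(\mathbf{v})$ denotes the corresponding nonzero vector in the one-dimensional weight space $L(\lambda)_{w(\lambda)}$ (well defined up to a nonzero scalar). **The elements $\sigma_X^{(i)}$.** - $A_\ell$: $\sigma_A^{(i)}=(\sigma_1\sigma_2\cdots\sigma_\ell)^i$, $1\le i\le\ell$. - $B_\ell$: $\sigma_B^{(1)}=\sigma_1\sigma_2\cdots\sigma_{\ell-1}\sigma_\ell\sigma_{\ell-1}\cdots\sigma_2\sigma_1$. - $C_\ell$: $\sigma_C^{(\ell)}=(\sigma_\ell\sigma_{\ell-1}\cdots\sigma_1)(\sigma_\ell\sigma_{\ell-1}\cdots\sigma_2)\cdots(\sigma_\ell\sigma_{\ell-1})(\sigma_\ell)$. - $D_\ell$: $\sigma_D^{(1)}=\sigma_1\sigma_2\cdots\sigma_{\ell-1}\sigma_\ell\,\sigma_{\ell-2}\sigma_{\ell-3}\cdots\sigma_2\sigma_1$. - $D_\ell$: $\sigma_D^{(\ell-1)}=B_1B_2\cdots B_{\ell-1}$, where for $1\le m\le\ell-2$, $B_m=\sigma_{\ell-1}\sigma_{\ell-2}\sigma_{\ell-3}\cdots\sigma_m$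 if $m$ is odd and $B_m=\sigma_\ell\sigma_{\ell-2}\sigma_{\ell-3}\cdots\sigma_m$ if $m$ is even, and the last block $B_{\ell-1}$ is $\sigma_{\ell-1}$ if $\ell$ is even and $\sigma_\ell$ if $\ell$ is odd. - $D_\ell$: $\sigma_D^{(\ell)}$ is obtained from $\sigma_D^{(\ell-1)}$ by interchanging $\sigma_{\ell-1}$ and $\sigma_\ell$ everywhere. - $E_6$: $\sigma_E^{(1)}=\sigma_1\sigma_3\sigma_4\sigma_2\sigma_5\sigma_4\sigma_3\sigma_1\sigma_6\sigma_5\sigma_4\sigma_2\sigma_3\sigma_4\sigma_5\sigma_6$. - $E_6$: $\sigma_E^{(6)}=\sigma_6\sigma_5\sigma_4\sigma_2\sigma_3\sigma_4\sigma_5\sigma_6\sigma_1\sigma_3\sigma_4\sigma_2\sigma_5\sigma_4\sigma_3\sigma_1$. - $E_7$: $\sigma_E^{(7)}=\sigma_7\sigma_6\sigma_5\sigma_4\sigma_3\sigma_2\sigma_4\sigma_5\sigma_6\sigma_7\sigma_1\sigma_3\sigma_4\sigma_5\sigma_6\sigma_2\sigma_4\sigma_5\sigma_3\sigma_4\sigma_1\sigma_3\sigma_2\sigma_4\sigma_5\sigma_6\sigma_7$. *)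

theory Defs
  imports Complex_Main "HOL-Library.Poly_Mapping" "HOL-Library.Product_Plus"
begin

section \<open>Complex vector spaces\<close>

text \<open>The complex analogue of the class \<open>real_vector\<close>, tied to the library locale
  \<^locale>\<open>vector_space\<close>.\<close>

class complex_vector = ab_group_add +
  fixes scaleC :: "complex \<Rightarrow> 'a \<Rightarrow> 'a"  (infixr "*\<^sub>C" 75)
  assumes scaleC_right_distrib: "a *\<^sub>C (x + y) = a *\<^sub>C x + a *\<^sub>C y"
    and scaleC_left_distrib: "(a + b) *\<^sub>C x = a *\<^sub>C x + b *\<^sub>C x"
    and scaleC_scaleC: "a *\<^sub>C b *\<^sub>C x = (a * b) *\<^sub>C x"
    and scaleC_one: "1 *\<^sub>C x = x"

global_interpretation complex_vector: vector_space "scaleC :: complex \<Rightarrow> 'a \<Rightarrow> 'a::complex_vector"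
  by standard
    (simp_all add: scaleC_right_distrib scaleC_left_distrib scaleC_scaleC scaleC_one)

instantiation complex :: complex_vector
begin

definition "scaleC a (x::complex) = a * x"

instance
  by standard (simp_all add: scaleC_complex_def algebra_simps)

end

instantiation prod :: (complex_vector, complex_vector) complex_vector
begin

definition "scaleC a p = (a *\<^sub>C fst p, a *\<^sub>C snd p)"

instance
  by standard
    (auto simp: scaleC_prod_def scaleC_right_distrib scaleC_left_distrib scaleC_scaleC scaleC_one)

end

instantiation poly_mapping :: (type, complex_vector) complex_vector
begin

definition "scaleC a p = Poly_Mapping.map (scaleC a) p"

lemma lookup_scaleC: "Poly_Mapping.lookup (a *\<^sub>C p) k = a *\<^sub>C Poly_Mapping.lookup p k"
  for p :: "'a \<Rightarrow>\<^sub>0 'b"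
  by (simp add: scaleC_poly_mapping_def Poly_Mapping.map.rep_eq when_def)

instance
  by standard
    (auto intro!: poly_mapping_eqI simp: lookup_scaleC Poly_Mapping.lookup_add
      scaleC_right_distrib scaleC_left_distrib scaleC_scaleC scaleC_one)

end

abbreviation lookup :: "('a \<Rightarrow>\<^sub>0 'b::zero) \<Rightarrow> 'a \<Rightarrow> 'b" where
  "lookup \<equiv> Poly_Mapping.lookup"

abbreviation keys :: "('a \<Rightarrow>\<^sub>0 'b::zero) \<Rightarrow> 'a set" where
  "keys \<equiv> Poly_Mapping.keys"

abbreviation clinear :: "('a::complex_vector \<Rightarrow> 'b::complex_vector) \<Rightarrow> bool" where
  "clinear \<equiv> Vector_Spaces.linear scaleC scaleC"

definition cbilinear ::
    "('a::complex_vector \<Rightarrow> 'b::complex_vector \<Rightarrow> 'c::complex_vector) \<Rightarrow> bool" where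
  "cbilinear f \<longleftrightarrow> (\<forall>x. clinear (f x)) \<and> (\<forall>y. clinear (\<lambda>x. f x y))"


section \<open>Lie algebras and their modules\<close>

definition lie_algebra :: "('g::complex_vector \<Rightarrow> 'g \<Rightarrow> 'g) \<Rightarrow> bool" where
  "lie_algebra br \<longleftrightarrow> cbilinear br \<and> (\<forall>x. br x x = 0) \<and>
     (\<forall>x y z. br x (br y z) + br y (br z x) + br z (br x y) = 0)"

definition lie_ideal :: "('g::complex_vector \<Rightarrow> 'g \<Rightarrow> 'g) \<Rightarrow> 'g set \<Rightarrow> bool" where
  "lie_ideal br I \<longleftrightarrow> complex_vector.subspace I \<and> (\<forall>x. \<forall>y\<in>I. br x y \<in> I)"

definition lie_subalgebra :: "('g::complex_vector \<Rightarrow> 'g \<Rightarrow> 'g) \<Rightarrow> 'g set \<Rightarrow> bool" where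
  "lie_subalgebra br S \<longleftrightarrow> complex_vector.subspace S \<and> (\<forall>x\<in>S. \<forall>y\<in>S. br x y \<in> S)"

definition simple_lie_algebra :: "('g::complex_vector \<Rightarrow> 'g \<Rightarrow> 'g) \<Rightarrow> bool" where
  "simple_lie_algebra br \<longleftrightarrow> lie_algebra br \<and> (\<exists>x y. br x y \<noteq> 0) \<and>
     (\<forall>I. lie_ideal br I \<longrightarrow> I = {0} \<or> I = UNIV)"

primrec lower_central :: "('g::complex_vector \<Rightarrow> 'g \<Rightarrow> 'g) \<Rightarrow> 'g set \<Rightarrow> nat \<Rightarrow> 'g set" where
  "lower_central br S 0 = S"
| "lower_central br S (Suc n) =
     complex_vector.span {br x y |x y. x \<in> S \<and> y \<in> lower_central br S n}"

definition cartan_subalgebra :: "('g::complex_vector \<Rightarrow> 'g \<Rightarrow> 'g) \<Rightarrow> 'g set \<Rightarrow> bool" where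
  "cartan_subalgebra br S \<longleftrightarrow> lie_subalgebra br S \<and> (\<exists>n. lower_central br S n = {0}) \<and>
     {x. \<forall>y\<in>S. br x y \<in> S} = S"

definition lie_module ::
    "('l::complex_vector \<Rightarrow> 'l \<Rightarrow> 'l) \<Rightarrow> ('l \<Rightarrow> 'v::complex_vector \<Rightarrow> 'v) \<Rightarrow> bool" where
  "lie_module br act \<longleftrightarrow> cbilinear act \<and>
     (\<forall>x y v. act (br x y) v = act x (act y v) - act y (act x v))"

definition submodule :: "('l \<Rightarrow> 'v::complex_vector \<Rightarrow> 'v) \<Rightarrow> 'v set \<Rightarrow> bool" where
  "submodule act S \<longleftrightarrow> complex_vector.subspace S \<and> (\<forall>x. \<forall>v\<in>S. act x v \<in> S)"

definition irreducible_module ::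
    "('l::complex_vector \<Rightarrow> 'l \<Rightarrow> 'l) \<Rightarrow> ('l \<Rightarrow> 'v::complex_vector \<Rightarrow> 'v) \<Rightarrow> bool" where
  "irreducible_module br act \<longleftrightarrow> lie_module br act \<and> (\<exists>v::'v. v \<noteq> 0) \<and>
     (\<forall>S. submodule act S \<longrightarrow> S = {0} \<or> S = UNIV)"

definition maximal_proper_submodule :: "('l \<Rightarrow> 'v::complex_vector \<Rightarrow> 'v) \<Rightarrow> 'v set \<Rightarrow> bool" where
  "maximal_proper_submodule act J \<longleftrightarrow> submodule act J \<and> J \<noteq> UNIV \<and>
     (\<forall>S. submodule act S \<and> S \<noteq> UNIV \<longrightarrow> S \<subseteq> J)"


section \<open>Dynkin types\<close>

datatype dynkin = Type_A nat | Type_B nat | Type_C nat | Type_D nat | Type_E6 | Type_E7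

fun dynkin_rank :: "dynkin \<Rightarrow> nat" where
  "dynkin_rank (Type_A l) = l"
| "dynkin_rank (Type_B l) = l"
| "dynkin_rank (Type_C l) = l"
| "dynkin_rank (Type_D l) = l"
| "dynkin_rank Type_E6 = 6"
| "dynkin_rank Type_E7 = 7"

text \<open>The ranges admit the low-rank coincidences \<open>C\<^sub>2 = B\<^sub>2\<close> (with the opposite numbering) and
  \<open>D\<^sub>3 = A\<^sub>3\<close> (with both nodes 2, 3 joined to 1).\<close>

fun valid_dynkin :: "dynkin \<Rightarrow> bool" where
  "valid_dynkin (Type_A l) \<longleftrightarrow> 1 \<le> l"
| "valid_dynkin (Type_B l) \<longleftrightarrow> 2 \<le> l"
| "valid_dynkin (Type_C l) \<longleftrightarrow> 2 \<le> l"
| "valid_dynkin (Type_D l) \<longleftrightarrow> 3 \<le> l"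
| "valid_dynkin Type_E6 \<longleftrightarrow> True"
| "valid_dynkin Type_E7 \<longleftrightarrow> True"

text \<open>\<open>cartan_entry X i j\<close> is \<open>\<alpha>\<^sub>i(H\<^sub>j)\<close>, with nodes numbered from 1 as in Bourbaki and Humphreys.\<close>

fun cartan_entry :: "dynkin \<Rightarrow> nat \<Rightarrow> nat \<Rightarrow> int" where
  "cartan_entry (Type_A l) i j =
     (if i = j then 2 else if j = i + 1 \<or> i = j + 1 then - 1 else 0)"
| "cartan_entry (Type_B l) i j =
     (if i = j then 2 else if i + 1 = l \<and> j = l then - 2
      else if j = i + 1 \<or> i = j + 1 then - 1 else 0)"
| "cartan_entry (Type_C l) i j =
     (if i = j then 2 else if i = l \<and> j + 1 = l then - 2
      else if j = i + 1 \<or> i = j + 1 then - 1 else 0)"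
| "cartan_entry (Type_D l) i j =
     (if i = j then 2
      else if {i, j} \<in> {{m, m + 1} |m. 1 \<le> m \<and> m \<le> l - 2} \<union> {{l - 2, l}} then - 1 else 0)"
| "cartan_entry Type_E6 i j =
     (if i = j then 2
      else if {i, j} \<in> {{1, 3}, {3, 4}, {4, 5}, {5, 6}, {2, 4}} then - 1 else 0)"
| "cartan_entry Type_E7 i j =
     (if i = j then 2
      else if {i, j} \<in> {{1, 3}, {3, 4}, {4, 5}, {5, 6}, {6, 7}, {2, 4}} then - 1 else 0)"

fun minuscule_nodes :: "dynkin \<Rightarrow> nat set" where
  "minuscule_nodes (Type_A l) = {1..l}"
| "minuscule_nodes (Type_B l) = {1}"
| "minuscule_nodes (Type_C l) = {l}"
| "minuscule_nodes (Type_D l) = {1, l - 1, l}"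
| "minuscule_nodes Type_E6 = {1, 6}"
| "minuscule_nodes Type_E7 = {7}"

text \<open>Weyl group elements are given by words: \<open>[i\<^sub>1, \<dots>, i\<^sub>r]\<close> stands for
  \<open>\<sigma>\<^bsub>i\<^sub>1\<^esub> \<cdots> \<sigma>\<^bsub>i\<^sub>r\<^esub>\<close>. Note that \<open>rev [m..<n]\<close> is \<open>n - 1, \<dots>, m\<close>.\<close>

definition D_block :: "nat \<Rightarrow> nat \<Rightarrow> nat list" where
  "D_block l m = (if odd m then l - 1 else l) # rev [m..<l - 1]"

definition D_spin_word :: "nat \<Rightarrow> nat list" where
  "D_spin_word l = concat (map (D_block l) [1..<l - 1]) @ [if even l then l - 1 else l]"

fun sigma_word :: "dynkin \<Rightarrow> nat \<Rightarrow> nat list" where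
  "sigma_word (Type_A l) i = concat (replicate i [1..<l + 1])"
| "sigma_word (Type_B l) i = [1..<l] @ [l] @ rev [1..<l]"
| "sigma_word (Type_C l) i = concat (map (\<lambda>m. rev [m..<l + 1]) [1..<l + 1])"
| "sigma_word (Type_D l) i =
     (if i = 1 then [1..<l + 1] @ rev [1..<l - 1]
      else if i = l - 1 then D_spin_word l
      else map (\<lambda>j. if j = l - 1 then l else if j = l then l - 1 else j) (D_spin_word l))"
| "sigma_word Type_E6 i =
     (if i = 1 then [1, 3, 4, 2, 5, 4, 3, 1, 6, 5, 4, 2, 3, 4, 5, 6]
      else [6, 5, 4, 2, 3, 4, 5, 6, 1, 3, 4, 2, 5, 4, 3, 1])"
| "sigma_word Type_E7 i =
     [7, 6, 5, 4, 3, 2, 4, 5, 6, 7, 1, 3, 4, 5, 6, 2, 4, 5, 3, 4, 1, 3, 2, 4, 5, 6, 7]"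


section \<open>Simple Lie algebras with Chevalley data\<close>

record 'g chevalley_data =
  bracket :: "'g \<Rightarrow> 'g \<Rightarrow> 'g"
  rank :: nat
  cartan :: "'g set"
  simple_root :: "nat \<Rightarrow> 'g \<Rightarrow> complex"
  coroot :: "nat \<Rightarrow> 'g"
  chev_E :: "nat \<Rightarrow> 'g"
  chev_F :: "nat \<Rightarrow> 'g"
  inv_form :: "'g \<Rightarrow> 'g \<Rightarrow> complex"
  highest_root :: "'g \<Rightarrow> complex"
  E_theta :: 'g
  F_theta :: 'g

text \<open>Elements of \<open>\<hh>\<^sup>*\<close> are functions on all of \<open>\<gg>\<close> that are linear on \<open>\<hh>\<close> and vanish off \<open>\<hh>\<close>
  (an extensionality convention, so that equal functionals are equal functions).\<close>

definition cartan_dual :: "('g::complex_vector) chevalley_data \<Rightarrow> ('g \<Rightarrow> complex) set" where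
  "cartan_dual G = {\<mu>. (\<forall>x\<in>cartan G. \<forall>y\<in>cartan G. \<mu> (x + y) = \<mu> x + \<mu> y) \<and>
     (\<forall>c. \<forall>x\<in>cartan G. \<mu> (c *\<^sub>C x) = c * \<mu> x) \<and> (\<forall>x. x \<notin> cartan G \<longrightarrow> \<mu> x = 0)}"

definition root_space :: "('g::complex_vector) chevalley_data \<Rightarrow> ('g \<Rightarrow> complex) \<Rightarrow> 'g set" where
  "root_space G \<alpha> = {x. \<forall>h\<in>cartan G. bracket G h x = \<alpha> h *\<^sub>C x}"

definition roots :: "('g::complex_vector) chevalley_data \<Rightarrow> ('g \<Rightarrow> complex) set" where
  "roots G = {\<alpha> \<in> cartan_dual G. \<alpha> \<noteq> (\<lambda>_. 0) \<and> root_space G \<alpha> \<noteq> {0}}"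

definition root_base :: "('g::complex_vector) chevalley_data \<Rightarrow> bool" where
  "root_base G \<longleftrightarrow> (\<forall>i\<in>{1..rank G}. simple_root G i \<in> roots G) \<and>
     (\<forall>c. (\<forall>h. (\<Sum>i=1..rank G. c i * simple_root G i h) = 0) \<longrightarrow> (\<forall>i\<in>{1..rank G}. c i = 0)) \<and>
     (\<forall>\<beta>\<in>roots G. \<exists>n :: nat \<Rightarrow> nat.
        \<beta> = (\<lambda>h. \<Sum>i=1..rank G. of_nat (n i) * simple_root G i h) \<or>
        \<beta> = (\<lambda>h. - (\<Sum>i=1..rank G. of_nat (n i) * simple_root G i h)))"

text \<open>The identification \<open>\<hh>\<^sup>* \<rightarrow> \<hh>\<close> given by the form, and the form on \<open>\<hh>\<^sup>*\<close>.\<close>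

definition form_rep :: "('g::complex_vector) chevalley_data \<Rightarrow> ('g \<Rightarrow> complex) \<Rightarrow> 'g" where
  "form_rep G \<mu> = (THE t. t \<in> cartan G \<and> (\<forall>h\<in>cartan G. inv_form G t h = \<mu> h))"

definition dual_form ::
    "('g::complex_vector) chevalley_data \<Rightarrow> ('g \<Rightarrow> complex) \<Rightarrow> ('g \<Rightarrow> complex) \<Rightarrow> complex" where
  "dual_form G \<mu> \<nu> = inv_form G (form_rep G \<mu>) (form_rep G \<nu>)"

text \<open>With the normalization \<open>\<langle>\<alpha>, \<alpha>\<rangle> = 2\<close> for long roots, \<open>dual_form\<close> is real and positive on roots,
  so that taking real parts to compare lengths is harmless.\<close>

definition long_root :: "('g::complex_vector) chevalley_data \<Rightarrow> ('g \<Rightarrow> complex) \<Rightarrow> bool" where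
  "long_root G \<alpha> \<longleftrightarrow> \<alpha> \<in> roots G \<and>
     (\<forall>\<beta>\<in>roots G. Re (dual_form G \<beta> \<beta>) \<le> Re (dual_form G \<alpha> \<alpha>))"

definition normalized_invariant_form :: "('g::complex_vector) chevalley_data \<Rightarrow> bool" where
  "normalized_invariant_form G \<longleftrightarrow> cbilinear (inv_form G) \<and>
     (\<forall>x y. inv_form G x y = inv_form G y x) \<and>
     (\<forall>x y z. inv_form G (bracket G x y) z = inv_form G x (bracket G y z)) \<and>
     (\<forall>x. (\<forall>y. inv_form G x y = 0) \<longrightarrow> x = 0) \<and>
     (\<forall>\<alpha>. long_root G \<alpha> \<longrightarrow> dual_form G \<alpha> \<alpha> = 2)"

definition is_highest_root :: "('g::complex_vector) chevalley_data \<Rightarrow> ('g \<Rightarrow> complex) \<Rightarrow> bool" where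
  "is_highest_root G \<theta> \<longleftrightarrow> \<theta> \<in> roots G \<and>
     (\<forall>\<beta>\<in>roots G. \<exists>n :: nat \<Rightarrow> nat.
        \<theta> = (\<lambda>h. \<beta> h + (\<Sum>i=1..rank G. of_nat (n i) * simple_root G i h)))"

definition simple_lie_algebra_of_type :: "dynkin \<Rightarrow> ('g::complex_vector) chevalley_data \<Rightarrow> bool" where
  "simple_lie_algebra_of_type X G \<longleftrightarrow>
     valid_dynkin X \<and> rank G = dynkin_rank X \<and>
     (\<exists>B::'g set. finite B \<and> complex_vector.span B = UNIV) \<and>
     simple_lie_algebra (bracket G) \<and>
     cartan_subalgebra (bracket G) (cartan G) \<and> complex_vector.dim (cartan G) = rank G \<and>
     root_base G \<and>
     (\<forall>i\<in>{1..rank G}.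
        chev_E G i \<in> root_space G (simple_root G i) \<and>
        chev_F G i \<in> root_space G (\<lambda>h. - simple_root G i h) \<and>
        coroot G i \<in> cartan G \<and> bracket G (chev_E G i) (chev_F G i) = coroot G i) \<and>
     (\<forall>i\<in>{1..rank G}. \<forall>j\<in>{1..rank G}.
        simple_root G i (coroot G j) = of_int (cartan_entry X i j)) \<and>
     (\<forall>S. lie_subalgebra (bracket G) S \<and> (\<forall>i\<in>{1..rank G}. chev_E G i \<in> S \<and> chev_F G i \<in> S)
        \<longrightarrow> S = UNIV) \<and>
     normalized_invariant_form G \<and>
     is_highest_root G (highest_root G) \<and>
     E_theta G \<in> root_space G (highest_root G) \<and>
     F_theta G \<in> root_space G (\<lambda>h. - highest_root G h) \<and>
     inv_form G (E_theta G) (F_theta G) = 1"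

definition fundamental_coweight :: "('g::complex_vector) chevalley_data \<Rightarrow> nat \<Rightarrow> 'g" where
  "fundamental_coweight G i = (THE H. H \<in> cartan G \<and>
     (\<forall>j\<in>{1..rank G}. simple_root G j H = (if j = i then 1 else 0)))"

definition dominant_integral :: "('g::complex_vector) chevalley_data \<Rightarrow> ('g \<Rightarrow> complex) set" where
  "dominant_integral G = {\<mu> \<in> cartan_dual G. \<forall>i\<in>{1..rank G}. \<exists>n::nat. \<mu> (coroot G i) = of_nat n}"

definition simple_reflection ::
    "('g::complex_vector) chevalley_data \<Rightarrow> nat \<Rightarrow> ('g \<Rightarrow> complex) \<Rightarrow> 'g \<Rightarrow> complex" where
  "simple_reflection G i \<mu> = (\<lambda>h. \<mu> h - \<mu> (coroot G i) * simple_root G i h)"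

definition weyl_action ::
    "('g::complex_vector) chevalley_data \<Rightarrow> nat list \<Rightarrow> ('g \<Rightarrow> complex) \<Rightarrow> 'g \<Rightarrow> complex" where
  "weyl_action G w \<mu> = foldr (simple_reflection G) w \<mu>"

text \<open>\<open>L(\<lambda>)\<close>, up to isomorphism.\<close>

definition irreducible_highest_weight_module ::
    "('g::complex_vector) chevalley_data \<Rightarrow> ('g \<Rightarrow> complex) \<Rightarrow> ('g \<Rightarrow> 'w::complex_vector \<Rightarrow> 'w) \<Rightarrow> bool"
  where
  "irreducible_highest_weight_module G \<mu> act \<longleftrightarrow> irreducible_module (bracket G) act \<and>
     (\<exists>w. w \<noteq> 0 \<and> (\<forall>h\<in>cartan G. act h w = \<mu> h *\<^sub>C w) \<and> (\<forall>i\<in>{1..rank G}. act (chev_E G i) w = 0))"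


section \<open>The affine Lie algebra and its modules\<close>

text \<open>\<open>(f, z)\<close> represents \<open>\<Sum>\<^sub>n f\<^sub>n \<otimes> t\<^sup>n + z c\<close>.\<close>

type_synonym 'g affine = "(int \<Rightarrow>\<^sub>0 'g) \<times> complex"

definition loop_elem :: "'g::complex_vector \<Rightarrow> int \<Rightarrow> 'g affine" where
  "loop_elem a n = (Poly_Mapping.single n a, 0)"

definition central_elem :: "('g::complex_vector) affine" where
  "central_elem = (0, 1)"

definition affine_bracket ::
    "('g::complex_vector) chevalley_data \<Rightarrow> 'g affine \<Rightarrow> 'g affine \<Rightarrow> 'g affine" where
  "affine_bracket G x y =
     (\<Sum>m\<in>keys (fst x). \<Sum>n\<in>keys (fst y).
        (Poly_Mapping.single (m + n) (bracket G (lookup (fst x) m) (lookup (fst y) n)),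
         if m + n = 0 then of_int m * inv_form G (lookup (fst x) m) (lookup (fst y) n) else 0))"

definition affine_highest_weight_vector ::
    "('g::complex_vector) chevalley_data \<Rightarrow> ('g affine \<Rightarrow> 'v::complex_vector \<Rightarrow> 'v) \<Rightarrow> 'v \<Rightarrow> bool" where
  "affine_highest_weight_vector G act v \<longleftrightarrow> v \<noteq> 0 \<and>
     (\<forall>h\<in>cartan G. \<exists>a. act (loop_elem h 0) v = a *\<^sub>C v) \<and>
     (\<exists>a. act central_elem v = a *\<^sub>C v) \<and>
     act (loop_elem (F_theta G) 1) v = 0 \<and>
     (\<forall>i\<in>{1..rank G}. act (loop_elem (chev_E G i) 0) v = 0)"

text \<open>\<open>V(k, \<lambda>) = U(\<gg>\<^sup>^) \<otimes>\<^bsub>U(\<pp>)\<^esub> W\<close> with \<open>\<pp> = \<gg> \<otimes> \<complex>[t] \<oplus> \<complex>c\<close> is presented as the quotient of the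
  space with basis all \<open>([x\<^sub>1, \<dots>, x\<^sub>r], w)\<close>, standing for \<open>x\<^sub>1 \<cdots> x\<^sub>r \<otimes> w\<close>, by the relations
  of the tensor algebra (multilinearity in the \<open>x\<^sub>i\<close>), of the enveloping algebra, of linearity
  in \<open>w\<close>, and of being balanced over \<open>U(\<pp>)\<close>. On \<open>W\<close> the subalgebra \<open>\<gg> \<otimes> t\<complex>[t]\<close> acts by 0
  and \<open>c\<close> acts by \<open>k\<close>.\<close>

definition parabolic :: "('g::complex_vector) affine set" where
  "parabolic = {x. keys (fst x) \<subseteq> {0..}}"

definition parabolic_action ::
    "complex \<Rightarrow> ('g::complex_vector \<Rightarrow> 'w::complex_vector \<Rightarrow> 'w) \<Rightarrow> 'g affine \<Rightarrow> 'w \<Rightarrow> 'w" where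
  "parabolic_action k act x w = act (lookup (fst x) 0) w + (snd x * k) *\<^sub>C w"

abbreviation pure_tensor :: "'l list \<Rightarrow> 'w \<Rightarrow> ('l list \<times> 'w) \<Rightarrow>\<^sub>0 complex" where
  "pure_tensor u w \<equiv> Poly_Mapping.single (u, w) 1"

definition induced_relations ::
    "('g::complex_vector) chevalley_data \<Rightarrow> complex \<Rightarrow> ('g \<Rightarrow> 'w::complex_vector \<Rightarrow> 'w) \<Rightarrow>
     (('g affine list \<times> 'w) \<Rightarrow>\<^sub>0 complex) set" where
  "induced_relations G k act = complex_vector.span (
     {pure_tensor (u @ [a *\<^sub>C x + b *\<^sub>C y] @ u') w
        - a *\<^sub>C pure_tensor (u @ [x] @ u') w - b *\<^sub>C pure_tensor (u @ [y] @ u') w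
        |u u' a b x y w. True} \<union>
     {pure_tensor (u @ [x, y] @ u') w - pure_tensor (u @ [y, x] @ u') w
        - pure_tensor (u @ [affine_bracket G x y] @ u') w |u u' x y w. True} \<union>
     {pure_tensor u (a *\<^sub>C w + b *\<^sub>C w') - a *\<^sub>C pure_tensor u w - b *\<^sub>C pure_tensor u w'
        |u a b w w'. True} \<union>
     {pure_tensor (u @ [p]) w - pure_tensor u (parabolic_action k act p w) |u p w. p \<in> parabolic})"

text \<open>The linear map \<open>x\<^sub>1 \<cdots> x\<^sub>r \<otimes> w \<mapsto> x\<^sub>1 (\<cdots> (x\<^sub>r (\<iota> w)))\<close>.\<close>

definition induced_eval ::
    "('l \<Rightarrow> 'v::complex_vector \<Rightarrow> 'v) \<Rightarrow> ('w \<Rightarrow> 'v) \<Rightarrow> (('l list \<times> 'w) \<Rightarrow>\<^sub>0 complex) \<Rightarrow> 'v" where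
  "induced_eval act \<iota> p = (\<Sum>(u, w)\<in>keys p. lookup p (u, w) *\<^sub>C foldr act u (\<iota> w))"

text \<open>\<open>(actV, \<iota>)\<close> is (isomorphic to) \<open>V(k, \<lambda>)\<close> with the map \<open>w \<mapsto> 1 \<otimes> w\<close>, where \<open>actW\<close> is \<open>L(\<lambda>)\<close>.\<close>

definition induced_module ::
    "('g::complex_vector) chevalley_data \<Rightarrow> complex \<Rightarrow> ('g \<Rightarrow> 'w::complex_vector \<Rightarrow> 'w) \<Rightarrow>
     ('g affine \<Rightarrow> 'v::complex_vector \<Rightarrow> 'v) \<Rightarrow> ('w \<Rightarrow> 'v) \<Rightarrow> bool" where
  "induced_module G k actW actV \<iota> \<longleftrightarrow> lie_module (affine_bracket G) actV \<and> clinear \<iota> \<and>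
     surj (induced_eval actV \<iota>) \<and> {p. induced_eval actV \<iota> p = 0} = induced_relations G k actW"

text \<open>\<open>(actM, q)\<close> is (isomorphic to) the quotient of the module \<open>actV\<close> by its maximal proper
  submodule, with quotient map \<open>q\<close>.\<close>

definition irreducible_quotient ::
    "('g::complex_vector) chevalley_data \<Rightarrow> ('g affine \<Rightarrow> 'v::complex_vector \<Rightarrow> 'v) \<Rightarrow>
     ('g affine \<Rightarrow> 'm::complex_vector \<Rightarrow> 'm) \<Rightarrow> ('v \<Rightarrow> 'm) \<Rightarrow> bool" where
  "irreducible_quotient G actV actM q \<longleftrightarrow> lie_module (affine_bracket G) actM \<and> clinear q \<and> surj q \<and>
     (\<forall>x v. q (actV x v) = actM x (q v)) \<and> maximal_proper_submodule actV {v. q v = 0}"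

text \<open>\<open>N\<close> is the copy of \<open>L(\<lambda>)\<close> inside an affine module.\<close>

definition weight_space ::
    "('g::complex_vector) chevalley_data \<Rightarrow> ('g affine \<Rightarrow> 'm::complex_vector \<Rightarrow> 'm) \<Rightarrow> 'm set \<Rightarrow>
     ('g \<Rightarrow> complex) \<Rightarrow> 'm set" where
  "weight_space G act N \<mu> = {v \<in> N. \<forall>h\<in>cartan G. act (loop_elem h 0) v = \<mu> h *\<^sub>C v}"

text \<open>\<open>u\<close> is a representative of \<open>w(v)\<close>, which is defined up to a nonzero scalar.\<close>

definition weyl_translate ::
    "('g::complex_vector) chevalley_data \<Rightarrow> ('g affine \<Rightarrow> 'm::complex_vector \<Rightarrow> 'm) \<Rightarrow> 'm set \<Rightarrow>
     ('g \<Rightarrow> complex) \<Rightarrow> nat list \<Rightarrow> 'm \<Rightarrow> 'm \<Rightarrow> bool" where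
  "weyl_translate G act N \<mu> w v u \<longleftrightarrow> v \<in> weight_space G act N \<mu> - {0} \<and>
     u \<in> weight_space G act N (weyl_action G w \<mu>) - {0}"


section \<open>Vertex operator algebras and modules\<close>

text \<open>A vertex operator map \<open>Y(v, x) = \<Sum>\<^sub>n v\<^sub>n x\<^bsup>-n-1\<^esup>\<close> is given by its modes: \<open>Y v n = v\<^sub>n\<close>.
  The Jacobi identity is stated through its coefficients; by truncation all sums are finite.\<close>

definition jacobi_identity ::
    "('v::complex_vector \<Rightarrow> int \<Rightarrow> 'v \<Rightarrow> 'v) \<Rightarrow> ('v \<Rightarrow> int \<Rightarrow> 'm::complex_vector \<Rightarrow> 'm) \<Rightarrow> bool" where
  "jacobi_identity Y YM \<longleftrightarrow> (\<forall>u v w l m n.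
     Sum_any (\<lambda>i::nat. (of_int m gchoose i) *\<^sub>C YM (Y u (l + int i) v) (m + n - int i) w) =
     Sum_any (\<lambda>i::nat. ((- 1) ^ i * (of_int l gchoose i)) *\<^sub>C
       (YM u (m + l - int i) (YM v (n + int i) w)
        - ((- 1) powi l) *\<^sub>C YM v (n + l - int i) (YM u (m + int i) w))))"

definition truncated :: "('v \<Rightarrow> int \<Rightarrow> 'm::complex_vector \<Rightarrow> 'm) \<Rightarrow> bool" where
  "truncated YM \<longleftrightarrow> (\<forall>v w. \<exists>N. \<forall>n\<ge>N. YM v n w = 0)"

definition virasoro ::
    "('v \<Rightarrow> int \<Rightarrow> 'm::complex_vector \<Rightarrow> 'm) \<Rightarrow> 'v \<Rightarrow> complex \<Rightarrow> bool" where
  "virasoro YM \<omega> c \<longleftrightarrow> (\<forall>m n w.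
     YM \<omega> (m + 1) (YM \<omega> (n + 1) w) - YM \<omega> (n + 1) (YM \<omega> (m + 1) w) =
     of_int (m - n) *\<^sub>C YM \<omega> (m + n + 1) w
     + (if m + n = 0 then (of_int (m ^ 3 - m) / 12 * c) *\<^sub>C w else 0))"

definition conformal_space ::
    "('v \<Rightarrow> int \<Rightarrow> 'm::complex_vector \<Rightarrow> 'm) \<Rightarrow> 'v \<Rightarrow> complex \<Rightarrow> 'm set" where
  "conformal_space YM \<omega> d = {w. YM \<omega> 1 w = d *\<^sub>C w}"

definition finite_dim :: "('m::complex_vector) set \<Rightarrow> bool" where
  "finite_dim S \<longleftrightarrow> (\<exists>B. finite B \<and> S \<subseteq> complex_vector.span B)"

text \<open>The grading of a vertex operator algebra is the one by \<open>L(0)\<close>-eigenvalues.\<close>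

definition vertex_operator_algebra ::
    "('v::complex_vector \<Rightarrow> int \<Rightarrow> 'v \<Rightarrow> 'v) \<Rightarrow> 'v \<Rightarrow> 'v \<Rightarrow> complex \<Rightarrow> bool" where
  "vertex_operator_algebra Y vac \<omega> c \<longleftrightarrow>
     (\<forall>n. cbilinear (\<lambda>v w. Y v n w)) \<and> truncated Y \<and>
     (\<forall>n w. Y vac n w = (if n = - 1 then w else 0)) \<and>
     (\<forall>v. Y v (- 1) vac = v \<and> (\<forall>n\<ge>0. Y v n vac = 0)) \<and>
     jacobi_identity Y Y \<and> virasoro Y \<omega> c \<and>
     (\<forall>v n w. Y (Y \<omega> 0 v) n w = (- of_int n) *\<^sub>C Y v (n - 1) w) \<and>
     complex_vector.span (\<Union>d::int. conformal_space Y \<omega> (of_int d)) = UNIV \<and>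
     (\<forall>d::int. finite_dim (conformal_space Y \<omega> (of_int d))) \<and>
     (\<exists>N::int. \<forall>d<N. conformal_space Y \<omega> (of_int d) = {0})"

definition voa_module ::
    "('v::complex_vector \<Rightarrow> int \<Rightarrow> 'v \<Rightarrow> 'v) \<Rightarrow> 'v \<Rightarrow> 'v \<Rightarrow> complex \<Rightarrow>
     ('v \<Rightarrow> int \<Rightarrow> 'm::complex_vector \<Rightarrow> 'm) \<Rightarrow> bool" where
  "voa_module Y vac \<omega> c YM \<longleftrightarrow>
     (\<forall>n. cbilinear (\<lambda>v w. YM v n w)) \<and> truncated YM \<and>
     (\<forall>n w. YM vac n w = (if n = - 1 then w else 0)) \<and>
     jacobi_identity Y YM \<and> virasoro YM \<omega> c \<and>
     (\<forall>v n w. YM (Y \<omega> 0 v) n w = (- of_int n) *\<^sub>C YM v (n - 1) w) \<and>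
     complex_vector.span (\<Union>d. conformal_space YM \<omega> d) = UNIV \<and>
     (\<forall>d. finite_dim (conformal_space YM \<omega> d)) \<and>
     (\<forall>d. \<exists>N::int. \<forall>n<N. conformal_space YM \<omega> (d + of_int n) = {0})"

text \<open>The vertex operators of the generators \<open>a(-1)\<one>\<close> are \<open>\<Sum>\<^sub>n a(n) x\<^bsup>-n-1\<^esup>\<close>; here \<open>act0\<close> is the
  affine action on the vertex operator algebra and \<open>act\<close> the one on the module.\<close>

definition extends_affine_action ::
    "('g::complex_vector affine \<Rightarrow> 'v \<Rightarrow> 'v) \<Rightarrow> 'v \<Rightarrow> ('g affine \<Rightarrow> 'm \<Rightarrow> 'm) \<Rightarrow>
     ('v \<Rightarrow> int \<Rightarrow> 'm \<Rightarrow> 'm) \<Rightarrow> bool" where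
  "extends_affine_action act0 vac act YM \<longleftrightarrow>
     (\<forall>a n w. YM (act0 (loop_elem a (- 1)) vac) n w = act (loop_elem a n) w)"


section \<open>Li's operators\<close>

text \<open>\<open>li_exp_power act H r s\<close> is the coefficient of \<open>x\<^bsup>-s\<^esup>\<close> in
  \<open>(\<Sum>\<^bsub>n\<ge>1\<^esub> H(n)/(-n) (-x)\<^bsup>-n\<^esup>)\<^sup>r\<close>, where \<open>(-x)\<^bsup>-n\<^esup> = (-1)\<^sup>n x\<^bsup>-n\<^esup>\<close>; it vanishes for \<open>r > s\<close>, so that
  \<open>li_exp act H s\<close> is the coefficient of \<open>x\<^bsup>-s\<^esup>\<close> in the exponential.\<close>

primrec li_exp_power ::
    "('g::complex_vector affine \<Rightarrow> 'v::complex_vector \<Rightarrow> 'v) \<Rightarrow> 'g \<Rightarrow> nat \<Rightarrow> nat \<Rightarrow> 'v \<Rightarrow> 'v" where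
  "li_exp_power act H 0 s v = (if s = 0 then v else 0)"
| "li_exp_power act H (Suc r) s v =
     (\<Sum>n=1..s. ((- 1) ^ n / (- of_nat n)) *\<^sub>C
        act (loop_elem H (int n)) (li_exp_power act H r (s - n) v))"

definition li_exp ::
    "('g::complex_vector affine \<Rightarrow> 'v::complex_vector \<Rightarrow> 'v) \<Rightarrow> 'g \<Rightarrow> nat \<Rightarrow> 'v \<Rightarrow> 'v" where
  "li_exp act H s v = (\<Sum>r\<le>s. (1 / fact r) *\<^sub>C li_exp_power act H r s v)"

text \<open>\<open>x\<^bsup>H(0)\<^esup> v = \<Sum>\<^sub>j x\<^sup>j v\<^sub>j\<close>, where \<open>v = \<Sum>\<^sub>j v\<^sub>j\<close> is the decomposition of \<open>v\<close> into eigenvectors of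
  \<open>H(0)\<close> with integer eigenvalues \<open>j\<close>; it is unique, and it exists in \<open>L(k, 0)\<close> for \<open>H\<close> in
  the coweight lattice.\<close>

definition eigen_decomposition ::
    "('g::complex_vector affine \<Rightarrow> 'v::complex_vector \<Rightarrow> 'v) \<Rightarrow> 'g \<Rightarrow> 'v \<Rightarrow> int \<Rightarrow>\<^sub>0 'v" where
  "eigen_decomposition act H v = (THE d.
     (\<forall>j. act (loop_elem H 0) (lookup d j) = of_int j *\<^sub>C lookup d j) \<and>
     (\<Sum>j\<in>keys d. lookup d j) = v)"

text \<open>\<open>li_delta act H p v\<close> is the coefficient of \<open>x\<^sup>p\<close> in \<open>\<Delta>(H, x)v\<close>, and \<open>li_twist\<close> gives the modes
  of \<open>Y\<^bsup>(H)\<^esup>(v, x) = Y(\<Delta>(H, x)v, x)\<close>. Both sums have finitely many nonzero terms.\<close>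

definition li_delta ::
    "('g::complex_vector affine \<Rightarrow> 'v::complex_vector \<Rightarrow> 'v) \<Rightarrow> 'g \<Rightarrow> int \<Rightarrow> 'v \<Rightarrow> 'v" where
  "li_delta act H p v =
     Sum_any (\<lambda>s::nat. lookup (eigen_decomposition act H (li_exp act H s v)) (p + int s))"

definition li_twist ::
    "('g::complex_vector affine \<Rightarrow> 'v::complex_vector \<Rightarrow> 'v) \<Rightarrow>
     ('v \<Rightarrow> int \<Rightarrow> 'm::complex_vector \<Rightarrow> 'm) \<Rightarrow> 'g \<Rightarrow> 'v \<Rightarrow> int \<Rightarrow> 'm \<Rightarrow> 'm" where
  "li_twist act0 YM H v n w = Sum_any (\<lambda>p::int. YM (li_delta act0 H p v) (n + p) w)"

definition twisted_affine_action ::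
    "complex \<Rightarrow> ('g::complex_vector affine \<Rightarrow> 'v::complex_vector \<Rightarrow> 'v) \<Rightarrow> 'v \<Rightarrow>
     ('v \<Rightarrow> int \<Rightarrow> 'm::complex_vector \<Rightarrow> 'm) \<Rightarrow> 'g \<Rightarrow> 'g affine \<Rightarrow> 'm \<Rightarrow> 'm" where
  "twisted_affine_action k act0 vac YM H x w =
     (\<Sum>n\<in>keys (fst x). li_twist act0 YM H (act0 (loop_elem (lookup (fst x) n) (- 1)) vac) n w)
     + (snd x * k) *\<^sub>C w"

end

theory Submission
  imports Defs
begin

text \<open>Let \<open>w\<close> be the Weyl group element and \<open>H\<close> the minuscule coweight. In the twisted module a root
  vector \<open>a \<otimes> t\<^sup>n\<close> of root \<open>\<beta>\<close> acts as \<open>a(n + \<beta>(H))\<close>, and \<open>h(0)\<close> acts as \<open>h(0) + k\<langle>H, h\<rangle>\<close>. Hence on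
  \<open>w(v)\<close> the generators \<open>e\<^sub>j\<close>, \<open>j \<noteq> i\<close>, act by \<open>E\<^sub>j(0)\<close>, \<open>e\<^sub>i\<close> acts by \<open>E\<^sub>i(1)\<close>, which kills the top space
  \<open>L(\<lambda>)\<close>, and \<open>e\<^sub>0\<close> acts by \<open>F\<^sub>\<theta>(0)\<close>, because \<open>\<theta>(H) = 1\<close>. The vectors \<open>E\<^sub>j w(v)\<close> and \<open>F\<^sub>\<theta> w(v)\<close> have
  weights in the orbits of \<open>\<lambda> + w\<^sup>-\<^sup>1\<alpha>\<^sub>j\<close> and \<open>\<lambda> - w\<^sup>-\<^sup>1\<theta>\<close>. The set of weights of \<open>L(\<lambda>)\<close> is stable under
  reflections and lies below \<open>\<lambda>\<close>, so these vectors vanish once \<open>w\<^sup>-\<^sup>1\<alpha>\<^sub>j\<close> has a positive coefficient and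
  \<open>w\<^sup>-\<^sup>1\<theta>\<close> a negative one. The latter holds because for some \<open>i'\<close> the coefficient of \<open>\<alpha>\<^bsub>i'\<^esub>\<close> vanishes
  in \<open>w\<^sup>-\<^sup>1\<alpha>\<^sub>j\<close> for all \<open>j \<noteq> i\<close> and is negative in \<open>w\<^sup>-\<^sup>1\<alpha>\<^sub>i\<close>.\<close>

section \<open>Modules of Lie algebras and \<open>sl\<^sub>2\<close>-theory\<close>

text \<open>Two points of the outline are not formal. Stability of the weights under reflections
  requires \<open>E j\<close> and \<open>F j\<close> to act locally nilpotently; for
  \<open>F j\<close> this comes from dominance, because F_j^(N+1) kills the highest weight vector
  when N = \<lambda>(H_j). And \<theta>(H) = 1 concerns a root known only by its maximality, so its
  coefficients cannot be read off the type. They are bounded for all positive roots at once: these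
  arise from simple roots by reflections, so a reflection-stable property of coordinate vectors that
  holds at the simple roots holds at \<theta>. The type-by-type work, including the evaluation of
  w^-1, thus takes place on integer vectors. On the Lie algebra side, the fact that a subalgebra
  containing the Chevalley generators is everything replaces the root space decomposition.\<close>

lemma clinear_iff:
  "clinear f \<longleftrightarrow> (\<forall>x y. f (x + y) = f x + f y) \<and> (\<forall>c x. f (c *\<^sub>C x) = c *\<^sub>C f x)"
  unfolding Vector_Spaces.linear_iff by (simp add: complex_vector.vector_space_axioms)

lemma clinear_zero: "clinear f \<Longrightarrow> f 0 = 0"
  unfolding clinear_iff by (metis add_cancel_right_left)

lemma clinear_diff: "clinear f \<Longrightarrow> f (x - y) = f x - f y"
  unfolding clinear_iff by (metis add_diff_cancel_right' diff_add_cancel)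

lemma clinear_minus: "clinear f \<Longrightarrow> f (- x) = - f x"
  using clinear_diff[of f 0 x] clinear_zero[of f] by simp

text \<open>Independence of eigenvectors for a family of operators. In the induction on a finite
  subset, T_t - c(t) removes \<open>b\<close> and preserves the span of the other vectors, but
  rescales \<open>x\<close> by the nonzero number \<mu> t - c t. The family is the Cartan subalgebra
  in one use and a single operator in others.\<close>

lemma eigenvector_not_in_span:
  assumes lin: "\<And>t. t \<in> C \<Longrightarrow> clinear (T t)"
    and B: "\<And>b. b \<in> B \<Longrightarrow> \<exists>c. (\<forall>t\<in>C. T t b = c t *\<^sub>C b) \<and> (\<exists>t\<in>C. c t \<noteq> \<mu> t)"
    and x: "x \<in> complex_vector.span B" "\<And>t. t \<in> C \<Longrightarrow> T t x = \<mu> t *\<^sub>C x"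
  shows "x = 0"
proof -
  obtain F where F: "finite F" "F \<subseteq> B" "x \<in> complex_vector.span F"
  proof -
    obtain F r where "finite F" "F \<subseteq> B" "x = (\<Sum>a\<in>F. r a *\<^sub>C a)"
      using x(1) unfolding complex_vector.span_explicit by blast
    moreover have "(\<Sum>a\<in>F. r a *\<^sub>C a) \<in> complex_vector.span F"
      by (intro complex_vector.span_sum complex_vector.span_scale complex_vector.span_base)
    ultimately show ?thesis using that by blast
  qed
  from F show ?thesis
    using x(2)
  proof (induction F arbitrary: x rule: finite_induct)
    case (insert b F)
    obtain c t where c: "\<And>t. t \<in> C \<Longrightarrow> T t b = c t *\<^sub>C b" and t: "t \<in> C" "c t \<noteq> \<mu> t"
      using B[of b] insert.prems(1) by blast
    obtain a where a: "x - a *\<^sub>C b \<in> complex_vector.span F"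
      using insert.prems(2) complex_vector.span_breakdown[of b "insert b F" x] insert.hyps(2) by auto
    define S where "S = {y. T t y - c t *\<^sub>C y \<in> complex_vector.span F}"
    have lint: "clinear (T t)" by (rule lin[OF t(1)])
    have S_add: "u + v \<in> S" if "u \<in> S" "v \<in> S" for u v
    proof -
      have "T t (u + v) - c t *\<^sub>C (u + v) = (T t u - c t *\<^sub>C u) + (T t v - c t *\<^sub>C v)"
        using lint by (simp add: clinear_iff complex_vector.scale_right_distrib)
      with that show ?thesis unfolding S_def mem_Collect_eq by (simp only: complex_vector.span_add)
    qed
    have S_scale: "d *\<^sub>C u \<in> S" if "u \<in> S" for d u
    proof -
      have "T t (d *\<^sub>C u) - c t *\<^sub>C d *\<^sub>C u = d *\<^sub>C (T t u - c t *\<^sub>C u)"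
        using lint by (simp add: clinear_iff complex_vector.scale_right_diff_distrib mult.commute)
      with that show ?thesis unfolding S_def mem_Collect_eq by (simp only: complex_vector.span_scale)
    qed
    have "0 \<in> S" unfolding S_def by (simp add: clinear_zero[OF lint] complex_vector.span_zero)
    with S_add S_scale have "complex_vector.subspace S"
      unfolding complex_vector.subspace_def by blast
    moreover have "F \<subseteq> S"
    proof
      fix y assume y: "y \<in> F"
      obtain e where "T t y = e *\<^sub>C y" using B[of y] insert.prems(1) y t(1) by blast
      hence "T t y - c t *\<^sub>C y = (e - c t) *\<^sub>C y" by (simp add: complex_vector.scale_left_diff_distrib)
      thus "y \<in> S" unfolding S_def using y by (simp add: complex_vector.span_base complex_vector.span_scale)
    qed
    ultimately have "x - a *\<^sub>C b \<in> S"
      using a complex_vector.span_minimal by blast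
    moreover have "T t (x - a *\<^sub>C b) - c t *\<^sub>C (x - a *\<^sub>C b) = (\<mu> t - c t) *\<^sub>C x"
      using lint insert.prems(3)[OF t(1)] c[OF t(1)]
      by (simp add: clinear_diff clinear_iff algebra_simps)
    ultimately have "(1 / (\<mu> t - c t)) *\<^sub>C ((\<mu> t - c t) *\<^sub>C x) \<in> complex_vector.span F"
      unfolding S_def by (simp del: complex_vector.scale_scale add: complex_vector.span_scale)
    hence "x \<in> complex_vector.span F" using t(2) by simp
    thus ?case using insert.IH insert.prems by blast
  qed simp
qed

locale lie_mod =
  fixes br :: "'l::complex_vector \<Rightarrow> 'l \<Rightarrow> 'l" and act :: "'l \<Rightarrow> 'v::complex_vector \<Rightarrow> 'v"
  assumes lie_module: "lie_module br act"
begin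

lemma act_clinear: "clinear (act x)" "clinear (\<lambda>x. act x v)"
  using lie_module unfolding lie_module_def cbilinear_def by auto

lemma act_simps [simp]:
  "act x (v + w) = act x v + act x w" "act x (c *\<^sub>C v) = c *\<^sub>C act x v" "act x 0 = 0"
  "act x (v - w) = act x v - act x w" "act x (- v) = - act x v"
  "act (x + y) v = act x v + act y v" "act (c *\<^sub>C x) v = c *\<^sub>C act x v" "act 0 v = 0"
  "act (x - y) v = act x v - act y v" "act (- x) v = - act x v"
  by (simp_all add: clinear_zero[OF act_clinear(1)] clinear_zero[OF act_clinear(2)]
      clinear_diff[OF act_clinear(1)] clinear_diff[OF act_clinear(2)]
      clinear_minus[OF act_clinear(1)] clinear_minus[OF act_clinear(2)]
      act_clinear[unfolded clinear_iff])

lemma act_br: "act (br x y) v = act x (act y v) - act y (act x v)"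
  using lie_module unfolding lie_module_def by blast

lemma act_swap: "act x (act y v) = act y (act x v) + act (br x y) v"
  by (simp add: act_br)

lemma funpow_act [simp]:
  "(act a ^^ p) (v + w) = (act a ^^ p) v + (act a ^^ p) w"
  "(act a ^^ p) (c *\<^sub>C v) = c *\<^sub>C (act a ^^ p) v" "(act a ^^ p) 0 = 0"
  by (induction p) auto

lemma funpow_act_eq_0_mono: "(act a ^^ p) v = 0 \<Longrightarrow> p \<le> q \<Longrightarrow> (act a ^^ q) v = 0"
  using funpow_add[of "q - p" p "act a"] by simp

section \<open>The sl_2-strings through a weight vector\<close>

lemma sl2_ladder:
  assumes ef: "br e f = h" and hf: "br h f = (- 2) *\<^sub>C f"
    and y: "act e y = 0" "act h y = N *\<^sub>C y"
  shows "act h ((act f ^^ n) y) = (N - 2 * of_nat n) *\<^sub>C (act f ^^ n) y"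
    and "act e ((act f ^^ Suc n) y) = (of_nat (Suc n) * (N - of_nat n)) *\<^sub>C (act f ^^ n) y"
proof -
  show h: "act h ((act f ^^ n) y) = (N - 2 * of_nat n) *\<^sub>C (act f ^^ n) y" for n
  proof (induction n)
    case (Suc n)
    have "act h ((act f ^^ Suc n) y) = act f (act h ((act f ^^ n) y)) + act (br h f) ((act f ^^ n) y)"
      by (simp add: act_swap[of h f])
    also have "\<dots> = ((N - 2 * of_nat n) + (- 2)) *\<^sub>C (act f ^^ Suc n) y"
      by (simp only: Suc hf act_simps complex_vector.scale_left_distrib funpow.simps o_apply)
    also have "(N - 2 * of_nat n) + (- 2) = N - 2 * of_nat (Suc n)" by simp
    finally show ?case .
  qed (simp add: y)
  show "act e ((act f ^^ Suc n) y) = (of_nat (Suc n) * (N - of_nat n)) *\<^sub>C (act f ^^ n) y"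
  proof (induction n)
    case (Suc n)
    have "act e ((act f ^^ Suc (Suc n)) y) = act f (act e ((act f ^^ Suc n) y)) + act (br e f) ((act f ^^ Suc n) y)"
      by (simp add: act_swap[of e f])
    also have "\<dots> = (of_nat (Suc n) * (N - of_nat n) + (N - 2 * of_nat (Suc n))) *\<^sub>C (act f ^^ Suc n) y"
      unfolding Suc ef h act_simps complex_vector.scale_left_distrib by simp
    also have "of_nat (Suc n) * (N - of_nat n) + (N - 2 * of_nat (Suc n))
        = of_nat (Suc (Suc n)) * (N - of_nat (Suc n))"
      by (simp add: algebra_simps)
    finally show ?case .
  qed (simp add: act_swap[of e f] ef y)
qed

lemma act_funpow_raise:
  assumes he: "br h e = 2 *\<^sub>C e" and x: "act h x = c *\<^sub>C x"
  shows "act h ((act e ^^ n) x) = (c + 2 * of_nat n) *\<^sub>C (act e ^^ n) x"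
proof (induction n)
  case (Suc n)
  show ?case using Suc he by (simp add: act_swap[of h e] algebra_simps)
qed (simp add: x)

text \<open>Climb with \<open>e\<close> to a vector y that \<open>e\<close> kills, and let K be the
  last power with f^K y nonzero; the ladder formula at K + 1 forces the weight c + 2p of y to equal
  K. If m >= 0, then p + m = K - p is at most K, so the vector in the second part is nonzero; its
  weight -m is the reflected one.\<close>

lemma sl2_weight_integral:
  assumes ef: "br e f = h" and he: "br h e = 2 *\<^sub>C e" and hf: "br h f = (- 2) *\<^sub>C f"
    and x: "x \<noteq> 0" "act h x = c *\<^sub>C x"
    and nil: "\<And>v. \<exists>p. (act e ^^ p) v = 0" "\<And>v. \<exists>p. (act f ^^ p) v = 0"
  shows "\<exists>m::int. c = of_int m \<and> (0 \<le> m \<longrightarrow> (\<exists>p. (act f ^^ (p + nat m)) ((act e ^^ p) x) \<noteq> 0))"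
proof -
  have top: "\<exists>p. (act a ^^ p) v \<noteq> 0 \<and> (act a ^^ Suc p) v = 0" if "\<exists>p. (act a ^^ p) v = 0" "v \<noteq> 0" for a v
  proof -
    define q where "q = (LEAST p. (act a ^^ p) v = 0)"
    have q: "(act a ^^ q) v = 0" "\<And>p. p < q \<Longrightarrow> (act a ^^ p) v \<noteq> 0"
      unfolding q_def using that(1) by (auto intro: LeastI_ex dest: not_less_Least)
    have "q \<noteq> 0" using q(1) that(2) by (metis funpow_0)
    then obtain p where "q = Suc p" by (cases q) auto
    thus ?thesis using q by blast
  qed
  obtain p where p: "(act e ^^ p) x \<noteq> 0" "(act e ^^ Suc p) x = 0"
    using top[OF nil(1) x(1)] by blast
  define y where "y = (act e ^^ p) x"
  have y: "y \<noteq> 0" "act e y = 0" "act h y = (c + 2 * of_nat p) *\<^sub>C y"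
    using p act_funpow_raise[OF he x(2)] by (auto simp: y_def)
  note ladder = sl2_ladder[OF ef hf y(2,3)]
  obtain K where K: "(act f ^^ K) y \<noteq> 0" "(act f ^^ Suc K) y = 0"
    using top[OF nil(2) y(1)] by blast
  have "(of_nat (Suc K) * (c + 2 * of_nat p - of_nat K)) *\<^sub>C (act f ^^ K) y = 0"
    using ladder(2)[of K] K(2) by simp
  hence "c + 2 * of_nat p - of_nat K = 0"
    using K(1) unfolding complex_vector.scale_eq_0_iff mult_eq_0_iff by (simp del: of_nat_Suc)
  hence c: "c = of_int (int K - 2 * int p)" by (simp add: algebra_simps)
  show ?thesis
  proof (intro exI[of _ "int K - 2 * int p"] conjI impI c)
    assume "0 \<le> int K - 2 * int p"
    hence "p + nat (int K - 2 * int p) \<le> K" by linarith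
    hence "(act f ^^ (p + nat (int K - 2 * int p))) y \<noteq> 0"
      using K(1) funpow_act_eq_0_mono by blast
    thus "\<exists>q. (act f ^^ (q + nat (int K - 2 * int p))) ((act e ^^ q) x) \<noteq> 0"
      unfolding y_def by blast
  qed
qed

text \<open>By the Leibniz rule each term has \<open>a\<close> acting r times on \<open>b\<close>
  and s times on \<open>v\<close> with r + s = p + q, so r >= p or s >= q. Induction on p + q avoids
  binomial coefficients.\<close>

lemma funpow_act_act_eq_0:
  "(br a ^^ p) b = 0 \<Longrightarrow> (act a ^^ q) v = 0 \<Longrightarrow> (act a ^^ (p + q)) (act b v) = 0"
proof (induction "p + q" arbitrary: p q b v)
  case (Suc n)
  show ?case
  proof (cases p; cases q)
    fix p' q' assume pq: "p = Suc p'" "q = Suc q'"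
    have "(act a ^^ (p + q)) (act b v) = (act a ^^ n) (act a (act b v))"
      using Suc.hyps(2) by (simp only: Suc.hyps(2)[symmetric] funpow_Suc_right o_apply)
    also have "\<dots> = (act a ^^ n) (act b (act a v)) + (act a ^^ n) (act (br a b) v)"
      by (simp add: act_swap[of a b])
    also have "(act a ^^ n) (act b (act a v)) = 0"
      using Suc.hyps(1)[of p q' b "act a v"] Suc.hyps(2) Suc.prems pq
      by (simp add: funpow_swap1)
    also have "(act a ^^ n) (act (br a b) v) = 0"
      using Suc.hyps(1)[of p' q "br a b" v] Suc.hyps(2) Suc.prems pq
      by (simp add: funpow_swap1)
    finally show ?thesis by simp
  qed (use Suc.prems in auto)
qed auto

lemma submodule_nilpotent:
  assumes "\<And>b. \<exists>p. (br a ^^ p) b = 0"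
  shows "submodule act {v. \<exists>p. (act a ^^ p) v = 0}"
proof -
  let ?N = "{v. \<exists>p. (act a ^^ p) v = 0}"
  have "v + w \<in> ?N" if "v \<in> ?N" "w \<in> ?N" for v w
  proof -
    from that obtain p q where "(act a ^^ p) v = 0" "(act a ^^ q) w = 0" by blast
    hence "(act a ^^ (p + q)) v = 0" "(act a ^^ (p + q)) w = 0"
      by (auto intro: funpow_act_eq_0_mono)
    hence "(act a ^^ (p + q)) (v + w) = 0" by simp
    thus ?thesis by blast
  qed
  moreover have "c *\<^sub>C v \<in> ?N" if "v \<in> ?N" for c v
    using that by (auto simp: complex_vector.scale_eq_0_iff)
  moreover have "0 \<in> ?N" by simp
  moreover have "act b v \<in> ?N" if "v \<in> ?N" for b v
    using that assms[of b] funpow_act_act_eq_0 by blast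
  ultimately show ?thesis
    unfolding submodule_def complex_vector.subspace_def by blast
qed

text \<open>Reduces stability of a subspace to a test on the Chevalley generators.\<close>

lemma stable_subalgebra:
  assumes S: "complex_vector.subspace S"
  shows "lie_subalgebra br {a. \<forall>v\<in>S. act a v \<in> S}"
  unfolding lie_subalgebra_def complex_vector.subspace_def
  using S by (auto simp: act_br complex_vector.subspace_0 complex_vector.subspace_add
      complex_vector.subspace_scale complex_vector.subspace_diff)

lemma stable_span:
  assumes "\<And>v. v \<in> B \<Longrightarrow> act a v \<in> complex_vector.span B" "v \<in> complex_vector.span B"
  shows "act a v \<in> complex_vector.span B"
proof -
  have "complex_vector.subspace {v. act a v \<in> complex_vector.span B}"
    unfolding complex_vector.subspace_def
    by (auto simp: complex_vector.span_zero complex_vector.span_add complex_vector.span_scale)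
  hence "complex_vector.span B \<subseteq> {v. act a v \<in> complex_vector.span B}"
    using assms(1) by (intro complex_vector.span_minimal) auto
  thus ?thesis using assms(2) by blast
qed

end


section \<open>Simple Lie algebras with Chevalley data\<close>

lemma cartan_entry_diag [simp]: "cartan_entry X i i = 2"
  by (cases X) auto

text \<open>The simple reflection in simple-root coordinates: the sum is the value on the coroot
  H_j, and subtracting a multiple of \<alpha>_j changes the coordinate at \<open>j\<close>
  only.\<close>

definition reflect_coords :: "dynkin \<Rightarrow> nat \<Rightarrow> (nat \<Rightarrow> int) \<Rightarrow> nat \<Rightarrow> int" where
  "reflect_coords X j x = x(j := x j - (\<Sum>m=1..dynkin_rank X. x m * cartan_entry X m j))"

abbreviation unit :: "nat \<Rightarrow> nat \<Rightarrow> int" where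
  "unit j \<equiv> \<lambda>i. if i = j then 1 else 0"

locale chevalley =
  fixes X :: dynkin and G :: "'g::complex_vector chevalley_data"
  assumes typed: "simple_lie_algebra_of_type X G"
begin

abbreviation br where "br \<equiv> bracket G"
abbreviation nodes where "nodes \<equiv> {1..rank G}"
abbreviation \<alpha> where "\<alpha> \<equiv> simple_root G"
abbreviation E where "E \<equiv> chev_E G"
abbreviation F where "F \<equiv> chev_F G"
abbreviation H where "H \<equiv> coroot G"

definition lc :: "(nat \<Rightarrow> int) \<Rightarrow> 'g \<Rightarrow> complex" where
  "lc x h = (\<Sum>i\<in>nodes. of_int (x i) * \<alpha> i h)"

lemma rank_eq: "rank G = dynkin_rank X"
  and finite_dimensional: "\<exists>B::'g set. finite B \<and> complex_vector.span B = UNIV"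
  and lie: "lie_algebra br" and nonabelian: "\<exists>x y. br x y \<noteq> 0"
  and ideal_trivial: "lie_ideal br J \<Longrightarrow> J = {0} \<or> J = UNIV"
  and cartan: "cartan_subalgebra br (cartan G)"
  and root_base: "root_base G"
  and highest_root: "is_highest_root G (highest_root G)"
  and invariant_form: "normalized_invariant_form G"
  and F_theta: "F_theta G \<in> root_space G (\<lambda>h. - highest_root G h)"
  using typed unfolding simple_lie_algebra_of_type_def simple_lie_algebra_def by (elim conjE; simp)+

lemma generators:
  assumes "j \<in> nodes"
  shows E_root: "E j \<in> root_space G (\<alpha> j)" and F_root: "F j \<in> root_space G (\<lambda>h. - \<alpha> j h)"
    and H_cartan: "H j \<in> cartan G" and EF: "br (E j) (F j) = H j"
  using typed assms unfolding simple_lie_algebra_of_type_def by (elim conjE; simp)+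

lemma root_coroot: "i \<in> nodes \<Longrightarrow> j \<in> nodes \<Longrightarrow> \<alpha> i (H j) = of_int (cartan_entry X i j)"
  using typed unfolding simple_lie_algebra_of_type_def by (elim conjE) simp

lemma generated:
  "lie_subalgebra br S \<Longrightarrow> (\<And>j. j \<in> nodes \<Longrightarrow> E j \<in> S \<and> F j \<in> S) \<Longrightarrow> S = UNIV"
  using typed unfolding simple_lie_algebra_of_type_def by (elim conjE) simp

lemma br_self [simp]: "br x x = 0"
  using lie unfolding lie_algebra_def by blast

lemma br_anti: "br y x = - br x y"
proof -
  have l: "br (a + b) z = br a z + br b z" "br z (a + b) = br z a + br z b" for a b z
    using lie unfolding lie_algebra_def cbilinear_def clinear_iff by auto
  have "br (x + y) (x + y) = br x y + br y x"
    unfolding l by simp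
  thus ?thesis by (simp add: eq_neg_iff_add_eq_0 add.commute)
qed

sublocale adj: lie_mod br br
proof
  have l: "clinear (br z)" for z
    using lie unfolding lie_algebra_def cbilinear_def by blast
  have J: "br x (br y z) + br y (br z x) + br z (br x y) = 0" for x y z
    using lie unfolding lie_algebra_def by blast
  have "br (br x y) z = br x (br y z) - br y (br x z)" for x y z
  proof -
    have "br z (br x y) = - br (br x y) z" "br y (br z x) = - br y (br x z)"
      using br_anti[of z "br x y"] br_anti[of z x] clinear_minus[OF l[of y], of "br x z"] by auto
    with J[of x y z] have "br x (br y z) + - br y (br x z) + - br (br x y) z = 0" by metis
    thus ?thesis by (simp add: algebra_simps)
  qed
  thus "lie_module br br"
    using lie unfolding lie_module_def lie_algebra_def by blast
qed

lemma cartan_subspace: "complex_vector.subspace (cartan G)"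
  and cartan_self_normalizing: "(\<And>y. y \<in> cartan G \<Longrightarrow> br x y \<in> cartan G) \<Longrightarrow> x \<in> cartan G"
  using cartan unfolding cartan_subalgebra_def lie_subalgebra_def by blast+

lemma cartan_closed:
  "0 \<in> cartan G" "x \<in> cartan G \<Longrightarrow> y \<in> cartan G \<Longrightarrow> x + y \<in> cartan G"
  "x \<in> cartan G \<Longrightarrow> c *\<^sub>C x \<in> cartan G"
  "x \<in> cartan G \<Longrightarrow> y \<in> cartan G \<Longrightarrow> x - y \<in> cartan G"
  using cartan_subspace
  by (simp_all add: complex_vector.subspace_0 complex_vector.subspace_add
      complex_vector.subspace_scale complex_vector.subspace_diff)

lemma simple_root_root: "j \<in> nodes \<Longrightarrow> \<alpha> j \<in> roots G"
  using root_base unfolding root_base_def by blast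

lemma cartan_dualD:
  assumes "\<mu> \<in> cartan_dual G"
  shows "x \<in> cartan G \<Longrightarrow> y \<in> cartan G \<Longrightarrow> \<mu> (x + y) = \<mu> x + \<mu> y"
    "x \<in> cartan G \<Longrightarrow> \<mu> (c *\<^sub>C x) = c * \<mu> x" "x \<notin> cartan G \<Longrightarrow> \<mu> x = 0"
    "x \<in> cartan G \<Longrightarrow> y \<in> cartan G \<Longrightarrow> \<mu> (x - y) = \<mu> x - \<mu> y"
proof -
  have m: "\<mu> (x + y) = \<mu> x + \<mu> y" "\<mu> (c *\<^sub>C x) = c * \<mu> x"
    if "x \<in> cartan G" "y \<in> cartan G" for c x y
    using assms that unfolding cartan_dual_def by auto
  show "x \<in> cartan G \<Longrightarrow> y \<in> cartan G \<Longrightarrow> \<mu> (x + y) = \<mu> x + \<mu> y"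
    "x \<in> cartan G \<Longrightarrow> \<mu> (c *\<^sub>C x) = c * \<mu> x" "x \<notin> cartan G \<Longrightarrow> \<mu> x = 0"
    using assms unfolding cartan_dual_def by auto
  assume xy: "x \<in> cartan G" "y \<in> cartan G"
  show "\<mu> (x - y) = \<mu> x - \<mu> y"
    using m(1)[OF xy(1), of "(- 1) *\<^sub>C y"] m(2)[OF xy(2) xy(2), of "- 1"] cartan_closed(3)[OF xy(2), of "- 1"]
    by simp
qed

lemma simple_root_dual: "j \<in> nodes \<Longrightarrow> \<alpha> j \<in> cartan_dual G"
  using simple_root_root unfolding roots_def by blast

lemma lc_add: "lc (\<lambda>i. x i + y i) h = lc x h + lc y h"
  and lc_diff: "lc (\<lambda>i. x i - y i) h = lc x h - lc y h"
  and lc_minus: "lc (\<lambda>i. - x i) h = - lc x h"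
  and lc_cmul: "lc (\<lambda>i. c * x i) h = of_int c * lc x h"
  by (simp_all add: lc_def algebra_simps sum.distrib sum_subtractf sum_negf sum_distrib_left)

lemma lc_unit: "j \<in> nodes \<Longrightarrow> lc (unit j) = \<alpha> j"
  by (rule ext) (simp add: lc_def if_distrib[of "\<lambda>n. of_int n * _"] cong: if_cong)

lemma lc_off: "h \<notin> cartan G \<Longrightarrow> lc x h = 0"
  by (simp add: lc_def cartan_dualD(3)[OF simple_root_dual])

lemma lc_dual: "lc x \<in> cartan_dual G"
  unfolding cartan_dual_def
  by (auto simp: lc_off)
     (auto simp: lc_def cartan_dualD[OF simple_root_dual] algebra_simps sum.distrib sum_distrib_left)

lemma lc_coroot:
  "j \<in> nodes \<Longrightarrow> lc x (H j) = of_int (\<Sum>m=1..dynkin_rank X. x m * cartan_entry X m j)"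
  by (simp add: lc_def root_coroot rank_eq)

lemma lc_inj:
  assumes "\<And>h. h \<in> cartan G \<Longrightarrow> lc x h = lc y h" "j \<in> nodes"
  shows "x j = y j"
proof -
  have "lc (\<lambda>i. x i - y i) h = 0" for h
    using assms(1) by (cases "h \<in> cartan G") (auto simp: lc_diff lc_off)
  moreover have "(\<forall>h. (\<Sum>i\<in>nodes. of_int (x i - y i) * \<alpha> i h) = 0) \<longrightarrow>
      (\<forall>i\<in>nodes. of_int (x i - y i) = (0::complex))"
    using root_base unfolding root_base_def by (elim conjE allE[of _ "\<lambda>i. of_int (x i - y i)"])
  ultimately have "of_int (x j - y j) = (0::complex)"
    using assms(2) by (simp only: lc_def) blast
  thus ?thesis by (simp del: of_int_diff)
qed

lemma root_lc:
  assumes "\<beta> \<in> roots G"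
  obtains x where "\<beta> = lc x" "\<And>i. i \<notin> nodes \<Longrightarrow> x i = 0" "\<exists>i\<in>nodes. x i \<noteq> 0"
    "(\<forall>i. 0 \<le> x i) \<or> (\<forall>i. x i \<le> 0)"
proof -
  obtain n :: "nat \<Rightarrow> nat" where
    n: "\<beta> = (\<lambda>h. \<Sum>i=1..rank G. of_nat (n i) * \<alpha> i h) \<or>
        \<beta> = (\<lambda>h. - (\<Sum>i=1..rank G. of_nat (n i) * \<alpha> i h))"
    using root_base assms unfolding root_base_def by blast
  define y where "y i = (if i \<in> nodes then int (n i) else 0)" for i
  have "lc y = (\<lambda>h. \<Sum>i=1..rank G. of_nat (n i) * \<alpha> i h)"
    by (rule ext) (simp add: lc_def y_def)
  hence "\<beta> = lc y \<or> \<beta> = lc (\<lambda>i. - y i)" using n by (auto simp: lc_minus)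
  moreover have "\<exists>i\<in>nodes. x i \<noteq> 0" if "\<beta> = lc x" for x
  proof (rule ccontr)
    assume "\<not> ?thesis"
    hence "\<beta> = (\<lambda>_. 0)" using that by (simp add: lc_def fun_eq_iff)
    thus False using assms unfolding roots_def by blast
  qed
  moreover have "\<forall>i. 0 \<le> y i" "\<forall>i. i \<notin> nodes \<longrightarrow> y i = 0" by (auto simp: y_def)
  ultimately show ?thesis using that[of y] that[of "\<lambda>i. - y i"] by fastforce
qed

lemma root_sign:
  assumes "lc x \<in> roots G" "i \<in> nodes" "j \<in> nodes" "0 < x i"
  shows "0 \<le> x j"
proof -
  obtain y where y: "lc x = lc y" "(\<forall>i. 0 \<le> y i) \<or> (\<forall>i. y i \<le> 0)"
    using root_lc[OF assms(1)] by metis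
  have "x i = y i" "x j = y j" using lc_inj[of x y] y(1) assms(2,3) by auto
  thus ?thesis using y(2) assms(4) by (metis not_le)
qed

lemma root_nonzero: "lc x \<in> roots G \<Longrightarrow> \<exists>i\<in>nodes. x i \<noteq> 0"
  by (rule ccontr) (auto simp: roots_def lc_def fun_eq_iff)

lemma root_space_lc:
  assumes "a \<in> root_space G (lc x)" "a \<noteq> 0" "\<exists>i\<in>nodes. x i \<noteq> 0"
  shows "lc x \<in> roots G"
proof -
  have "lc x \<noteq> (\<lambda>_. 0)"
  proof
    assume "lc x = (\<lambda>_. 0)"
    hence "lc x = lc (\<lambda>_. 0)" by (simp add: lc_def fun_eq_iff)
    thus False using lc_inj[of x "\<lambda>_. 0"] assms(3) by auto
  qed
  thus ?thesis using assms lc_dual unfolding roots_def by blast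
qed

lemma root_spaceD: "a \<in> root_space G \<beta> \<Longrightarrow> h \<in> cartan G \<Longrightarrow> br h a = \<beta> h *\<^sub>C a"
  unfolding root_space_def by blast

lemma br_root_space:
  assumes "a \<in> root_space G \<beta>" "b \<in> root_space G \<gamma>"
  shows "br a b \<in> root_space G (\<lambda>h. \<beta> h + \<gamma> h)"
  unfolding root_space_def
  using assms by (auto simp: adj.act_swap[of _ a b] root_spaceD complex_vector.scale_left_distrib add.commute)

text \<open>Otherwise \<alpha>_j - \<alpha>_k would be a root with coefficients of both
  signs.\<close>

lemma EF_0:
  assumes jk: "j \<in> nodes" "k \<in> nodes" "j \<noteq> k"
  shows "br (E j) (F k) = 0"
proof (rule ccontr)
  assume nz: "br (E j) (F k) \<noteq> 0"
  let ?x = "\<lambda>i. unit j i - unit k i"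
  have "lc ?x = (\<lambda>h. \<alpha> j h + - \<alpha> k h)" using jk by (simp add: lc_diff lc_unit fun_eq_iff)
  hence "br (E j) (F k) \<in> root_space G (lc ?x)"
    using br_root_space[OF E_root F_root] jk by simp
  moreover have "\<exists>i\<in>nodes. ?x i \<noteq> 0" using jk by (intro bexI[of _ j]) auto
  ultimately have "lc ?x \<in> roots G" using root_space_lc nz by blast
  from root_sign[OF this jk(1,2)] show False using jk by simp
qed

text \<open>The centralizer of \<open>z\<close> is a subalgebra containing the generators, so
  \<open>z\<close> is central; the center is an ideal and is proper because the bracket is
  nonzero.\<close>

lemma central_0:
  assumes "\<And>j. j \<in> nodes \<Longrightarrow> br z (E j) = 0 \<and> br z (F j) = 0"
  shows "z = 0"
proof -
  let ?Z = "{z. \<forall>a. br z a = 0}"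
  have "lie_subalgebra br {a. br z a = 0}"
    unfolding lie_subalgebra_def complex_vector.subspace_def by (auto simp: adj.act_swap[of z])
  hence "{a. br z a = 0} = UNIV" by (rule generated) (use assms in auto)
  hence z: "z \<in> ?Z" by auto
  have "lie_ideal br ?Z"
    unfolding lie_ideal_def complex_vector.subspace_def by (auto simp: adj.act_br)
  moreover have "?Z \<noteq> UNIV" using nonabelian by blast
  ultimately show ?thesis using ideal_trivial z by blast
qed

lemma cartan_eq_0:
  assumes "h \<in> cartan G" "\<And>j. j \<in> nodes \<Longrightarrow> \<alpha> j h = 0"
  shows "h = 0"
  by (rule central_0) (use assms root_spaceD[OF E_root] root_spaceD[OF F_root] in auto)

text \<open>A Cartan subalgebra is given as nilpotent and self-normalizing. It is abelian because
  [h, h'] acts on each \<open>E j\<close> and \<open>F j\<close> as a commutator of scalars.\<close>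

lemma cartan_abelian:
  assumes "h \<in> cartan G" "h' \<in> cartan G"
  shows "br h h' = 0"
  by (rule central_0)
     (use assms root_spaceD[OF E_root] root_spaceD[OF F_root] in \<open>auto simp: adj.act_br mult.commute\<close>)

lemma zero_weight_cartan:
  assumes "\<And>h. h \<in> cartan G \<Longrightarrow> br h a = 0"
  shows "a \<in> cartan G"
proof (rule cartan_self_normalizing)
  fix h assume "h \<in> cartan G"
  hence "br a h = 0" using assms[of h] br_anti[of a h] by simp
  thus "br a h \<in> cartan G" by (simp add: cartan_closed(1))
qed

text \<open>Otherwise the vectors (ad a)^p b would be infinitely many eigenvectors of ad h with
  distinct eigenvalues \<gamma>(h) + p \<beta>(h), against finite dimension.\<close>

lemma ad_nilpotent_aux:
  assumes a: "a \<in> root_space G \<beta>" "h \<in> cartan G" "\<beta> h \<noteq> 0" and b: "b \<in> root_space G \<gamma>"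
  shows "\<exists>p. (br a ^^ p) b = 0"
proof (rule ccontr)
  assume nz: "\<nexists>p. (br a ^^ p) b = 0"
  define y where "y p = (br a ^^ p) b" for p
  define c where "c p = \<gamma> h + of_nat p * \<beta> h" for p
  have y: "br h (y p) = c p *\<^sub>C y p" for p
  proof (induction p)
    case (Suc p)
    have "br h (y (Suc p)) = br a (br h (y p)) + br (br h a) (y p)"
      by (simp add: y_def adj.act_swap[of h a])
    also have "\<dots> = (c p + \<beta> h) *\<^sub>C br a (y p)"
      using Suc root_spaceD[OF a(1,2)] by (simp add: complex_vector.scale_left_distrib)
    also have "\<dots> = c (Suc p) *\<^sub>C y (Suc p)" by (simp add: y_def c_def algebra_simps)
    finally show ?case .
  qed (use root_spaceD[OF b a(2)] in \<open>simp add: y_def c_def\<close>)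
  have nz': "y p \<noteq> 0" for p using nz by (auto simp: y_def)
  have c: "c p = c q \<longleftrightarrow> p = q" for p q using a(3) by (simp add: c_def)
  have "inj y"
  proof (rule injI)
    fix p q assume "y p = y q"
    hence "c p *\<^sub>C y p = c q *\<^sub>C y p" using y[of p] y[of q] by metis
    thus "p = q" using nz'[of p] c by simp
  qed
  moreover have "complex_vector.independent (range y)"
    unfolding complex_vector.dependent_def
  proof (clarify)
    fix p assume p: "y p \<in> complex_vector.span (range y - {y p})"
    have "y p = 0"
    proof (rule eigenvector_not_in_span[where C = "{h}" and T = br and \<mu> = "\<lambda>_. c p", OF _ _ p])
      fix z assume "z \<in> range y - {y p}"
      then obtain q where "z = y q" "q \<noteq> p" by blast
      thus "\<exists>d. (\<forall>t\<in>{h}. br t z = d t *\<^sub>C z) \<and> (\<exists>t\<in>{h}. d t \<noteq> c p)"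
        using y c by (intro exI[of _ "\<lambda>_. c q"]) auto
    qed (use y adj.act_clinear in auto)
    thus False using nz' by blast
  qed
  moreover obtain B :: "'g set" where "finite B" "complex_vector.span B = UNIV"
    using finite_dimensional by blast
  ultimately have "finite (range y)"
    using complex_vector.independent_span_bound[of B "range y"] by auto
  thus False using \<open>inj y\<close> by (simp add: finite_image_iff)
qed

lemma root_coroot_self: "j \<in> nodes \<Longrightarrow> \<alpha> j (H j) = 2"
  by (simp add: root_coroot)

text \<open>By the Leibniz rule the elements killed by a power of ad a form a subalgebra, and it
  contains the generators, which are root vectors.\<close>

lemma ad_nilpotent:
  assumes "j \<in> nodes"
  shows ad_E_nilpotent: "\<exists>p. (br (E j) ^^ p) b = 0" and ad_F_nilpotent: "\<exists>p. (br (F j) ^^ p) b = 0"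
proof -
  have *: "{b. \<exists>p. (br a ^^ p) b = 0} = UNIV"
    if a: "a \<in> root_space G \<beta>" "\<beta> (H j) \<noteq> 0" for a \<beta>
  proof (rule generated)
    let ?N = "{b. \<exists>p. (br a ^^ p) b = 0}"
    show "E k \<in> ?N \<and> F k \<in> ?N" if "k \<in> nodes" for k
      using ad_nilpotent_aux[OF a(1) H_cartan[OF assms] a(2)] E_root[OF that] F_root[OF that] by blast
    have "b + c \<in> ?N" if "b \<in> ?N" "c \<in> ?N" for b c
    proof -
      from that obtain p q where "(br a ^^ p) b = 0" "(br a ^^ q) c = 0" by blast
      hence "(br a ^^ (p + q)) b = 0" "(br a ^^ (p + q)) c = 0"
        by (auto intro: adj.funpow_act_eq_0_mono)
      hence "(br a ^^ (p + q)) (b + c) = 0" by simp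
      thus ?thesis by blast
    qed
    moreover have "c *\<^sub>C b \<in> ?N" if "b \<in> ?N" for c b using that by auto
    moreover have "br b c \<in> ?N" if "b \<in> ?N" "c \<in> ?N" for b c
      using that adj.funpow_act_act_eq_0 by blast
    moreover have "0 \<in> ?N" by simp
    ultimately show "lie_subalgebra br ?N"
      unfolding lie_subalgebra_def complex_vector.subspace_def by blast
  qed
  show "\<exists>p. (br (E j) ^^ p) b = 0" "\<exists>p. (br (F j) ^^ p) b = 0"
    using *[OF E_root[OF assms]] *[OF F_root[OF assms]] root_coroot_self[OF assms] by auto
qed

lemma HE: "j \<in> nodes \<Longrightarrow> br (H j) (E j) = 2 *\<^sub>C E j"
  and HF: "j \<in> nodes \<Longrightarrow> br (H j) (F j) = (- 2) *\<^sub>C F j"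
  using root_spaceD[OF E_root H_cartan] root_spaceD[OF F_root H_cartan] root_coroot_self by auto

end


section \<open>Weights of highest weight modules\<close>

locale weight_mod = chevalley X G + lie_mod "bracket G" act
  for X :: dynkin and G :: "'g::complex_vector chevalley_data"
    and act :: "'g \<Rightarrow> 'v::complex_vector \<Rightarrow> 'v"
begin

definition wsp :: "('g \<Rightarrow> complex) \<Rightarrow> 'v set" where
  "wsp \<mu> = {v. \<forall>h\<in>cartan G. act h v = \<mu> h *\<^sub>C v}"

lemma wspD: "v \<in> wsp \<mu> \<Longrightarrow> h \<in> cartan G \<Longrightarrow> act h v = \<mu> h *\<^sub>C v"
  by (simp add: wsp_def)

lemma wsp_cong: "(\<And>h. h \<in> cartan G \<Longrightarrow> \<mu> h = \<nu> h) \<Longrightarrow> wsp \<mu> = wsp \<nu>"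
  by (simp add: wsp_def)

lemma act_wsp:
  assumes "a \<in> root_space G \<beta>" "v \<in> wsp \<mu>"
  shows "act a v \<in> wsp (\<lambda>h. \<mu> h + \<beta> h)"
  using assms
  by (auto simp: wsp_def act_swap[of _ a] root_spaceD complex_vector.scale_left_distrib)

lemma funpow_act_wsp:
  assumes "a \<in> root_space G \<beta>" "v \<in> wsp \<mu>"
  shows "(act a ^^ n) v \<in> wsp (\<lambda>h. \<mu> h + of_nat n * \<beta> h)"
proof (induction n)
  case (Suc n)
  have "(act a ^^ Suc n) v \<in> wsp (\<lambda>h. \<mu> h + of_nat n * \<beta> h + \<beta> h)"
    using act_wsp[OF assms(1) Suc] by simp
  thus ?case by (simp add: algebra_simps)
qed (use assms in simp)

lemma reflect_weight:
  assumes j: "j \<in> nodes" and v: "v \<in> wsp \<mu>" "v \<noteq> 0"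
    and nil: "\<And>v. \<exists>p. (act (E j) ^^ p) v = 0" "\<And>v. \<exists>p. (act (F j) ^^ p) v = 0"
  shows "\<exists>u\<in>wsp (simple_reflection G j \<mu>). u \<noteq> 0"
proof -
  have "act (H j) v = \<mu> (H j) *\<^sub>C v" using wspD[OF v(1) H_cartan[OF j]] .
  from sl2_weight_integral[OF EF[OF j] HE[OF j] HF[OF j] v(2) this nil]
  obtain m where m: "\<mu> (H j) = of_int m"
    "0 \<le> m \<Longrightarrow> \<exists>p. (act (F j) ^^ (p + nat m)) ((act (E j) ^^ p) v) \<noteq> 0"
    by blast
  \<comment> \<open>The triple (F, E, -H) treats the case of a negative weight, where the reflection
    moves upwards.\<close>
  have "br (F j) (E j) = - H j" using br_anti[of "F j" "E j"] EF[OF j] by simp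
  moreover have "br (- H j) (F j) = 2 *\<^sub>C F j" "br (- H j) (E j) = (- 2) *\<^sub>C E j"
    using HF[OF j] HE[OF j] by simp_all
  moreover have "act (- H j) v = (- \<mu> (H j)) *\<^sub>C v" using wspD[OF v(1) H_cartan[OF j]] by simp
  ultimately obtain m' where m': "- \<mu> (H j) = of_int m'"
    "0 \<le> m' \<Longrightarrow> \<exists>p. (act (E j) ^^ (p + nat m')) ((act (F j) ^^ p) v) \<noteq> 0"
    using sl2_weight_integral[of "F j" "E j" "- H j" v "- \<mu> (H j)"] v(2) nil by blast
  have mm: "m' = - m" using m(1) m'(1) by (metis of_int_eq_iff of_int_minus)
  show ?thesis
  proof (cases "0 \<le> m")
    case True
    obtain p where p: "(act (F j) ^^ (p + nat m)) ((act (E j) ^^ p) v) \<noteq> 0"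
      using m(2)[OF True] by blast
    have "(act (F j) ^^ (p + nat m)) ((act (E j) ^^ p) v)
        \<in> wsp (\<lambda>h. (\<mu> h + of_nat p * \<alpha> j h) + of_nat (p + nat m) * (- \<alpha> j h))"
      by (intro funpow_act_wsp E_root F_root j v)
    also have "(\<lambda>h. (\<mu> h + of_nat p * \<alpha> j h) + of_nat (p + nat m) * (- \<alpha> j h))
        = simple_reflection G j \<mu>"
      using True by (simp add: simple_reflection_def m(1) fun_eq_iff algebra_simps)
    finally show ?thesis using p by blast
  next
    case False
    obtain p where p: "(act (E j) ^^ (p + nat m')) ((act (F j) ^^ p) v) \<noteq> 0"
      using m'(2) False mm by auto
    have "(act (E j) ^^ (p + nat m')) ((act (F j) ^^ p) v)
        \<in> wsp (\<lambda>h. (\<mu> h + of_nat p * (- \<alpha> j h)) + of_nat (p + nat m') * \<alpha> j h)"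
      by (intro funpow_act_wsp E_root F_root j v)
    also have "(\<lambda>h. (\<mu> h + of_nat p * (- \<alpha> j h)) + of_nat (p + nat m') * \<alpha> j h)
        = simple_reflection G j \<mu>"
      using False mm by (simp add: simple_reflection_def m(1) fun_eq_iff algebra_simps)
    finally show ?thesis using p by blast
  qed
qed

section \<open>The submodule generated by a singular vector\<close>

definition lowering :: "nat list \<Rightarrow> 'v \<Rightarrow> 'v" where
  "lowering l w = foldr (\<lambda>j. act (F j)) l w"

lemma lowering_wsp:
  assumes "w \<in> wsp \<mu>" "set l \<subseteq> nodes"
  shows "lowering l w \<in> wsp (\<lambda>h. \<mu> h - lc (\<lambda>i. int (count_list l i)) h)"
  using assms(2)
proof (induction l)
  case (Cons j l)
  have j: "j \<in> nodes" using Cons.prems by simp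
  have "lc (\<lambda>i. int (count_list (j # l) i)) h = lc (\<lambda>i. int (count_list l i)) h + \<alpha> j h" for h
    unfolding lc_unit[OF j, symmetric] lc_add[symmetric]
    by (rule arg_cong[where f = "\<lambda>x. lc x h"]) auto
  moreover have "lowering (j # l) w \<in> wsp (\<lambda>h. (\<mu> h - lc (\<lambda>i. int (count_list l i)) h) + - \<alpha> j h)"
    using act_wsp[OF F_root[OF j]] Cons by (simp add: lowering_def)
  ultimately show ?case by (simp add: algebra_simps)
qed (use assms(1) in \<open>simp add: lowering_def lc_def\<close>)

context
  fixes w :: 'v and \<mu> :: "'g \<Rightarrow> complex"
  assumes w: "w \<in> wsp \<mu>" and singular: "\<And>j. j \<in> nodes \<Longrightarrow> act (E j) w = 0"
begin

abbreviation lowered where "lowered \<equiv> {lowering l w |l. set l \<subseteq> nodes}"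

text \<open>Moving \<open>E j\<close> to the right through the lowering operators leaves commutators
  [E_j, F_k], which are 0 or act by a scalar on a lowered vector, until \<open>E j\<close> reaches
  \<open>w\<close> and kills it.\<close>

lemma submodule_singular: "submodule act (complex_vector.span lowered)"
proof -
  let ?S = "complex_vector.span lowered"
  have base: "lowering l w \<in> ?S" if "set l \<subseteq> nodes" for l
    using that by (intro complex_vector.span_base) blast
  have F: "act (F j) v \<in> ?S" if j: "j \<in> nodes" and v: "v \<in> ?S" for j v
  proof (rule stable_span[OF _ v])
    fix y assume "y \<in> lowered"
    then obtain l where l: "y = lowering l w" "set l \<subseteq> nodes" by blast
    have "act (F j) y = lowering (j # l) w" by (simp add: l(1) lowering_def)
    thus "act (F j) y \<in> ?S" using base[of "j # l"] l(2) j by simp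
  qed
  have E: "act (E j) v \<in> ?S" if j: "j \<in> nodes" and v: "v \<in> ?S" for j v
  proof (rule stable_span[OF _ v])
    fix y assume "y \<in> lowered"
    then obtain l where l: "y = lowering l w" "set l \<subseteq> nodes" by blast
    have "act (E j) (lowering l w) \<in> ?S" using l(2)
    proof (induction l)
      case (Cons k l)
      have k: "k \<in> nodes" "set l \<subseteq> nodes" using Cons.prems by auto
      have *: "act (E j) (lowering (k # l) w)
          = act (F k) (act (E j) (lowering l w)) + act (br (E j) (F k)) (lowering l w)"
        by (simp add: lowering_def act_swap[of "E j" "F k"])
      have "act (br (E j) (F k)) (lowering l w) \<in> ?S"
        using EF[OF j] EF_0[OF j k(1)] wspD[OF lowering_wsp[OF w k(2)] H_cartan[OF j]] base[OF k(2)]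
        by (cases "j = k") (simp_all add: complex_vector.span_scale complex_vector.span_zero)
      moreover have "act (F k) (act (E j) (lowering l w)) \<in> ?S"
        using F[OF k(1)] Cons.IH k(2) by blast
      ultimately show ?case unfolding * by (rule complex_vector.span_add[rotated])
    qed (simp add: lowering_def singular[OF j] complex_vector.span_zero)
    thus "act (E j) y \<in> ?S" by (simp add: l(1))
  qed
  have "{a. \<forall>v\<in>?S. act a v \<in> ?S} = UNIV"
    by (rule generated[OF stable_subalgebra]) (use E F in auto)
  thus ?thesis unfolding submodule_def by auto
qed

lemma singular_in_span: "w \<in> complex_vector.span lowered"
proof -
  have "w = lowering [] w" by (simp add: lowering_def)
  moreover have "set [] \<subseteq> nodes" by simp
  ultimately show ?thesis by (intro complex_vector.span_base) blast
qed

text \<open>The lowered vectors span and are weight vectors, so a weight different from all of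
  theirs has no nonzero vector by \<open>eigenvector_not_in_span\<close>.\<close>

lemma weights_below_singular:
  assumes gen: "complex_vector.span lowered = UNIV" and v: "v \<in> wsp \<nu>" "v \<noteq> 0"
  shows "\<exists>n. (\<forall>i. 0 \<le> n i) \<and> (\<forall>h\<in>cartan G. \<nu> h = \<mu> h - lc n h)"
proof (rule ccontr)
  assume no: "\<not> ?thesis"
  have "v = 0"
  proof (rule eigenvector_not_in_span[where C = "cartan G" and T = act and \<mu> = \<nu> and B = lowered])
    fix y assume "y \<in> lowered"
    then obtain l where l: "y = lowering l w" "set l \<subseteq> nodes" by blast
    define c where "c h = \<mu> h - lc (\<lambda>i. int (count_list l i)) h" for h
    have "\<forall>h\<in>cartan G. act h y = c h *\<^sub>C y"
      using wspD[OF lowering_wsp[OF w l(2)]] by (simp add: l(1) c_def)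
    moreover have "\<exists>h\<in>cartan G. c h \<noteq> \<nu> h"
    proof (rule ccontr)
      assume "\<not> ?thesis"
      hence "\<forall>h\<in>cartan G. \<nu> h = \<mu> h - lc (\<lambda>i. int (count_list l i)) h" by (auto simp: c_def)
      thus False using no by (metis of_nat_0_le_iff)
    qed
    ultimately show "\<exists>c. (\<forall>h\<in>cartan G. act h y = c h *\<^sub>C y) \<and> (\<exists>h\<in>cartan G. c h \<noteq> \<nu> h)" by blast
  qed (use v gen act_clinear wspD in auto)
  thus False using v by blast
qed

end

end

section \<open>Irreducible modules of dominant integral highest weight\<close>

locale dominant_mod = weight_mod +
  fixes \<mu> w
  assumes irreducible: "irreducible_module br act"
    and dominant: "\<And>j. j \<in> nodes \<Longrightarrow> \<exists>n::nat. \<mu> (H j) = of_nat n"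
    and w: "w \<in> wsp \<mu>" "w \<noteq> 0" "\<And>j. j \<in> nodes \<Longrightarrow> act (E j) w = 0"
begin

lemma generated_by_singular:
  assumes "u \<in> wsp \<kappa>" "u \<noteq> 0" "\<And>j. j \<in> nodes \<Longrightarrow> act (E j) u = 0"
  shows "complex_vector.span {lowering l u |l. set l \<subseteq> nodes} = UNIV"
  using submodule_singular[OF assms(1,3)] singular_in_span[OF assms(1,3)] assms(2) irreducible
  unfolding irreducible_module_def by blast

lemma weights_below:
  assumes "v \<in> wsp \<nu>" "v \<noteq> 0"
  shows "\<exists>n. (\<forall>i. 0 \<le> n i) \<and> (\<forall>h\<in>cartan G. \<nu> h = \<mu> h - lc n h)"
  using weights_below_singular[OF w(1,3) generated_by_singular[OF w] assms] by blast

text \<open>Each of the two singular vectors generates the module, so each weight lies below the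
  other, and the two nonnegative differences cancel.\<close>

lemma singular_weight:
  assumes v: "v \<in> wsp \<nu>" "v \<noteq> 0" "\<And>j. j \<in> nodes \<Longrightarrow> act (E j) v = 0"
    and h: "h \<in> cartan G"
  shows "\<nu> h = \<mu> h"
proof -
  obtain n where n: "\<And>i. 0 \<le> n i" "\<And>h. h \<in> cartan G \<Longrightarrow> \<nu> h = \<mu> h - lc n h"
    using weights_below[OF v(1,2)] by blast
  obtain m where m: "\<And>i. 0 \<le> m i" "\<And>h. h \<in> cartan G \<Longrightarrow> \<mu> h = \<nu> h - lc m h"
    using weights_below_singular[OF v(1,3) generated_by_singular[OF v] w(1,2)] by blast
  have "lc (\<lambda>i. n i + m i) h = lc (\<lambda>_. 0) h" if "h \<in> cartan G" for h
  proof -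
    have "\<mu> h = (\<mu> h - lc n h) - lc m h" using n(2)[OF that] m(2)[OF that] by metis
    thus ?thesis by (simp add: lc_add lc_def[of "\<lambda>_. 0"] neg_eq_iff_add_eq_0)
  qed
  hence "n j + m j = 0" if "j \<in> nodes" for j
    using lc_inj[of "\<lambda>i. n i + m i" "\<lambda>_. 0" j] that by auto
  hence "n j = 0" if "j \<in> nodes" for j using n(1)[of j] m(1)[of j] that by fastforce
  hence "lc n h = 0" by (simp add: lc_def)
  thus ?thesis using n(2)[OF h] by simp
qed

lemma not_weight_above:
  assumes "v \<in> wsp \<nu>" "\<And>h. h \<in> cartan G \<Longrightarrow> \<nu> h = \<mu> h + lc x h"
    and "i \<in> nodes" "0 < x i"
  shows "v = 0"
proof (rule ccontr)
  assume "v \<noteq> 0"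
  then obtain n where n: "\<And>i. 0 \<le> n i" "\<And>h. h \<in> cartan G \<Longrightarrow> \<nu> h = \<mu> h - lc n h"
    using weights_below[OF assms(1)] by blast
  have "lc x h = lc (\<lambda>i. - n i) h" if "h \<in> cartan G" for h
    using n(2)[OF that] assms(2)[OF that] by (simp add: lc_minus)
  hence "x i = - n i" using lc_inj[of x "\<lambda>i. - n i" i] assms(3) by auto
  thus False using n(1)[of i] assms(4) by simp
qed

text \<open>The vectors killed by a power of \<open>a\<close> form a submodule; by irreducibility
  one nonzero such vector is enough.\<close>

lemma nilpotent_of_singular:
  assumes "\<And>b. \<exists>p. (br a ^^ p) b = 0" "(act a ^^ p) w = 0"
  shows "\<exists>p. (act a ^^ p) v = 0"
proof -
  have "{v. \<exists>p. (act a ^^ p) v = 0} = {0} \<or> {v. \<exists>p. (act a ^^ p) v = 0} = UNIV"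
    using submodule_nilpotent[OF assms(1)] irreducible unfolding irreducible_module_def by blast
  thus ?thesis using assms(2) w(2) by blast
qed

lemma E_nilpotent: "j \<in> nodes \<Longrightarrow> \<exists>p. (act (E j) ^^ p) v = 0"
  by (rule nilpotent_of_singular[where p = 1]) (use ad_E_nilpotent w(3) in auto)

text \<open>With N = \<mu>(H_j), the vector F_j^(N+1) w is again singular, since the ladder
  coefficient contains N - N. Were it nonzero, it would generate the module and \<mu> would lie
  below \<mu> - (N+1) \<alpha>_j.\<close>

lemma F_nilpotent:
  assumes j: "j \<in> nodes"
  shows "\<exists>p. (act (F j) ^^ p) v = 0"
proof -
  obtain N :: nat where N: "\<mu> (H j) = of_nat N" using dominant[OF j] by blast
  define y where "y = (act (F j) ^^ Suc N) w"
  have y: "y \<in> wsp (\<lambda>h. \<mu> h + of_nat (Suc N) * - \<alpha> j h)"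
    unfolding y_def by (rule funpow_act_wsp[OF F_root[OF j] w(1)])
  have "act (E k) y = 0" if k: "k \<in> nodes" for k
  proof (cases "k = j")
    case True
    have "act (E j) y = (of_nat (Suc N) * (of_nat N - of_nat N)) *\<^sub>C (act (F j) ^^ N) w"
      unfolding y_def
      using sl2_ladder(2)[OF EF[OF j] HF[OF j] w(3)[OF j]] wspD[OF w(1) H_cartan[OF j]] N by metis
    thus ?thesis using True by simp
  next
    case False
    have "act (E k) ((act (F j) ^^ n) w) = 0" for n
      by (induction n) (simp_all add: w(3)[OF k] act_swap[of "E k" "F j"] EF_0[OF k j False])
    thus ?thesis by (simp only: y_def)
  qed
  note sing = this
  have "y = 0"
  proof (rule ccontr)
    assume y0: "y \<noteq> 0"
    obtain n where n: "\<And>i. 0 \<le> n i"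
      "\<And>h. h \<in> cartan G \<Longrightarrow> \<mu> h = (\<mu> h + of_nat (Suc N) * - \<alpha> j h) - lc n h"
      using weights_below_singular[OF y sing generated_by_singular[OF y y0 sing] w(1,2)] by blast
    have "lc (\<lambda>i. int (Suc N) * unit j i + n i) h = lc (\<lambda>_. 0) h" if "h \<in> cartan G" for h
      using n(2)[OF that] unfolding lc_add lc_cmul lc_unit[OF j]
      by (simp add: lc_def[of "\<lambda>_. 0"] algebra_simps)
    from lc_inj[OF this j] show False using n(1)[of j] by simp
  qed
  thus ?thesis
    by (intro nilpotent_of_singular[where p = "Suc N"]) (use ad_F_nilpotent[OF j] y_def in auto)
qed

lemma reflect_weights:
  assumes "set l \<subseteq> nodes" "v \<in> wsp \<nu>" "v \<noteq> 0"
  shows "\<exists>u\<in>wsp (foldr (simple_reflection G) l \<nu>). u \<noteq> 0"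
  using assms(1)
proof (induction l)
  case (Cons j l)
  then obtain u where "u \<in> wsp (foldr (simple_reflection G) l \<nu>)" "u \<noteq> 0" by auto
  thus ?case using reflect_weight[of j u] E_nilpotent F_nilpotent Cons.prems by simp
qed (use assms in auto)

end


section \<open>Roots and coweights\<close>

context chevalley
begin

text \<open>In the adjoint module weight vectors are root vectors, so the reflection of weights
  becomes a reflection of roots.\<close>

sublocale adjw: weight_mod X G br
  by unfold_locales

lemma adj_wsp: "adjw.wsp \<beta> = root_space G \<beta>"
  by (simp add: adjw.wsp_def root_space_def)

lemma lc_reflect: "j \<in> nodes \<Longrightarrow> lc (reflect_coords X j x) = simple_reflection G j (lc x)"
proof
  fix h assume j: "j \<in> nodes"
  let ?s = "\<Sum>m=1..dynkin_rank X. x m * cartan_entry X m j"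
  have "reflect_coords X j x = (\<lambda>i. x i - ?s * unit j i)" by (auto simp: reflect_coords_def)
  thus "lc (reflect_coords X j x) h = simple_reflection G j (lc x) h"
    by (simp add: lc_diff lc_cmul lc_unit[OF j] simple_reflection_def lc_coroot[OF j])
qed

lemma simple_reflection_twice:
  "j \<in> nodes \<Longrightarrow> simple_reflection G j (simple_reflection G j \<mu>) = \<mu>"
  by (rule ext) (simp add: simple_reflection_def root_coroot_self)

lemma root_reflect:
  assumes x: "lc x \<in> roots G" and j: "j \<in> nodes"
  shows "lc (reflect_coords X j x) \<in> roots G"
proof -
  obtain a where a: "a \<in> root_space G (lc x)" "a \<noteq> 0"
    using x unfolding roots_def root_space_def by fastforce
  have "\<exists>u\<in>root_space G (simple_reflection G j (lc x)). u \<noteq> 0"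
    using adjw.reflect_weight[OF j, of a "lc x"] a ad_E_nilpotent[OF j] ad_F_nilpotent[OF j]
    unfolding adj_wsp by blast
  then obtain b where "b \<in> root_space G (lc (reflect_coords X j x))" "b \<noteq> 0"
    using lc_reflect[OF j] by auto
  moreover have "\<exists>i\<in>nodes. reflect_coords X j x i \<noteq> 0"
  proof (rule ccontr)
    assume "\<not> ?thesis"
    hence "lc (reflect_coords X j x) = (\<lambda>_. 0)" by (simp add: lc_def fun_eq_iff)
    hence "simple_reflection G j (\<lambda>_. 0) = lc x"
      using simple_reflection_twice[OF j, of "lc x"] lc_reflect[OF j] by simp
    hence "lc x = (\<lambda>_. 0)" by (auto simp: simple_reflection_def)
    thus False using x by (simp add: roots_def)
  qed
  ultimately show ?thesis by (rule root_space_lc)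
qed

text \<open>Subtracting a multiple of \<open>E j\<close> from \<open>y\<close> makes \<open>[E j, [F j, y]]\<close> vanish; a nonzero vector of weight 2
  with this property would have infinitely many nonzero images under powers of \<open>E j\<close>.\<close>

lemma root_space_simple:
  assumes j: "j \<in> nodes" and y: "y \<in> root_space G (\<alpha> j)"
  shows "\<exists>c. y = c *\<^sub>C E j"
proof -
  define z where "z c = br (F j) (y - c *\<^sub>C E j)" for c
  have HyE: "br h (y - c *\<^sub>C E j) = \<alpha> j h *\<^sub>C (y - c *\<^sub>C E j)" if "h \<in> cartan G" for h c
    using root_spaceD[OF y that] root_spaceD[OF E_root[OF j] that]
    by (simp add: complex_vector.scale_right_diff_distrib mult.commute)
  have zc: "z c \<in> cartan G" for c
  proof (rule zero_weight_cartan)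
    fix h assume h: "h \<in> cartan G"
    show "br h (z c) = 0"
    proof -
      have "br h (z c) = br (F j) (br h (y - c *\<^sub>C E j)) + br (br h (F j)) (y - c *\<^sub>C E j)"
        unfolding z_def by (rule adj.act_swap)
      also have "br (F j) (br h (y - c *\<^sub>C E j)) = \<alpha> j h *\<^sub>C z c"
        unfolding HyE[OF h] z_def by (rule adj.act_simps(2))
      also have "br (br h (F j)) (y - c *\<^sub>C E j) = - \<alpha> j h *\<^sub>C z c"
        unfolding root_spaceD[OF F_root[OF j] h] z_def by (rule adj.act_simps(7))
      finally show ?thesis by (simp add: complex_vector.scale_minus_left)
    qed
  qed
  have FE: "br (F j) (E j) = - H j" using br_anti[of "F j" "E j"] EF[OF j] by simp
  have "\<alpha> j (z c) = \<alpha> j (z 0) + 2 * c" for c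
  proof -
    have "z c = z 0 + c *\<^sub>C H j" by (simp add: z_def FE)
    hence "\<alpha> j (z c) = \<alpha> j (z 0) + \<alpha> j (c *\<^sub>C H j)"
      using cartan_dualD(1)[OF simple_root_dual[OF j] zc[of 0] cartan_closed(3)[OF H_cartan[OF j]]] by metis
    thus ?thesis
      using cartan_dualD(2)[OF simple_root_dual[OF j] H_cartan[OF j]] root_coroot_self[OF j] by simp
  qed
  from this[of "- \<alpha> j (z 0) / 2"] have "\<exists>c. \<alpha> j (z c) = 0" by auto
  then obtain c where c: "\<alpha> j (z c) = 0" by blast
  define v where "v = y - c *\<^sub>C E j"
  have "br (E j) (br (F j) v) = 0"
    using br_anti[of "E j" "z c"] root_spaceD[OF E_root[OF j] zc[of c]] c
    by (simp add: v_def z_def)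
  moreover have "br (F j) (br (E j) v) = br (E j) (br (F j) v) - br (H j) v"
    using adj.act_br[of "E j" "F j" v] EF[OF j] by simp
  moreover have Hv: "br (H j) v = 2 *\<^sub>C v"
    using HyE[OF H_cartan[OF j]] root_coroot_self[OF j] unfolding v_def by simp
  ultimately have F0: "br (F j) (br (E j) v) = - (2 *\<^sub>C v)" by simp
  have weight: "br (H j) ((br (E j) ^^ n) v) = (2 + 2 * of_nat n) *\<^sub>C (br (E j) ^^ n) v" for n
    by (rule adj.act_funpow_raise[OF HE[OF j] Hv])
  have lower: "br (F j) ((br (E j) ^^ Suc n) v) = (- (of_nat (Suc n) * of_nat (n + 2))) *\<^sub>C (br (E j) ^^ n) v" for n
  proof (induction n)
    case (Suc n)
    have "br (F j) ((br (E j) ^^ Suc (Suc n)) v)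
        = br (E j) (br (F j) ((br (E j) ^^ Suc n) v)) + br (- H j) ((br (E j) ^^ Suc n) v)"
      unfolding FE[symmetric] by (simp add: adj.act_swap[of "F j" "E j"])
    also have "br (- H j) ((br (E j) ^^ Suc n) v) = (- (2 + 2 * of_nat (Suc n))) *\<^sub>C (br (E j) ^^ Suc n) v"
      by (simp only: adj.act_simps(10) weight complex_vector.scale_minus_left)
    also have "br (E j) (br (F j) ((br (E j) ^^ Suc n) v))
        = (- (of_nat (Suc n) * of_nat (n + 2))) *\<^sub>C (br (E j) ^^ Suc n) v"
      by (simp only: Suc adj.act_simps(2)) (simp only: funpow.simps o_apply)
    also note complex_vector.scale_left_distrib[symmetric]
    also have "- (of_nat (Suc n) * of_nat (n + 2)) + - (2 + 2 * of_nat (Suc n))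
        = - (of_nat (Suc (Suc n)) * of_nat (Suc n + 2) :: complex)"
      by (simp add: algebra_simps)
    finally show ?case .
  qed (use F0 in simp)
  have "v = 0"
  proof (rule ccontr)
    assume v: "v \<noteq> 0"
    have "(br (E j) ^^ n) v \<noteq> 0" for n
    proof (induction n)
      case (Suc n)
      have "- (of_nat (Suc n) * of_nat (n + 2)) \<noteq> (0::complex)"
        by (simp del: of_nat_Suc of_nat_add)
      with Suc have "br (F j) ((br (E j) ^^ Suc n) v) \<noteq> 0"
        unfolding lower complex_vector.scale_eq_0_iff by blast
      thus ?case by (metis adj.act_simps(3))
    qed (use v in simp)
    thus False using ad_E_nilpotent[OF j] by blast
  qed
  thus ?thesis unfolding v_def by (intro exI[of _ c]) simp
qed

text \<open>For n >= 2 let y, of weight m \<alpha>_j, end the E_j-string through \<open>x\<close>.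
  Then F_j^(m-1) y has weight \<alpha>_j, so it is a multiple of \<open>E j\<close> and
  \<open>E j\<close> kills it; but the ladder formula gives (m-1)(m+2) F_j^(m-2) y, which is
  nonzero.\<close>

lemma root_multiple_simple:
  assumes j: "j \<in> nodes" and n: "1 \<le> n" and x: "x \<in> root_space G (\<lambda>h. of_nat n * \<alpha> j h)" "x \<noteq> 0"
  shows "n = 1"
proof (rule ccontr)
  assume "n \<noteq> 1"
  hence n2: "2 \<le> n" using n by simp
  define p where "p = (LEAST p. (br (E j) ^^ p) x = 0)"
  have p: "(br (E j) ^^ p) x = 0" "\<And>q. q < p \<Longrightarrow> (br (E j) ^^ q) x \<noteq> 0"
    unfolding p_def using ad_E_nilpotent[OF j] by (auto intro: LeastI_ex dest: not_less_Least)
  obtain q where q: "p = Suc q" using p(1) x(2) by (cases p) auto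
  define y where "y = (br (E j) ^^ q) x"
  define m where "m = n + q"
  have y: "y \<noteq> 0" "br (E j) y = 0" using p q by (auto simp: y_def)
  have "(\<lambda>h. of_nat n * \<alpha> j h + of_nat q * \<alpha> j h) = (\<lambda>h. of_nat m * \<alpha> j h)"
    by (simp add: m_def algebra_simps)
  hence yr: "y \<in> root_space G (\<lambda>h. of_nat m * \<alpha> j h)"
    using adjw.funpow_act_wsp[OF E_root[OF j], of x "\<lambda>h. of_nat n * \<alpha> j h" q] x(1)
    unfolding adj_wsp y_def by simp
  have Hy: "br (H j) y = (2 * of_nat m) *\<^sub>C y"
    using root_spaceD[OF yr H_cartan[OF j]] root_coroot_self[OF j] by (simp add: mult.commute)
  note ladder = adj.sl2_ladder(2)[OF EF[OF j] HF[OF j] y(2) Hy]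
  have nz: "(br (F j) ^^ i) y \<noteq> 0" if "i < m" for i
    using that
  proof (induction i)
    case (Suc i)
    have "2 * of_nat m - of_nat i = (of_nat (2 * m - i) :: complex)"
      using Suc.prems by (simp add: of_nat_diff)
    hence "of_nat (Suc i) * (2 * of_nat m - of_nat i) \<noteq> (0::complex)"
      using Suc.prems by (simp del: of_nat_Suc of_nat_diff)
    moreover have "(br (F j) ^^ i) y \<noteq> 0" using Suc by simp
    ultimately have "br (E j) ((br (F j) ^^ Suc i) y) \<noteq> 0"
      unfolding ladder complex_vector.scale_eq_0_iff by blast
    thus ?case by (metis adj.act_simps(3))
  qed (use y in simp)
  have m2: "m = Suc (Suc (m - 2))" using n2 by (simp add: m_def)
  have "(br (F j) ^^ (m - 1)) y \<in> root_space G (\<lambda>h. of_nat m * \<alpha> j h + of_nat (m - 1) * - \<alpha> j h)"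
    using adjw.funpow_act_wsp[OF F_root[OF j], of y "\<lambda>h. of_nat m * \<alpha> j h" "m - 1"] yr
    unfolding adj_wsp .
  moreover have "(\<lambda>h. of_nat m * \<alpha> j h + of_nat (m - 1) * - \<alpha> j h) = \<alpha> j"
  proof -
    have "of_nat (m - 1) = (of_nat m - 1 :: complex)" by (subst (2) m2) (subst m2, simp)
    thus ?thesis by (simp only:) (simp add: algebra_simps)
  qed
  ultimately obtain c where "(br (F j) ^^ (m - 1)) y = c *\<^sub>C E j"
    using root_space_simple[OF j] by force
  hence "br (E j) ((br (F j) ^^ Suc (m - 2)) y) = 0" using m2 by (metis adj.act_simps(2) br_self complex_vector.scale_zero_right diff_Suc_1)
  moreover have "2 * of_nat m - of_nat (m - 2) = (of_nat (m + 2) :: complex)"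
    using n2 by (simp add: m_def of_nat_diff del: of_nat_add)
  hence "of_nat (Suc (m - 2)) * (2 * of_nat m - of_nat (m - 2)) \<noteq> (0::complex)"
    by (simp del: of_nat_Suc of_nat_add)
  moreover have "(br (F j) ^^ (m - 2)) y \<noteq> 0" using nz m2 by simp
  ultimately show False
    unfolding ladder complex_vector.scale_eq_0_iff by metis
qed

text \<open>Reflections lower a positive root until it is simple: the pairing of a positive root with the coweight
  \<open>\<Sum>\<^sub>j f j H\<^sub>j\<close> is positive, so some \<open>H\<^sub>j\<close> is positive on it.\<close>

lemma positive_root_induct:
  assumes f: "\<And>j. j \<in> nodes \<Longrightarrow> 0 \<le> f j"
      "\<And>k. k \<in> nodes \<Longrightarrow> 0 < (\<Sum>j\<in>nodes. cartan_entry X k j * f j)"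
    and unit: "\<And>j. j \<in> nodes \<Longrightarrow> P (unit j)"
    and refl: "\<And>x j. j \<in> nodes \<Longrightarrow> P x \<Longrightarrow> P (reflect_coords X j x)"
    and x: "lc x \<in> roots G" "\<And>i. 0 \<le> x i" "\<And>i. i \<notin> nodes \<Longrightarrow> x i = 0"
  shows "P x"
  using x
proof (induction "nat (\<Sum>i\<in>nodes. x i)" arbitrary: x rule: less_induct)
  case less
  define s where "s j = (\<Sum>m\<in>nodes. x m * cartan_entry X m j)" for j
  have refl_s: "reflect_coords X j x = x(j := x j - s j)" for j by (simp add: reflect_coords_def s_def rank_eq)
  have "(\<Sum>j\<in>nodes. s j * f j) = (\<Sum>m\<in>nodes. x m * (\<Sum>j\<in>nodes. cartan_entry X m j * f j))"
    unfolding s_def sum_distrib_left sum_distrib_right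
    by (subst sum.swap) (simp add: mult.assoc)
  also obtain k where k: "k \<in> nodes" "x k \<noteq> 0" using root_nonzero[OF less.prems(1)] by blast
  have pos: "0 < x k * (\<Sum>j\<in>nodes. cartan_entry X k j * f j)"
    using k less.prems(2)[of k] f(2)[OF k(1)] by (simp add: less_le)
  have "0 < (\<Sum>m\<in>nodes. x m * (\<Sum>j\<in>nodes. cartan_entry X m j * f j))"
    by (rule sum_pos2[where i = k, OF _ k(1)]) (use pos less.prems(2) f(2) in \<open>simp_all add: less_imp_le\<close>)
  finally have "\<exists>j\<in>nodes. 0 < s j * f j"
    by (meson not_le sum_nonpos)
  then obtain j where j: "j \<in> nodes" "0 < s j"
    using f(1) by (metis mult_nonneg_nonpos2 mult.commute not_le)
  show ?case
  proof (cases "\<exists>m\<in>nodes. m \<noteq> j \<and> x m \<noteq> 0")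
    case False
    define n where "n = nat (x j)"
    have x: "x = (\<lambda>i. int n * unit j i)"
      using False less.prems(2,3) by (fastforce simp: n_def)
    have n: "1 \<le> n"
      using root_nonzero[OF less.prems(1)] False by (cases n) (auto simp: x)
    have lcx: "lc x = (\<lambda>h. of_nat n * \<alpha> j h)"
      by (rule ext) (subst x, simp add: lc_cmul lc_unit[OF j(1)])
    obtain a where "a \<in> root_space G (lc x)" "a \<noteq> 0"
      using less.prems(1) unfolding roots_def root_space_def by fastforce
    hence "n = 1" using root_multiple_simple[OF j(1) n, of a] unfolding lcx by blast
    hence "x = unit j" using x by auto
    thus ?thesis using unit[OF j(1)] by simp
  next
    case True
    then obtain m where m: "m \<in> nodes" "m \<noteq> j" "x m \<noteq> 0" by blast
    let ?y = "reflect_coords X j x"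
    have y: "lc ?y \<in> roots G" by (rule root_reflect[OF less.prems(1) j(1)])
    \<comment> \<open>The coordinate at \<open>m\<close> is untouched by the reflection in
      \<alpha>_j and positive, so the reflected root is still positive.\<close>
    have ym: "0 < ?y m" using m less.prems(2)[of m] by (simp add: refl_s less_le)
    have y0: "0 \<le> ?y i" for i
    proof (cases "i = j")
      case True
      thus ?thesis using root_sign[OF y m(1) j(1) ym] by simp
    qed (simp add: refl_s less.prems(2))
    have ysup: "?y i = 0" if "i \<notin> nodes" for i
      using that j(1) less.prems(3) by (auto simp: refl_s)
    have "(\<Sum>i\<in>nodes. ?y i) < (\<Sum>i\<in>nodes. x i)"
      by (rule sum_strict_mono_ex1) (use j in \<open>auto simp: refl_s\<close>)
    hence "nat (\<Sum>i\<in>nodes. ?y i) < nat (\<Sum>i\<in>nodes. x i)"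
      using y0 sum_nonneg[of nodes ?y] by (simp add: nat_less_eq_zless)
    from less.hyps[OF this y y0 ysup] have "P ?y" .
    hence "P (reflect_coords X j ?y)" by (rule refl[OF j(1)])
    moreover have "reflect_coords X j ?y = x"
    proof -
      have "(\<Sum>m\<in>nodes. ?y m * cartan_entry X m j) = s j - s j * 2"
        unfolding refl_s s_def
        by (subst (1 2) sum.remove[OF _ j(1)]) (auto simp: algebra_simps intro: sum.cong)
      thus ?thesis by (simp add: reflect_coords_def[of X j ?y] rank_eq[symmetric]) (simp add: refl_s)
    qed
    ultimately show ?thesis by simp
  qed
qed

section \<open>The highest root and the fundamental coweights\<close>

lemma highest_root_lc:
  obtains t where "highest_root G = lc t" "lc t \<in> roots G" "\<And>j. j \<in> nodes \<Longrightarrow> 1 \<le> t j"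
    "\<And>i. 0 \<le> t i" "\<And>i. i \<notin> nodes \<Longrightarrow> t i = 0"
proof -
  have r: "highest_root G \<in> roots G" using highest_root unfolding is_highest_root_def by blast
  obtain t where t: "highest_root G = lc t" "\<And>i. i \<notin> nodes \<Longrightarrow> t i = 0"
    using root_lc[OF r] by metis
  have t1: "1 \<le> t j" if j: "j \<in> nodes" for j
  proof -
    obtain n :: "nat \<Rightarrow> nat" where
      n: "highest_root G = (\<lambda>h. \<alpha> j h + (\<Sum>i=1..rank G. of_nat (n i) * \<alpha> i h))"
      using highest_root simple_root_root[OF j] unfolding is_highest_root_def by blast
    have "lc t h = lc (\<lambda>i. unit j i + int (n i)) h" for h
      unfolding t(1)[symmetric] n lc_add lc_unit[OF j] by (simp add: lc_def)
    from lc_inj[OF this j] show ?thesis by simp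
  qed
  have "0 \<le> t i" for i using t1[of i] t(2)[of i] by (cases "i \<in> nodes") auto
  thus ?thesis using that[of t] t t1 r by simp
qed

lemma cartan_sum: "(\<And>i. i \<in> L \<Longrightarrow> K i \<in> cartan G) \<Longrightarrow> (\<Sum>i\<in>L. c i *\<^sub>C K i) \<in> cartan G"
  by (rule complex_vector.subspace_sum[OF cartan_subspace]) (simp add: cartan_closed(3))

lemma cartan_dual_sum:
  assumes \<mu>: "\<mu> \<in> cartan_dual G" and "finite L" "\<And>i. i \<in> L \<Longrightarrow> K i \<in> cartan G"
  shows "\<mu> (\<Sum>i\<in>L. c i *\<^sub>C K i) = (\<Sum>i\<in>L. c i * \<mu> (K i))"
  using assms(2,3)
proof (induction L rule: finite_induct)
  case empty
  show ?case using cartan_dualD(2)[OF \<mu> cartan_closed(1), of 0] by simp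
next
  case (insert l L)
  have "(\<Sum>i\<in>L. c i *\<^sub>C K i) \<in> cartan G"
    by (rule cartan_sum) (simp add: insert.prems)
  moreover have "\<mu> (c l *\<^sub>C K l) = c l * \<mu> (K l)" "c l *\<^sub>C K l \<in> cartan G"
    by (simp_all add: cartan_dualD(2)[OF \<mu>] cartan_closed(3) insert.prems)
  ultimately have "\<mu> (c l *\<^sub>C K l + (\<Sum>i\<in>L. c i *\<^sub>C K i)) = c l * \<mu> (K l) + (\<Sum>i\<in>L. c i * \<mu> (K i))"
    using cartan_dualD(1)[OF \<mu>] insert.IH insert.prems by (metis insertI2)
  thus ?case unfolding sum.insert[OF insert.hyps] .
qed

text \<open>Existence behind the definite description of the fundamental coweights. A dual family
  for \<open>J\<close> is extended by \<open>k\<close> as in Gram-Schmidt: \<open>pr\<close> removes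
  the components along \<open>J\<close>, and if \<alpha>_k vanished on its range, \<alpha>_k would
  be a combination of the \<alpha>_i with i in \<open>J\<close>.\<close>

lemma dual_family:
  assumes "J \<subseteq> nodes"
  shows "\<exists>K. \<forall>i\<in>J. K i \<in> cartan G \<and> (\<forall>j\<in>J. \<alpha> j (K i) = (if j = i then 1 else 0))"
proof -
  have "finite J" using assms finite_subset by blast
  thus ?thesis using assms
  proof (induction J rule: finite_induct)
    case (insert k J)
    have k: "k \<in> nodes" and J: "J \<subseteq> nodes" using insert.prems by auto
    obtain K where K: "\<And>i. i \<in> J \<Longrightarrow> K i \<in> cartan G"
      "\<And>i j. i \<in> J \<Longrightarrow> j \<in> J \<Longrightarrow> \<alpha> j (K i) = (if j = i then 1 else 0)"
      using insert.IH J by blast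
    define pr where "pr x = x - (\<Sum>i\<in>J. \<alpha> i x *\<^sub>C K i)" for x
    have sum_cartan: "(\<Sum>i\<in>J. c i *\<^sub>C K i) \<in> cartan G" for c
      by (rule cartan_sum[OF K(1)])
    have sum_root: "\<alpha> j (\<Sum>i\<in>J. c i *\<^sub>C K i) = (\<Sum>i\<in>J. c i * \<alpha> j (K i))" if "j \<in> nodes" for j c
      by (rule cartan_dual_sum[OF simple_root_dual[OF that] insert.hyps(1) K(1)])
    have pr: "pr x \<in> cartan G" "\<alpha> k (pr x) = \<alpha> k x - (\<Sum>i\<in>J. \<alpha> i x * \<alpha> k (K i))"
      "\<And>j. j \<in> J \<Longrightarrow> \<alpha> j (pr x) = 0" if "x \<in> cartan G" for x
    proof -
      show "pr x \<in> cartan G" unfolding pr_def by (rule cartan_closed(4)[OF that sum_cartan])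
      have *: "\<alpha> j (pr x) = \<alpha> j x - (\<Sum>i\<in>J. \<alpha> i x * \<alpha> j (K i))" if "j \<in> nodes" for j
        unfolding pr_def cartan_dualD(4)[OF simple_root_dual[OF that] \<open>x \<in> cartan G\<close> sum_cartan]
          sum_root[OF that] ..
      show "\<alpha> k (pr x) = \<alpha> k x - (\<Sum>i\<in>J. \<alpha> i x * \<alpha> k (K i))" by (rule *[OF k])
      fix j assume j: "j \<in> J"
      have "(\<Sum>i\<in>J. \<alpha> i x * \<alpha> j (K i)) = (\<Sum>i\<in>J. if j = i then \<alpha> i x else 0)"
        by (rule sum.cong) (simp_all add: K(2)[OF _ j])
      thus "\<alpha> j (pr x) = 0" using *[of j] j J insert.hyps(1) by auto
    qed
    have "\<exists>x\<in>cartan G. \<alpha> k (pr x) \<noteq> 0"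
    proof (rule ccontr)
      assume "\<not> ?thesis"
      hence *: "\<alpha> k x = (\<Sum>i\<in>J. \<alpha> i x * \<alpha> k (K i))" if "x \<in> cartan G" for x
        using pr(2)[OF that] that by simp
      define c where "c i = (if i = k then - 1 else if i \<in> J then \<alpha> k (K i) else 0)" for i
      have "(\<Sum>i=1..rank G. c i * \<alpha> i h) = 0" for h
      proof (cases "h \<in> cartan G")
        case True
        have "(\<Sum>i\<in>nodes. c i * \<alpha> i h) = c k * \<alpha> k h + (\<Sum>i\<in>nodes - {k}. c i * \<alpha> i h)"
          using k by (intro sum.remove) auto
        also have "(\<Sum>i\<in>nodes - {k}. c i * \<alpha> i h) = (\<Sum>i\<in>J. c i * \<alpha> i h)"
          using J insert.hyps(2) by (intro sum.mono_neutral_right) (auto simp: c_def)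
        also have "\<dots> = (\<Sum>i\<in>J. \<alpha> i h * \<alpha> k (K i))"
          using insert.hyps(2) by (intro sum.cong) (auto simp: c_def)
        finally show ?thesis using *[OF True] by (simp add: c_def)
      qed (simp add: cartan_dualD(3)[OF simple_root_dual])
      moreover have "(\<forall>h. (\<Sum>i=1..rank G. c i * \<alpha> i h) = 0) \<longrightarrow> (\<forall>i\<in>nodes. c i = 0)"
        using root_base unfolding root_base_def by (elim conjE allE[of _ c])
      ultimately have "c k = 0" using k by blast
      thus False by (simp add: c_def)
    qed
    then obtain x where x: "x \<in> cartan G" "\<alpha> k (pr x) \<noteq> 0" by blast
    define Kk where "Kk = (1 / \<alpha> k (pr x)) *\<^sub>C pr x"
    have Kk: "Kk \<in> cartan G" "\<alpha> k Kk = 1" "\<And>j. j \<in> J \<Longrightarrow> \<alpha> j Kk = 0"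
    proof -
      show "Kk \<in> cartan G" unfolding Kk_def by (rule cartan_closed(3)[OF pr(1)[OF x(1)]])
      have *: "\<alpha> j Kk = \<alpha> j (pr x) / \<alpha> k (pr x)" if "j \<in> nodes" for j
        unfolding Kk_def cartan_dualD(2)[OF simple_root_dual[OF that] pr(1)[OF x(1)]] by simp
      show "\<alpha> k Kk = 1" using *[OF k] x(2) by simp
      show "\<alpha> j Kk = 0" if "j \<in> J" for j
        using *[of j] pr(3)[OF x(1) that] that J by auto
    qed
    define K' where "K' i = (if i = k then Kk else K i - \<alpha> k (K i) *\<^sub>C Kk)" for i
    have "\<alpha> j (K' i) = (if j = i then 1 else 0)" if "i \<in> insert k J" "j \<in> insert k J" for i j
    proof (cases "i = k")
      case True
      thus ?thesis using that(2) insert.hyps(2) Kk(2,3) by (auto simp: K'_def)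
    next
      case False
      have j: "j \<in> nodes" and i: "i \<in> J" using that k J False by auto
      have "\<alpha> j (K' i) = \<alpha> j (K i) - \<alpha> k (K i) * \<alpha> j Kk"
        using False cartan_dualD(4)[OF simple_root_dual[OF j] K(1)[OF i] cartan_closed(3)[OF Kk(1)]]
          cartan_dualD(2)[OF simple_root_dual[OF j] Kk(1)] by (simp add: K'_def)
      thus ?thesis using that(2) insert.hyps(2) Kk(2,3) K(2)[OF i] i by auto
    qed
    moreover have "K' i \<in> cartan G" if "i \<in> insert k J" for i
      using that Kk(1) K(1)[of i] cartan_closed(4)[OF K(1) cartan_closed(3)[OF Kk(1)], of i]
      by (auto simp: K'_def)
    ultimately show ?case by blast
  qed simp
qed

lemma fundamental_coweight:
  assumes "i \<in> nodes"
  shows "fundamental_coweight G i \<in> cartan G"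
    and "\<And>j. j \<in> nodes \<Longrightarrow> \<alpha> j (fundamental_coweight G i) = (if j = i then 1 else 0)"
proof -
  let ?P = "\<lambda>h. h \<in> cartan G \<and> (\<forall>j\<in>nodes. \<alpha> j h = (if j = i then 1 else 0))"
  have "\<exists>h. ?P h" using dual_family[OF order_refl] assms by blast
  moreover have "h = h'" if "?P h" "?P h'" for h h'
  proof -
    have "h - h' = 0"
      by (rule cartan_eq_0) (use that cartan_closed(4) in \<open>auto simp: cartan_dualD(4)[OF simple_root_dual]\<close>)
    thus ?thesis by simp
  qed
  ultimately have "\<exists>!h. ?P h" by (rule ex_ex1I)
  hence "?P (fundamental_coweight G i)"
    unfolding fundamental_coweight_def by (rule theI')
  thus "fundamental_coweight G i \<in> cartan G"
    "\<And>j. j \<in> nodes \<Longrightarrow> \<alpha> j (fundamental_coweight G i) = (if j = i then 1 else 0)" by blast+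
qed

end


section \<open>Twisted action of the affine Lie algebra\<close>

lemma eigen_sum_zero:
  assumes "clinear T" "finite S" "\<And>j. j \<in> S \<Longrightarrow> T (y j) = of_int j *\<^sub>C y j"
    and "(\<Sum>j\<in>S. y j) = 0" "j \<in> S"
  shows "y (j::int) = 0"
proof (rule eigenvector_not_in_span[where C = "{()}" and T = "\<lambda>_. T" and \<mu> = "\<lambda>_. of_int j"
      and B = "y ` (S - {j})"])
  show "\<exists>c. (\<forall>t\<in>{()}. T b = c t *\<^sub>C b) \<and> (\<exists>t\<in>{()}. c t \<noteq> of_int j)" if b: "b \<in> y ` (S - {j})" for b
  proof -
    obtain k where "k \<in> S" "k \<noteq> j" "b = y k" using b by blast
    thus ?thesis using assms(3) by (intro exI[of _ "\<lambda>_. of_int k"]) auto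
  qed
  have "y j = - (\<Sum>k\<in>S - {j}. y k)"
    using assms(2,4,5) by (simp add: sum.remove[of S j] eq_neg_iff_add_eq_0)
  moreover have "(\<Sum>k\<in>S - {j}. y k) \<in> complex_vector.span (y ` (S - {j}))"
    by (intro complex_vector.span_sum complex_vector.span_base) simp
  ultimately show "y j \<in> complex_vector.span (y ` (S - {j}))"
    by (simp only: complex_vector.span_neg)
qed (use assms in auto)

text \<open>Evaluates the definite description: two decompositions of one vector differ by
  eigenvectors for distinct integers with sum 0, hence agree.\<close>

lemma eigen_decomposition_eigenvector:
  assumes lin: "clinear (act (loop_elem H 0))" and v: "act (loop_elem H 0) v = of_int d *\<^sub>C v"
  shows "eigen_decomposition act H v = Poly_Mapping.single d v"
  unfolding eigen_decomposition_def
proof (rule the_equality)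
  show "(\<forall>j. act (loop_elem H 0) (lookup (Poly_Mapping.single d v) j)
          = of_int j *\<^sub>C lookup (Poly_Mapping.single d v) j) \<and>
      (\<Sum>j\<in>keys (Poly_Mapping.single d v). lookup (Poly_Mapping.single d v) j) = v"
    using v clinear_zero[OF lin] by (auto simp: lookup_single when_def)
next
  fix D
  assume D: "(\<forall>j. act (loop_elem H 0) (lookup D j) = of_int j *\<^sub>C lookup D j) \<and>
      (\<Sum>j\<in>keys D. lookup D j) = v"
  define y where "y j = lookup D j - lookup (Poly_Mapping.single d v) j" for j
  let ?S = "insert d (keys D)"
  have y: "act (loop_elem H 0) (y j) = of_int j *\<^sub>C y j" for j
    using D v clinear_zero[OF lin]
    by (auto simp: y_def clinear_diff[OF lin] complex_vector.scale_right_diff_distrib lookup_single when_def)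
  have "(\<Sum>j\<in>?S. lookup D j) = (\<Sum>j\<in>keys D. lookup D j)"
    by (rule sum.mono_neutral_right) (auto simp: in_keys_iff)
  moreover have "(\<Sum>j\<in>?S. lookup (Poly_Mapping.single d v) j) = (\<Sum>j\<in>{d}. lookup (Poly_Mapping.single d v) j)"
    by (rule sum.mono_neutral_right) (auto simp: lookup_single when_def)
  ultimately have "(\<Sum>j\<in>?S. y j) = 0"
    using D by (simp add: y_def sum_subtractf)
  hence "y j = 0" if "j \<in> ?S" for j
    by (intro eigen_sum_zero[OF lin _ y _ that]) auto
  moreover have "y j = 0" if "j \<notin> ?S" for j
    using that by (auto simp: y_def in_keys_iff lookup_single when_def)
  ultimately show "D = Poly_Mapping.single d v"
    by (intro poly_mapping_eqI) (metis y_def right_minus_eq)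
qed

lemma affine_bracket_loop:
  assumes "lie_algebra (bracket G)" "cbilinear (inv_form G)"
  shows "affine_bracket G (loop_elem a m) (loop_elem b n)
    = loop_elem (bracket G a b) (m + n) + (if m + n = 0 then of_int m * inv_form G a b else 0) *\<^sub>C central_elem"
proof -
  have *: "bracket G 0 b = 0" "bracket G a 0 = 0" "inv_form G 0 b = 0" "inv_form G a 0 = 0"
    using assms clinear_zero unfolding lie_algebra_def cbilinear_def by blast+
  \<comment> \<open>A zero argument gives a loop element of empty support, hence an empty double
    sum; the bracket and the form vanish too.\<close>
  show ?thesis
    using * by (cases "a = 0"; cases "b = 0")
      (auto simp: affine_bracket_def loop_elem_def central_elem_def scaleC_prod_def scaleC_complex_def
        lookup_single zero_prod_def)
qed

text \<open>The evaluation is a sum over the support, so equal tensors would merge; the differences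
  have the shape of the balancing relations.\<close>

lemma induced_eval_diff:
  assumes "A \<noteq> B"
  shows "induced_eval act \<iota> (Poly_Mapping.single A 1 - Poly_Mapping.single B 1)
    = foldr act (fst A) (\<iota> (snd A)) - foldr act (fst B) (\<iota> (snd B))"
proof -
  let ?p = "Poly_Mapping.single A 1 - Poly_Mapping.single B (1::complex)"
  have l: "lookup ?p A = 1" "lookup ?p B = - 1"
    using assms by (auto simp: lookup_minus lookup_single when_def)
  have "keys ?p \<subseteq> {A, B}"
    by (auto simp: in_keys_iff lookup_minus lookup_single when_def split: if_splits)
  hence "induced_eval act \<iota> ?p = (\<Sum>(u, w)\<in>{A, B}. lookup ?p (u, w) *\<^sub>C foldr act u (\<iota> w))"
    unfolding induced_eval_def by (intro sum.mono_neutral_left) (auto simp: in_keys_iff)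
  also have "\<dots> = foldr act (fst A) (\<iota> (snd A)) - foldr act (fst B) (\<iota> (snd B))"
    using assms l by (simp add: split_beta complex_vector.scale_minus_left)
  finally show ?thesis .
qed

text \<open>The balancing relation for the empty word lies in the kernel of the evaluation. The
  lists \<open>[p]\<close> and \<open>[]\<close> differ, so the two terms never merge.\<close>

lemma parabolic_on_top:
  assumes V: "induced_module G K actW actV \<iota>" and M: "irreducible_quotient G actV actM q"
    and p: "p \<in> parabolic"
  shows "actM p (q (\<iota> w)) = q (\<iota> (parabolic_action K actW p w))"
proof -
  let ?r = "pure_tensor ([] @ [p]) w - pure_tensor [] (parabolic_action K actW p w)"
  have "?r \<in> induced_relations G K actW"
    unfolding induced_relations_def by (rule complex_vector.span_base) (use p in blast)
  hence "induced_eval actV \<iota> ?r = 0"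
    using V unfolding induced_module_def by blast
  hence "actV p (\<iota> w) = \<iota> (parabolic_action K actW p w)"
    by (subst (asm) induced_eval_diff) auto
  thus ?thesis using M unfolding irreducible_quotient_def by metis
qed

lemma loop_parabolic: "0 \<le> n \<Longrightarrow> loop_elem a n \<in> parabolic"
  and central_parabolic: "central_elem \<in> parabolic"
  by (auto simp: parabolic_def loop_elem_def central_elem_def)

context
  fixes G :: "'g::complex_vector chevalley_data" and K :: complex
    and actW :: "'g \<Rightarrow> 'w::complex_vector \<Rightarrow> 'w" and actV :: "'g affine \<Rightarrow> 'v::complex_vector \<Rightarrow> 'v"
    and \<iota> actM and q :: "'v \<Rightarrow> 'm::complex_vector"
  assumes V: "induced_module G K actW actV \<iota>" and M: "irreducible_quotient G actV actM q"
    and W0: "\<And>w. actW 0 w = 0"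
begin

lemma top_linear: "clinear (\<lambda>w. q (\<iota> w))"
  using V M unfolding induced_module_def irreducible_quotient_def clinear_iff by simp

lemma loop_0_on_top: "actM (loop_elem a 0) (q (\<iota> w)) = q (\<iota> (actW a w))"
  using parabolic_on_top[OF V M loop_parabolic[of 0]]
  by (simp add: parabolic_action_def loop_elem_def)

lemma loop_pos_on_top: "0 < n \<Longrightarrow> actM (loop_elem a n) (q (\<iota> w)) = 0"
  using parabolic_on_top[OF V M loop_parabolic[of n a]] clinear_zero[OF top_linear]
  by (simp add: parabolic_action_def loop_elem_def lookup_single when_def W0)

lemma central_on_top: "actM central_elem (q (\<iota> w)) = K *\<^sub>C q (\<iota> w)"
proof -
  have "actM central_elem (q (\<iota> w)) = q (\<iota> (K *\<^sub>C w))"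
    using parabolic_on_top[OF V M central_parabolic]
    by (simp add: parabolic_action_def central_elem_def W0)
  thus ?thesis using top_linear unfolding clinear_iff by simp
qed

end

section \<open>Li's operator on the generators a(-1)1 of L(k, 0)\<close>

context
  fixes G :: "'g::complex_vector chevalley_data" and K :: complex
    and act0 :: "'g affine \<Rightarrow> 'v::complex_vector \<Rightarrow> 'v" and vac :: 'v
    and act :: "'g affine \<Rightarrow> 'm::complex_vector \<Rightarrow> 'm" and YM
  assumes lie: "lie_algebra (bracket G)" and form: "cbilinear (inv_form G)"
    and act0: "lie_module (affine_bracket G) act0"
    and vac_loop: "\<And>a n. 0 \<le> n \<Longrightarrow> act0 (loop_elem a n) vac = 0"
    and vac_central: "act0 central_elem vac = K *\<^sub>C vac"
    and YM_linear: "\<And>n w. clinear (\<lambda>v. YM v n w)"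
    and YM_vac: "\<And>n w. YM vac n w = (if n = - 1 then w else 0)"
    and YM_ext: "extends_affine_action act0 vac act YM"
begin

interpretation a0: lie_mod "affine_bracket G" act0 by (rule lie_mod.intro[OF act0])

abbreviation gen :: "'g \<Rightarrow> 'v" where "gen a \<equiv> act0 (loop_elem a (- 1)) vac"

text \<open>h(n) kills the vacuum, so only its commutator with a(-1) remains. Consequently the
  exponential in Li's operator stops after the linear term.\<close>

lemma loop_gen:
  assumes "0 \<le> n"
  shows "act0 (loop_elem h n) (gen a)
    = (if n = 0 then gen (bracket G h a) else if n = 1 then (K * inv_form G h a) *\<^sub>C vac else 0)"
proof -
  have "act0 (loop_elem h n) (gen a) = act0 (affine_bracket G (loop_elem h n) (loop_elem a (- 1))) vac"
    using a0.act_swap[of "loop_elem h n" "loop_elem a (- 1)" vac] vac_loop[OF assms] by simp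
  also have "\<dots> = act0 (loop_elem (bracket G h a) (n - 1)) vac
      + (if n = 1 then inv_form G h a else 0) *\<^sub>C (K *\<^sub>C vac)"
    by (simp add: affine_bracket_loop[OF lie form] vac_central)
  finally show ?thesis using assms vac_loop[of "n - 1"] by (auto simp: mult.commute)
qed

lemma gen_scale: "gen (c *\<^sub>C a) = c *\<^sub>C gen a"
proof -
  have "loop_elem (c *\<^sub>C a) n = c *\<^sub>C loop_elem a n" for n
    by (auto simp: loop_elem_def scaleC_prod_def scaleC_complex_def lookup_scaleC lookup_single when_def
        intro!: poly_mapping_eqI)
  thus ?thesis by simp
qed

text \<open>In closed form \<Delta>(h, x) v = x^d v + c x^(-1) 1: the vacuum has h(0)-eigenvalue 0,
  so its power of x comes from the exponential alone.\<close>

lemma li_delta_eigen: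
  assumes exp0: "\<And>s. 2 \<le> s \<Longrightarrow> li_exp act0 h s v = 0" and exp1: "li_exp act0 h 1 v = c *\<^sub>C vac"
    and v: "act0 (loop_elem h 0) v = of_int d *\<^sub>C v"
  shows "li_delta act0 h p v = (if p = d then v else 0) + (if p = - 1 then c *\<^sub>C vac else 0)"
proof -
  note ed = eigen_decomposition_eigenvector[where act = act0 and H = h, OF a0.act_clinear(1)]
  have e: "eigen_decomposition act0 h (li_exp act0 h s v)
      = (if s = 0 then Poly_Mapping.single d v else if s = 1 then Poly_Mapping.single 0 (c *\<^sub>C vac) else 0)" for s
  proof -
    have "li_exp act0 h 0 v = v" by (simp add: li_exp_def)
    moreover have "eigen_decomposition act0 h (c *\<^sub>C vac) = Poly_Mapping.single 0 (c *\<^sub>C vac)"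
      by (rule ed) (simp add: vac_loop)
    moreover have "eigen_decomposition act0 h 0 = 0"
      using ed[of 0 0] by simp
    moreover have "s = 0 \<or> s = 1 \<or> 2 \<le> s" by linarith
    ultimately show ?thesis using ed[OF v] exp0 exp1 by auto
  qed
  have "li_delta act0 h p v = Sum_any (\<lambda>s::nat. (if s = 0 then lookup (Poly_Mapping.single d v) p else 0)
      + (if s = 1 then lookup (Poly_Mapping.single 0 (c *\<^sub>C vac)) (p + 1) else 0))"
    unfolding li_delta_def e by (rule arg_cong[where f = Sum_any]) auto
  also have "\<dots> = (\<Sum>s\<in>{0,1::nat}. (if s = 0 then lookup (Poly_Mapping.single d v) p else 0)
      + (if s = 1 then lookup (Poly_Mapping.single 0 (c *\<^sub>C vac)) (p + 1) else 0))"
    by (rule Sum_any.expand_superset) (auto split: if_splits)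
  also have "\<dots> = (if p = d then v else 0) + (if p = - 1 then c *\<^sub>C vac else 0)"
    by (auto simp: lookup_single when_def)
  finally show ?thesis .
qed

text \<open>The factor (-1)^n / (-n) equals 1 at n = 1, and a second factor h(n) would hit the
  vacuum.\<close>

lemma li_exp_power_gen:
  "li_exp_power act0 h r s (gen a) = (if s = 0 \<and> r = 0 then gen a
     else if s = 1 \<and> r = 1 then (K * inv_form G h a) *\<^sub>C vac else 0)"
proof (induction r arbitrary: s)
  case (Suc r)
  have "(\<Sum>n = 1..s. ((- 1) ^ n / - of_nat n) *\<^sub>C act0 (loop_elem h (int n)) (li_exp_power act0 h r (s - n) (gen a)))
      = (\<Sum>n = 1..s. if n = 1 \<and> s = 1 \<and> r = 0 then (K * inv_form G h a) *\<^sub>C vac else 0)"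
    by (rule sum.cong) (auto simp: Suc loop_gen vac_loop)
  thus ?case by auto
qed auto

lemma li_exp_gen:
  "2 \<le> s \<Longrightarrow> li_exp act0 h s (gen a) = 0"
  "li_exp act0 h 1 (gen a) = (K * inv_form G h a) *\<^sub>C vac"
  by (simp_all add: li_exp_def li_exp_power_gen)

text \<open>The term x^d \<open>gen a\<close> shifts the mode by \<open>d\<close>; the vacuum, with
  x^(-1), has the identity as vertex operator and contributes at n = 0 only.\<close>

lemma li_twist_gen:
  assumes "bracket G h a = of_int d *\<^sub>C a"
  shows "li_twist act0 YM h (gen a) n w
    = act (loop_elem a (n + d)) w + (if n = 0 then (K * inv_form G h a) *\<^sub>C w else 0)"
proof -
  have v: "act0 (loop_elem h 0) (gen a) = of_int d *\<^sub>C gen a"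
    by (simp add: loop_gen assms gen_scale)
  have delta: "li_delta act0 h p (gen a)
      = (if p = d then gen a else 0) + (if p = - 1 then (K * inv_form G h a) *\<^sub>C vac else 0)" for p
    by (rule li_delta_eigen[OF li_exp_gen(1) li_exp_gen(2) v])
  have YM0: "YM (x + y) m w = YM x m w + YM y m w" "YM (b *\<^sub>C x) m w = b *\<^sub>C YM x m w" "YM 0 m w = 0"
    for x y b m
    using YM_linear[of m w] clinear_zero[OF YM_linear] unfolding clinear_iff by auto
  have "li_twist act0 YM h (gen a) n w = Sum_any (\<lambda>p. (if p = d then act (loop_elem a (n + d)) w else 0)
      + (if p = - 1 then (if n = 0 then (K * inv_form G h a) *\<^sub>C w else 0) else 0))"
    unfolding li_twist_def delta
    by (rule arg_cong[where f = Sum_any])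
       (use YM_ext in \<open>auto simp: fun_eq_iff YM0 YM_vac extends_affine_action_def\<close>)
  also have "\<dots> = (\<Sum>p\<in>{d, - 1}. (if p = d then act (loop_elem a (n + d)) w else 0)
      + (if p = - 1 then (if n = 0 then (K * inv_form G h a) *\<^sub>C w else 0) else 0))"
    by (rule Sum_any.expand_superset) (auto split: if_splits)
  also have "\<dots> = act (loop_elem a (n + d)) w + (if n = 0 then (K * inv_form G h a) *\<^sub>C w else 0)"
    by (cases "d = - 1") auto
  finally show ?thesis .
qed

lemma twisted_action_loop:
  assumes "bracket G h a = of_int d *\<^sub>C a"
  shows "twisted_affine_action K act0 vac YM h (loop_elem a n) w
    = act (loop_elem a (n + d)) w + (if n = 0 then (K * inv_form G h a) *\<^sub>C w else 0)"
proof (cases "a = 0")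
  case True
  \<comment> \<open>\<open>loop_elem 0 n\<close> has empty support, so the left side is an empty
    sum. On the right, \<open>act\<close> is accessible through \<open>YM\<close>, which is linear
    in its first argument.\<close>
  have "act (loop_elem 0 m) w = 0" for m
  proof -
    have "gen 0 = 0" using gen_scale[of 0 0] by simp
    hence "YM (gen 0) m w = 0" using clinear_zero[OF YM_linear] by simp
    thus ?thesis using YM_ext unfolding extends_affine_action_def by metis
  qed
  moreover have "inv_form G h 0 = 0" using form clinear_zero unfolding cbilinear_def by blast
  ultimately show ?thesis using True by (simp add: twisted_affine_action_def loop_elem_def)
next
  case False
  thus ?thesis using li_twist_gen[OF assms] by (simp add: twisted_affine_action_def loop_elem_def)
qed

end


section \<open>Column sums of Cartan matrices\<close>

abbreviation colsum :: "dynkin \<Rightarrow> nat \<Rightarrow> (nat \<Rightarrow> int) \<Rightarrow> int" where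
  "colsum X j x \<equiv> \<Sum>m=1..dynkin_rank X. x m * cartan_entry X m j"

lemma cartan_entry_D:
  assumes "3 \<le> l" "1 \<le> i" "1 \<le> j"
  shows "cartan_entry (Type_D l) i j =
    (if i = j then 2
     else if (j = i + 1 \<and> j \<le> l - 1) \<or> (i = j + 1 \<and> i \<le> l - 1) \<or>
       (i = l - 2 \<and> j = l) \<or> (i = l \<and> j = l - 2) then - 1 else 0)"
proof -
  have "{i, j} \<in> {{m, m + 1} |m. 1 \<le> m \<and> m \<le> l - 2} \<union> {{l - 2, l}} \<longleftrightarrow>
      (j = i + 1 \<and> j \<le> l - 1) \<or> (i = j + 1 \<and> i \<le> l - 1) \<or>
       (i = l - 2 \<and> j = l) \<or> (i = l \<and> j = l - 2)"
    using assms by (auto simp: doubleton_eq_iff)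
  thus ?thesis by simp
qed

lemma colsum_A:
  "1 \<le> j \<Longrightarrow> j \<le> l \<Longrightarrow> colsum (Type_A l) j x =
     2 * x j - (if 1 < j then x (j - 1) else 0) - (if j < l then x (j + 1) else 0)" (is "_ \<Longrightarrow> _ \<Longrightarrow> _ = ?rhs")
proof -
  assume j: "1 \<le> j" "j \<le> l"
  have "colsum (Type_A l) j x = (\<Sum>m=1..l. (if m = j then 2 * x m else 0)
      - (if m = j - 1 then x m else 0) - (if m = j + 1 then x m else 0))"
    unfolding dynkin_rank.simps
  proof (rule sum.cong)
    fix m assume m: "m \<in> {1..l}"
    consider "m = j" | "j = Suc m" | "m = Suc j" | "m \<noteq> j" "j \<noteq> Suc m" "m \<noteq> Suc j" by blast
    thus "x m * cartan_entry (Type_A l) m j = (if m = j then 2 * x m else 0)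
      - (if m = j - 1 then x m else 0) - (if m = j + 1 then x m else 0)"
      by cases (use m j in auto)
  qed simp
  also have "\<dots> = ?rhs" unfolding sum_subtractf sum.delta[OF finite_atLeastAtMost] using j by auto
  finally show ?thesis .
qed

lemma colsum_B:
  "1 \<le> j \<Longrightarrow> j \<le> l \<Longrightarrow> colsum (Type_B l) j x =
     2 * x j - (if 1 < j then (if j = l then 2 else 1) * x (j - 1) else 0) - (if j < l then x (j + 1) else 0)" (is "_ \<Longrightarrow> _ \<Longrightarrow> _ = ?rhs")
proof -
  assume j: "1 \<le> j" "j \<le> l"
  have "colsum (Type_B l) j x = (\<Sum>m=1..l. (if m = j then 2 * x m else 0)
      - (if m = j - 1 then (if j = l then 2 else 1) * x m else 0) - (if m = j + 1 then x m else 0))"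
    unfolding dynkin_rank.simps
  proof (rule sum.cong)
    fix m assume m: "m \<in> {1..l}"
    consider "m = j" | "j = Suc m" | "m = Suc j" | "m \<noteq> j" "j \<noteq> Suc m" "m \<noteq> Suc j" by blast
    thus "x m * cartan_entry (Type_B l) m j = (if m = j then 2 * x m else 0)
      - (if m = j - 1 then (if j = l then 2 else 1) * x m else 0) - (if m = j + 1 then x m else 0)"
      by cases (use m j in auto)
  qed simp
  also have "\<dots> = ?rhs" unfolding sum_subtractf sum.delta[OF finite_atLeastAtMost] using j by auto
  finally show ?thesis .
qed

lemma colsum_C:
  "1 \<le> j \<Longrightarrow> j \<le> l \<Longrightarrow> colsum (Type_C l) j x =
     2 * x j - (if 1 < j then x (j - 1) else 0) - (if j < l then (if j + 1 = l then 2 else 1) * x (j + 1) else 0)" (is "_ \<Longrightarrow> _ \<Longrightarrow> _ = ?rhs")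
proof -
  assume j: "1 \<le> j" "j \<le> l"
  have "colsum (Type_C l) j x = (\<Sum>m=1..l. (if m = j then 2 * x m else 0)
      - (if m = j - 1 then x m else 0) - (if m = j + 1 then (if j + 1 = l then 2 else 1) * x m else 0))"
    unfolding dynkin_rank.simps
  proof (rule sum.cong)
    fix m assume m: "m \<in> {1..l}"
    consider "m = j" | "j = Suc m" | "m = Suc j" | "m \<noteq> j" "j \<noteq> Suc m" "m \<noteq> Suc j" by blast
    thus "x m * cartan_entry (Type_C l) m j = (if m = j then 2 * x m else 0)
      - (if m = j - 1 then x m else 0) - (if m = j + 1 then (if j + 1 = l then 2 else 1) * x m else 0)"
      by cases (use m j in auto)
  qed simp
  also have "\<dots> = ?rhs" unfolding sum_subtractf sum.delta[OF finite_atLeastAtMost] using j by auto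
  finally show ?thesis .
qed

lemma colsum_D:
  "3 \<le> l \<Longrightarrow> 1 \<le> j \<Longrightarrow> j \<le> l \<Longrightarrow> colsum (Type_D l) j x =
     2 * x j - (if 1 < j \<and> j < l then x (j - 1) else 0) - (if j + 1 < l then x (j + 1) else 0)
       - (if j = l then x (l - 2) else 0) - (if j = l - 2 then x l else 0)" (is "_ \<Longrightarrow> _ \<Longrightarrow> _ \<Longrightarrow> _ = ?rhs")
proof -
  assume j: "3 \<le> l" "1 \<le> j" "j \<le> l"
  have "colsum (Type_D l) j x = (\<Sum>m=1..l. (if m = j then 2 * x m else 0)
      - (if m = j - 1 then (if j < l then x m else 0) else 0) - (if m = j + 1 then (if j + 1 < l then x m else 0) else 0)
      - (if m = l - 2 then (if j = l then x m else 0) else 0) - (if m = l then (if j = l - 2 then x m else 0) else 0))"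
    unfolding dynkin_rank.simps
  proof (rule sum.cong)
    fix m assume m: "m \<in> {1..l}"
    hence e: "cartan_entry (Type_D l) m j =
        (if m = j then 2
         else if (j = m + 1 \<and> j \<le> l - 1) \<or> (m = j + 1 \<and> m \<le> l - 1) \<or>
           (m = l - 2 \<and> j = l) \<or> (m = l \<and> j = l - 2) then - 1 else 0)"
      by (intro cartan_entry_D) (use j in auto)
    consider "m = j" | "j = Suc m" | "m = Suc j" | "m \<noteq> j" "j \<noteq> Suc m" "m \<noteq> Suc j" by blast
    thus "x m * cartan_entry (Type_D l) m j = (if m = j then 2 * x m else 0)
      - (if m = j - 1 then (if j < l then x m else 0) else 0) - (if m = j + 1 then (if j + 1 < l then x m else 0) else 0)
      - (if m = l - 2 then (if j = l then x m else 0) else 0) - (if m = l then (if j = l - 2 then x m else 0) else 0)"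
      unfolding e by cases (use m j in auto)
  qed simp
  also have "\<dots> = ?rhs" unfolding sum_subtractf sum.delta[OF finite_atLeastAtMost] using j by auto
  finally show ?thesis .
qed

text \<open>Turns the row sums for coweights into column sums; transposition exchanges types B and
  C.\<close>

lemma cartan_entry_transpose:
  "cartan_entry (Type_A l) i j = cartan_entry (Type_A l) j i"
  "cartan_entry (Type_B l) i j = cartan_entry (Type_C l) j i"
  "cartan_entry (Type_D l) i j = cartan_entry (Type_D l) j i"
  by (auto simp: insert_commute)

text \<open>The witnesses are multiples of the coefficients of \<open>\<rho>\<^sup>\<or>\<close> in the simple coroots; any dominant regular
  coweight with nonnegative coefficients would do.\<close>

lemma positive_coweight:
  assumes "valid_dynkin X"
  shows "\<exists>f. (\<forall>j\<in>{1..dynkin_rank X}. 0 \<le> f j) \<and>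
     (\<forall>k\<in>{1..dynkin_rank X}. 0 < (\<Sum>j=1..dynkin_rank X. cartan_entry X k j * f j))"
proof (cases X)
  case (Type_A l)
  let ?f = "\<lambda>j. int j * (int l + 1 - int j)"
  have "(\<Sum>j=1..l. cartan_entry (Type_A l) k j * ?f j) = colsum (Type_A l) k ?f" for k
    unfolding cartan_entry_transpose(1)[of l k] by (simp only: mult.commute dynkin_rank.simps)
  moreover have "0 < colsum (Type_A l) k ?f" if "1 \<le> k" "k \<le> l" for k
    using that unfolding colsum_A[OF that] by (auto simp: of_nat_diff algebra_simps)
  ultimately show ?thesis using Type_A by (intro exI[of _ ?f]) auto
next
  case (Type_B l)
  let ?f = "\<lambda>j. if j = l then int l * (int l + 1) else 2 * int j * (2 * int l + 1 - int j)"
  have l: "2 \<le> l" using assms Type_B by simp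
  have "(\<Sum>j=1..l. cartan_entry (Type_B l) k j * ?f j) = colsum (Type_C l) k ?f" for k
    unfolding cartan_entry_transpose(2)[of l k] by (simp only: mult.commute dynkin_rank.simps)
  moreover have "0 < colsum (Type_C l) k ?f" if k: "1 \<le> k" "k \<le> l" for k
  proof -
    consider "k = l" | "k + 1 = l" | "k + 1 < l" using k by linarith
    thus ?thesis
    proof cases
      case 1
      then obtain n where "l = Suc n" using l by (cases l) auto
      thus ?thesis using 1 l unfolding colsum_C[OF k] by (simp add: algebra_simps)
    next
      case 2
      thus ?thesis using k l unfolding colsum_C[OF k] by (auto simp: of_nat_diff algebra_simps)
    next
      case 3
      thus ?thesis using k l unfolding colsum_C[OF k] by (auto simp: of_nat_diff algebra_simps)
    qed
  qed
  ultimately show ?thesis using Type_B by (intro exI[of _ ?f]) auto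
next
  case (Type_C l)
  let ?f = "\<lambda>j. int j * (2 * int l - int j)"
  have l: "2 \<le> l" using assms Type_C by simp
  have "(\<Sum>j=1..l. cartan_entry (Type_C l) k j * ?f j) = colsum (Type_B l) k ?f" for k
    unfolding cartan_entry_transpose(2)[of l _ k, symmetric] by (simp only: mult.commute dynkin_rank.simps)
  moreover have "0 < colsum (Type_B l) k ?f" if "1 \<le> k" "k \<le> l" for k
    using that l unfolding colsum_B[OF that] by (auto simp: of_nat_diff algebra_simps)
  ultimately show ?thesis using Type_C by (intro exI[of _ ?f]) auto
next
  case (Type_D l)
  let ?f = "\<lambda>j. if l \<le> j + 1 then int l * (int l - 1) else 2 * int j * (2 * int l - 1 - int j)"
  have l: "3 \<le> l" using assms Type_D by simp
  have "(\<Sum>j=1..l. cartan_entry (Type_D l) k j * ?f j) = colsum (Type_D l) k ?f" for k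
    unfolding cartan_entry_transpose(3)[of l k] by (simp only: mult.commute dynkin_rank.simps)
  moreover have "0 < colsum (Type_D l) k ?f" if k: "1 \<le> k" "k \<le> l" for k
  proof -
    consider "k = l" | "k + 1 = l" | "k + 2 = l" | "k + 2 < l" using k by linarith
    thus ?thesis
      unfolding colsum_D[OF l k] by cases (use k l in \<open>auto simp: of_nat_diff algebra_simps\<close>)
  qed
  ultimately show ?thesis using Type_D by (intro exI[of _ ?f]) auto
next
  case Type_E6
  have s: "{1..6::nat} = {1, 2, 3, 4, 5, 6}" by auto
  \<comment> \<open>The leading 0 pads position 0, since the nodes start at 1.\<close>
  show ?thesis unfolding Type_E6 dynkin_rank.simps s
    by (intro exI[of _ "\<lambda>j. [0, 8, 11, 15, 21, 15, 8] ! j"]) (simp add: doubleton_eq_iff)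
next
  case Type_E7
  have s: "{1..7::nat} = {1, 2, 3, 4, 5, 6, 7}" by auto
  show ?thesis unfolding Type_E7 dynkin_rank.simps s
    by (intro exI[of _ "\<lambda>j. [0, 34, 49, 66, 96, 75, 52, 27] ! j"]) (simp add: doubleton_eq_iff)
qed

lemma minuscule_nodes_subset: "valid_dynkin X \<Longrightarrow> minuscule_nodes X \<subseteq> {1..dynkin_rank X}"
  by (cases X) auto


section \<open>Coefficients of roots at minuscule nodes\<close>

text \<open>A certificate free of Lie theory, shaped for \<open>positive_root_induct\<close>:
  \<open>P\<close> then holds at every positive root and bounds its coefficient at
  \<open>i\<close>.\<close>

definition coefficient_le_1 :: "dynkin \<Rightarrow> nat \<Rightarrow> bool" where
  "coefficient_le_1 X i \<longleftrightarrow> (\<exists>P. (\<forall>j\<in>{1..dynkin_rank X}. P (unit j)) \<and>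
     (\<forall>j\<in>{1..dynkin_rank X}. \<forall>x. P x \<longrightarrow> P (reflect_coords X j x)) \<and> (\<forall>x. P x \<longrightarrow> x i \<le> 1))"

text \<open>A coweight is given by its values \<open>y m\<close> on the simple roots, and \<open>Y\<close> is a superset of the Weyl orbit of
  the minuscule coweight at node \<open>i\<close> on which all simple roots are at most 1. In the classical types \<open>Y\<close> is
  described below by the \<open>\<epsilon>\<close>-coordinates \<open>f\<close> of coweights, shifted by \<open>1/2\<close> in the half-integral cases.\<close>

lemma orbit_bound:
  assumes bound: "\<And>y j. y \<in> Y \<Longrightarrow> j \<in> {1..dynkin_rank X} \<Longrightarrow> y j \<le> (1::int)"
    and closed: "\<And>y j. y \<in> Y \<Longrightarrow> j \<in> {1..dynkin_rank X} \<Longrightarrow>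
      \<exists>y'\<in>Y. \<forall>m\<in>{1..dynkin_rank X}. y' m = y m - cartan_entry X m j * y j"
    and base: "\<exists>y\<in>Y. \<forall>m\<in>{1..dynkin_rank X}. y m = unit i m" and i: "i \<in> {1..dynkin_rank X}"
  shows "coefficient_le_1 X i"
proof -
  let ?I = "{1..dynkin_rank X}"
  \<comment> \<open>Reflecting the root or the coweight gives the same pairing, so closure of
    \<open>Y\<close> makes \<open>P\<close> reflection-stable; the base coweight reads off the
    coefficient at \<open>i\<close>.\<close>
  define P where "P x \<longleftrightarrow> (\<forall>y\<in>Y. (\<Sum>m\<in>?I. x m * y m) \<le> 1)" for x
  have unit: "P (unit j)" if j: "j \<in> ?I" for j
  proof -
    have "(\<Sum>m\<in>?I. unit j m * y m) = y j" for y :: "nat \<Rightarrow> int"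
    proof -
      have "(\<Sum>m\<in>?I. unit j m * y m) = (\<Sum>m\<in>?I. if m = j then y m else 0)" by (rule sum.cong) auto
      thus ?thesis using j by simp
    qed
    thus ?thesis using bound[OF _ j] unfolding P_def by simp
  qed
  have refl: "P (reflect_coords X j x)" if P: "P x" and j: "j \<in> ?I" for x j
    unfolding P_def
  proof
    fix y assume "y \<in> Y"
    then obtain y' where y': "y' \<in> Y" "\<And>m. m \<in> ?I \<Longrightarrow> y' m = y m - cartan_entry X m j * y j"
      using closed[OF _ j] by blast
    have "(\<Sum>m\<in>?I. x m * y' m) = (\<Sum>m\<in>?I. x m * y m - x m * cartan_entry X m j * y j)"
      by (rule sum.cong) (simp_all add: y'(2) algebra_simps)
    also have "\<dots> = (\<Sum>m\<in>?I. x m * y m) - colsum X j x * y j"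
      by (simp add: sum_subtractf sum_distrib_right)
    also have "\<dots> = (\<Sum>m\<in>?I. reflect_coords X j x m * y m)"
      using j by (simp add: reflect_coords_def sum.remove[of _ j] algebra_simps)
    finally have "(\<Sum>m\<in>?I. reflect_coords X j x m * y m) = (\<Sum>m\<in>?I. x m * y' m)" by (rule sym)
    thus "(\<Sum>m\<in>?I. reflect_coords X j x m * y m) \<le> 1"
      using P y'(1) unfolding P_def by simp
  qed
  have "x i \<le> 1" if P: "P x" for x
  proof -
    obtain y where y: "y \<in> Y" "\<And>m. m \<in> ?I \<Longrightarrow> y m = unit i m" using base by blast
    have "(\<Sum>m\<in>?I. x m * y m) = (\<Sum>m\<in>?I. if m = i then x m else 0)"
      by (rule sum.cong) (simp_all add: y(2))
    also have "\<dots> = x i" using i by simp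
    finally show ?thesis using P y(1) unfolding P_def by metis
  qed
  thus ?thesis using unit refl unfolding coefficient_le_1_def by (intro exI[of _ P]) simp
qed

text \<open>Reflections swap adjacent entries of a 0/1 vector. Admitting any number of ones lets one
  set serve all \<open>i\<close>.\<close>

lemma minuscule_bound_A:
  assumes "i \<in> {1..l}"
  shows "coefficient_le_1 (Type_A l) i"
proof (rule orbit_bound)
  let ?y = "\<lambda>f m. f m - f (Suc m) :: int"
  let ?O = "{?y f |f. \<forall>m. f m \<in> {0, 1}}"
  show "y j \<le> 1" if y: "y \<in> ?O" for y j
  proof -
    obtain f where f: "y = ?y f" "\<And>m. f m \<in> {0, 1}" using y by blast
    show ?thesis using f(2)[of j] f(2)[of "Suc j"] by (auto simp: f(1))
  qed
  show "\<exists>y'\<in>?O. \<forall>m\<in>{1..dynkin_rank (Type_A l)}. y' m = y m - cartan_entry (Type_A l) m j * y j"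
    if y: "y \<in> ?O" for y j
  proof -
    obtain f where f: "y = ?y f" "\<And>m. f m \<in> {0, 1}" using y by blast
    let ?f = "f(j := f (Suc j), Suc j := f j)"
    have "?y ?f \<in> ?O" using f(2) by (intro CollectI exI[of _ ?f]) auto
    moreover have "\<forall>m\<in>{1..dynkin_rank (Type_A l)}. ?y ?f m = y m - cartan_entry (Type_A l) m j * y j"
      by (auto simp: f(1))
    ultimately show ?thesis by (intro bexI[of _ "?y ?f"])
  qed
  show "\<exists>y\<in>?O. \<forall>m\<in>{1..dynkin_rank (Type_A l)}. y m = unit i m"
    by (intro bexI[of _ "?y (\<lambda>m. if m \<le> i then 1 else 0)"]) (auto intro!: exI[of _ "\<lambda>m. if m \<le> i then 1 else 0"])
qed (use assms in simp)

text \<open>The orbit consists of the vectors \<epsilon>_m and -\<epsilon>_m; \<open>?Q\<close>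
  describes these together with 0.\<close>

lemma minuscule_bound_B:
  assumes "2 \<le> l"
  shows "coefficient_le_1 (Type_B l) 1"
proof (rule orbit_bound)
  let ?y = "\<lambda>f m. if m = l then f m else f m - f (Suc m) :: int"
  let ?Q = "\<lambda>f. (\<forall>m. \<bar>f m\<bar> \<le> (1::int)) \<and> (\<forall>m n. m \<noteq> n \<longrightarrow> f m = 0 \<or> f n = 0)"
  let ?O = "{?y f |f. ?Q f}"
  show "y j \<le> 1" if y: "y \<in> ?O" for y j
  proof -
    obtain f where f: "y = ?y f" "\<And>m. \<bar>f m\<bar> \<le> 1" "\<And>m n. m \<noteq> n \<Longrightarrow> f m = 0 \<or> f n = 0" using y by blast
    show ?thesis using f(2)[of j] f(2)[of "Suc j"] f(3)[of j "Suc j"] by (auto simp: f(1))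
  qed
  show "\<exists>y'\<in>?O. \<forall>m\<in>{1..dynkin_rank (Type_B l)}. y' m = y m - cartan_entry (Type_B l) m j * y j"
    if y: "y \<in> ?O" and j: "j \<in> {1..dynkin_rank (Type_B l)}" for y j
  proof -
    obtain f where f: "y = ?y f" "?Q f" using y by blast
    let ?f = "if j = l then f(l := - f l) else f(j := f (Suc j), Suc j := f j)"
    have "?Q ?f"
    proof (cases "j = l")
      case False
      thus ?thesis using f(2) by (auto simp: fun_upd_def)
    qed (use f(2) in auto)
    hence "?y ?f \<in> ?O" by (intro CollectI exI[of _ ?f]) auto
    moreover have "\<forall>m\<in>{1..dynkin_rank (Type_B l)}. ?y ?f m = y m - cartan_entry (Type_B l) m j * y j"
      using j by (auto simp: f(1))
    ultimately show ?thesis by (intro bexI[of _ "?y ?f"])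
  qed
  show "\<exists>y\<in>?O. \<forall>m\<in>{1..dynkin_rank (Type_B l)}. y m = unit 1 m"
    using assms by (intro bexI[of _ "?y (unit 1)"]) (auto intro!: exI[of _ "unit 1"])
qed (use assms in simp)

text \<open>The orbit consists of the vectors with entries 1/2 and -1/2. After the shift the entries
  are 0 and 1, the sign change is 1 - f, and the long root 2 \<epsilon>_l takes the value 2 f(l) -
  1.\<close>

lemma minuscule_bound_C:
  assumes "2 \<le> l"
  shows "coefficient_le_1 (Type_C l) l"
proof (rule orbit_bound)
  let ?y = "\<lambda>f m. if m = l then 2 * f m - 1 else f m - f (Suc m) :: int"
  let ?O = "{?y f |f. \<forall>m. f m \<in> {0, 1}}"
  show "y j \<le> 1" if y: "y \<in> ?O" for y j
  proof -
    obtain f where f: "y = ?y f" "\<And>m. f m \<in> {0, 1}" using y by blast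
    show ?thesis using f(2)[of j] f(2)[of "Suc j"] by (auto simp: f(1))
  qed
  show "\<exists>y'\<in>?O. \<forall>m\<in>{1..dynkin_rank (Type_C l)}. y' m = y m - cartan_entry (Type_C l) m j * y j"
    if y: "y \<in> ?O" and j: "j \<in> {1..dynkin_rank (Type_C l)}" for y j
  proof -
    obtain f where f: "y = ?y f" "\<And>m. f m \<in> {0, 1}" using y by blast
    let ?f = "if j = l then f(l := 1 - f l) else f(j := f (Suc j), Suc j := f j)"
    have "?f m \<in> {0, 1}" for m using f(2)[of m] f(2)[of l] f(2)[of j] f(2)[of "Suc j"] by auto
    hence "?y ?f \<in> ?O" by (intro CollectI exI[of _ ?f]) auto
    moreover have "\<forall>m\<in>{1..dynkin_rank (Type_C l)}. ?y ?f m = y m - cartan_entry (Type_C l) m j * y j"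
      using j by (auto simp: f(1))
    ultimately show ?thesis by (intro bexI[of _ "?y ?f"])
  qed
  show "\<exists>y\<in>?O. \<forall>m\<in>{1..dynkin_rank (Type_C l)}. y m = unit l m"
    by (intro bexI[of _ "?y (\<lambda>_. 1)"]) (auto intro!: exI[of _ "\<lambda>_. 1"])
qed (use assms in simp)

lemma minuscule_bound_D_vector:
  assumes l: "3 \<le> l"
  shows "coefficient_le_1 (Type_D l) 1"
proof (rule orbit_bound)
  let ?y = "\<lambda>f m. if m = l then f (l - 1) + f l else f m - f (Suc m) :: int"
  let ?Q = "\<lambda>f. (\<forall>m. \<bar>f m\<bar> \<le> (1::int)) \<and> (\<forall>m n. m \<noteq> n \<longrightarrow> f m = 0 \<or> f n = 0)"
  let ?O = "{?y f |f. ?Q f}"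
  show "y j \<le> 1" if y: "y \<in> ?O" for y j
  proof -
    obtain f where f: "y = ?y f" "\<And>m. \<bar>f m\<bar> \<le> 1" "\<And>m n. m \<noteq> n \<Longrightarrow> f m = 0 \<or> f n = 0" using y by blast
    have "f (l - 1) = 0 \<or> f l = 0" by (rule f(3)) (use l in simp)
    thus ?thesis using f(2)[of j] f(2)[of "Suc j"] f(3)[of j "Suc j"] f(2)[of l] f(2)[of "l - 1"]
      by (auto simp: f(1))
  qed
  show "\<exists>y'\<in>?O. \<forall>m\<in>{1..dynkin_rank (Type_D l)}. y' m = y m - cartan_entry (Type_D l) m j * y j"
    if y: "y \<in> ?O" and j: "j \<in> {1..dynkin_rank (Type_D l)}" for y j
  proof -
    obtain f where f: "y = ?y f" "?Q f" using y by blast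
    \<comment> \<open>The reflection in \<epsilon>_(l-1) + \<epsilon>_l swaps the last two
      coordinates and negates both; the sign c treats it together with the plain swaps.\<close>
    let ?f = "if j = l then f(l - 1 := - f l, l := - f (l - 1)) else f(j := f (Suc j), Suc j := f j)"
    have "?Q (f(a := c * f b, b := c * f a))" if "\<bar>c\<bar> = 1" for a b and c :: int
      using f(2) that by (auto simp: abs_mult)
    from this[of 1 j "Suc j"] this[of "- 1" "l - 1" l] have "?Q ?f" by (cases "j = l") simp_all
    hence "?y ?f \<in> ?O" by (intro CollectI exI[of _ ?f]) auto
    moreover have "?y ?f m = y m - cartan_entry (Type_D l) m j * y j" if m: "m \<in> {1..dynkin_rank (Type_D l)}" for m
    proof -
      consider "j = l" | "j + 1 = l" | "j + 2 = l" | "j + 2 < l" using j by fastforce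
      thus ?thesis
      proof cases
        case 1
        thus ?thesis using m l cartan_entry_D[OF l, of m j] by (auto simp: f(1) simp del: cartan_entry.simps)
      next
        case 2
        thus ?thesis using m j l cartan_entry_D[OF l, of m j] by (auto simp: f(1) simp del: cartan_entry.simps)
      next
        case 3
        thus ?thesis using m j l cartan_entry_D[OF l, of m j] by (auto simp: f(1) simp del: cartan_entry.simps)
      next
        case 4
        thus ?thesis using m j l cartan_entry_D[OF l, of m j] by (auto simp: f(1) simp del: cartan_entry.simps)
      qed
    qed
    hence "\<forall>m\<in>{1..dynkin_rank (Type_D l)}. ?y ?f m = y m - cartan_entry (Type_D l) m j * y j"
      by blast
    ultimately show ?thesis by (intro bexI[of _ "?y ?f"])
  qed
  show "\<exists>y\<in>?O. \<forall>m\<in>{1..dynkin_rank (Type_D l)}. y m = unit 1 m"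
    using l by (intro bexI[of _ "?y (unit 1)"]) (auto intro!: exI[of _ "unit 1"])
qed (use assms in simp)

text \<open>Admitting either parity of the number of negative entries merges the two half-spin
  orbits, so one set serves both nodes.\<close>

lemma minuscule_bound_D_spin:
  assumes l: "3 \<le> l" and i: "i \<in> {l - 1, l}"
  shows "coefficient_le_1 (Type_D l) i"
proof (rule orbit_bound)
  let ?y = "\<lambda>f m. if m = l then f (l - 1) + f l - 1 else f m - f (Suc m) :: int"
  let ?O = "{?y f |f. \<forall>m. f m \<in> {0, 1}}"
  show "y j \<le> 1" if y: "y \<in> ?O" for y j
  proof -
    obtain f where f: "y = ?y f" "\<And>m. f m \<in> {0, 1}" using y by blast
    show ?thesis using f(2)[of j] f(2)[of "Suc j"] f(2)[of l] f(2)[of "l - 1"] by (auto simp: f(1))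
  qed
  show "\<exists>y'\<in>?O. \<forall>m\<in>{1..dynkin_rank (Type_D l)}. y' m = y m - cartan_entry (Type_D l) m j * y j"
    if y: "y \<in> ?O" and j: "j \<in> {1..dynkin_rank (Type_D l)}" for y j
  proof -
    obtain f where f: "y = ?y f" "\<And>m. f m \<in> {0, 1}" using y by blast
    let ?f = "if j = l then f(l - 1 := 1 - f l, l := 1 - f (l - 1)) else f(j := f (Suc j), Suc j := f j)"
    have "f(a := g (f b), b := g (f a)) \<in> {f. \<forall>m. f m \<in> {0, 1}}" if "g = id \<or> g = (\<lambda>n. 1 - n)" for a b g
    proof -
      have "f m = 0 \<or> f m = 1" for m using f(2)[of m] by simp
      moreover have "g 0 \<in> {0, 1}" "g 1 \<in> {0, 1}" using that by auto
      ultimately have "g (f m) \<in> {0, 1}" for m by (metis (no_types))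
      thus ?thesis using f(2) by simp
    qed
    from this[of id j "Suc j"] this[of "\<lambda>n. 1 - n" "l - 1" l]
    have "?f \<in> {f. \<forall>m. f m \<in> {0, 1}}" by (cases "j = l") simp_all
    hence "?y ?f \<in> ?O" by (intro CollectI exI[of _ ?f]) simp
    moreover have "?y ?f m = y m - cartan_entry (Type_D l) m j * y j" if m: "m \<in> {1..dynkin_rank (Type_D l)}" for m
    proof -
      consider "j = l" | "j + 1 = l" | "j + 2 = l" | "j + 2 < l" using j by fastforce
      thus ?thesis
      proof cases
        case 1
        thus ?thesis using m l cartan_entry_D[OF l, of m j] by (auto simp: f(1) simp del: cartan_entry.simps)
      next
        case 2
        thus ?thesis using m j l cartan_entry_D[OF l, of m j] by (auto simp: f(1) simp del: cartan_entry.simps)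
      next
        case 3
        thus ?thesis using m j l cartan_entry_D[OF l, of m j] by (auto simp: f(1) simp del: cartan_entry.simps)
      next
        case 4
        thus ?thesis using m j l cartan_entry_D[OF l, of m j] by (auto simp: f(1) simp del: cartan_entry.simps)
      qed
    qed
    hence "\<forall>m\<in>{1..dynkin_rank (Type_D l)}. ?y ?f m = y m - cartan_entry (Type_D l) m j * y j"
      by blast
    ultimately show ?thesis by (intro bexI[of _ "?y ?f"])
  qed
  let ?f = "\<lambda>m. if m = l \<and> i = l - 1 then 0 else 1"
  show "\<exists>y\<in>?O. \<forall>m\<in>{1..dynkin_rank (Type_D l)}. y m = unit i m"
  proof (rule bexI[of _ "?y ?f"])
    show "?y ?f \<in> ?O" by (intro CollectI exI[of _ ?f]) simp
  qed (use l i in auto)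
qed (use assms in auto)

section \<open>The exceptional types\<close>

lemma numeral_nodes:
  "{1..6::nat} = {1, 2, 3, 4, 5, 6}" "{1..7::nat} = {1, 2, 3, 4, 5, 6, 7}"
  by auto

lemma reflect_coords_E6:
  "reflect_coords Type_E6 1 x = x(1 := x 3 - x 1)" "reflect_coords Type_E6 2 x = x(2 := x 4 - x 2)"
  "reflect_coords Type_E6 3 x = x(3 := x 1 + x 4 - x 3)" "reflect_coords Type_E6 4 x = x(4 := x 2 + x 3 + x 5 - x 4)"
  "reflect_coords Type_E6 5 x = x(5 := x 4 + x 6 - x 5)" "reflect_coords Type_E6 6 x = x(6 := x 5 - x 6)"
  unfolding reflect_coords_def dynkin_rank.simps numeral_nodes by (simp_all add: doubleton_eq_iff algebra_simps)

lemma reflect_coords_E7: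
  "reflect_coords Type_E7 1 x = x(1 := x 3 - x 1)" "reflect_coords Type_E7 2 x = x(2 := x 4 - x 2)"
  "reflect_coords Type_E7 3 x = x(3 := x 1 + x 4 - x 3)" "reflect_coords Type_E7 4 x = x(4 := x 2 + x 3 + x 5 - x 4)"
  "reflect_coords Type_E7 5 x = x(5 := x 4 + x 6 - x 5)" "reflect_coords Type_E7 6 x = x(6 := x 5 + x 7 - x 6)"
  "reflect_coords Type_E7 7 x = x(7 := x 6 - x 7)"
  unfolding reflect_coords_def dynkin_rank.simps numeral_nodes by (simp_all add: doubleton_eq_iff algebra_simps)

lemma square_le_3: "n * n \<le> 3 \<Longrightarrow> n \<le> (1::int)"
  by (rule ccontr) (use mult_mono[of 2 n 2 n] in auto)

text \<open>In type \<open>E\<close> all roots have the same length, and completing squares in the quadratic form \<open>Q\<close> along the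
  Dynkin diagram towards node \<open>i\<close> bounds the coefficient there.\<close>

lemma minuscule_bound_E6:
  assumes "i \<in> {1, 6}"
  shows "coefficient_le_1 Type_E6 i"
proof -
  define Q :: "(nat \<Rightarrow> int) \<Rightarrow> int" where
    "Q x = x 1 * x 1 + x 2 * x 2 + x 3 * x 3 + x 4 * x 4 + x 5 * x 5 + x 6 * x 6
      - x 1 * x 3 - x 3 * x 4 - x 4 * x 5 - x 5 * x 6 - x 2 * x 4" for x
  have unit: "Q (unit j) = 1" if "j \<in> {1..6}" for j
    using that unfolding numeral_nodes by (auto simp: Q_def)
  have refl: "Q (reflect_coords Type_E6 j x) = Q x" if "j \<in> {1..6}" for j x
    using that unfolding numeral_nodes
    by (elim insertE emptyE; hypsubst; unfold reflect_coords_E6 Q_def; simp add: algebra_simps)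
  \<comment> \<open>\<open>Q\<close> is half the squared length, 1 on every root, and 120 clears
    denominators. The residue 45/120 = 3/8 gives x_1^2 <= 8/3; the second identity is the mirror
    image.\<close>
  have "120 * Q x = 30 * (2 * x 6 - x 5)\<^sup>2 + 10 * (3 * x 5 - 2 * x 4)\<^sup>2 + 30 * (2 * x 2 - x 4)\<^sup>2
      + 2 * (5 * x 4 - 6 * x 3)\<^sup>2 + 3 * (4 * x 3 - 5 * x 1)\<^sup>2 + 45 * (x 1 * x 1)" for x
    by (simp add: Q_def power2_eq_square algebra_simps)
  hence 1: "45 * (x 1 * x 1) \<le> 120 * Q x" for x by simp
  have "120 * Q x = 30 * (2 * x 1 - x 3)\<^sup>2 + 10 * (3 * x 3 - 2 * x 4)\<^sup>2 + 30 * (2 * x 2 - x 4)\<^sup>2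
      + 2 * (5 * x 4 - 6 * x 5)\<^sup>2 + 3 * (4 * x 5 - 5 * x 6)\<^sup>2 + 45 * (x 6 * x 6)" for x
    by (simp add: Q_def power2_eq_square algebra_simps)
  hence 6: "45 * (x 6 * x 6) \<le> 120 * Q x" for x by simp
  have "x i \<le> 1" if "Q x = 1" for x
    by (rule square_le_3) (use assms that 1[of x] 6[of x] in auto)
  thus ?thesis using unit refl
    unfolding coefficient_le_1_def by (intro exI[of _ "\<lambda>x. Q x = 1"]) simp
qed

lemma minuscule_bound_E7:
  "coefficient_le_1 Type_E7 7"
proof -
  define Q :: "(nat \<Rightarrow> int) \<Rightarrow> int" where
    "Q x = x 1 * x 1 + x 2 * x 2 + x 3 * x 3 + x 4 * x 4 + x 5 * x 5 + x 6 * x 6 + x 7 * x 7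
      - x 1 * x 3 - x 3 * x 4 - x 4 * x 5 - x 5 * x 6 - x 6 * x 7 - x 2 * x 4" for x
  have unit: "Q (unit j) = 1" if "j \<in> {1..7}" for j
    using that unfolding numeral_nodes by (auto simp: Q_def)
  have refl: "Q (reflect_coords Type_E7 j x) = Q x" if "j \<in> {1..7}" for j x
    using that unfolding numeral_nodes
    by (elim insertE emptyE; hypsubst; unfold reflect_coords_E7 Q_def; simp add: algebra_simps)
  \<comment> \<open>Here the residue is 40/120 = 1/3, so x_7^2 <= 3.\<close>
  have "120 * Q x = 30 * (2 * x 1 - x 3)\<^sup>2 + 10 * (3 * x 3 - 2 * x 4)\<^sup>2 + 30 * (2 * x 2 - x 4)\<^sup>2
      + 2 * (5 * x 4 - 6 * x 5)\<^sup>2 + 3 * (4 * x 5 - 5 * x 6)\<^sup>2 + 5 * (3 * x 6 - 4 * x 7)\<^sup>2 + 40 * (x 7 * x 7)" for x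
    by (simp add: Q_def power2_eq_square algebra_simps)
  hence 7: "40 * (x 7 * x 7) \<le> 120 * Q x" for x by simp
  have "x 7 \<le> 1" if "Q x = 1" for x
    by (rule square_le_3) (use that 7[of x] in auto)
  thus ?thesis using unit refl
    unfolding coefficient_le_1_def by (intro exI[of _ "\<lambda>x. Q x = 1"]) simp
qed

lemma minuscule_bound:
  assumes "valid_dynkin X" "i \<in> minuscule_nodes X"
  shows "coefficient_le_1 X i"
  using assms minuscule_bound_A minuscule_bound_B minuscule_bound_C minuscule_bound_D_vector
    minuscule_bound_D_spin minuscule_bound_E6 minuscule_bound_E7
  by (cases X) auto


section \<open>The words of simple reflections\<close>

text \<open>The zero values at the positions 0 and l + 1 make the formula uniform at the ends of the
  diagram.\<close>

lemma reflect_coords_A: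
  "1 \<le> j \<Longrightarrow> j \<le> l \<Longrightarrow> x 0 = 0 \<Longrightarrow> x (Suc l) = 0 \<Longrightarrow>
    reflect_coords (Type_A l) j x = x(j := x (j - 1) + x (Suc j) - x j)"
  unfolding reflect_coords_def by (subst colsum_A) (auto simp: le_Suc_eq not_less)

lemma reflect_coords_B:
  "1 \<le> j \<Longrightarrow> j < l \<Longrightarrow> x 0 = 0 \<Longrightarrow> reflect_coords (Type_B l) j x = x(j := x (j - 1) + x (Suc j) - x j)"
  "2 \<le> l \<Longrightarrow> reflect_coords (Type_B l) l x = x(l := 2 * x (l - 1) - x l)"
  unfolding reflect_coords_def by (subst colsum_B; auto simp: le_Suc_eq not_less)+

lemma reflect_coords_C:
  "1 \<le> j \<Longrightarrow> Suc j < l \<Longrightarrow> x 0 = 0 \<Longrightarrow> reflect_coords (Type_C l) j x = x(j := x (j - 1) + x (Suc j) - x j)"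
  "2 \<le> l \<Longrightarrow> x 0 = 0 \<Longrightarrow> reflect_coords (Type_C l) (l - 1) x = x(l - 1 := x (l - 1 - 1) + 2 * x l - x (l - 1))"
  "2 \<le> l \<Longrightarrow> reflect_coords (Type_C l) l x = x(l := x (l - 1) - x l)"
  unfolding reflect_coords_def by (subst colsum_C; auto simp: le_Suc_eq not_less)+

lemma reflect_coords_D:
  assumes l: "3 \<le> l"
  shows "1 \<le> j \<Longrightarrow> j + 2 < l \<Longrightarrow> x 0 = 0 \<Longrightarrow> reflect_coords (Type_D l) j x = x(j := x (j - 1) + x (Suc j) - x j)"
  and "x 0 = 0 \<Longrightarrow> reflect_coords (Type_D l) (l - 2) x = x(l - 2 := x (l - 2 - 1) + (x (l - 1) + x l) - x (l - 2))"
  and "reflect_coords (Type_D l) (l - 1) x = x(l - 1 := x (l - 2) - x (l - 1))"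
  and "reflect_coords (Type_D l) l x = x(l := x (l - 2) - x l)"
proof -
  have 1: "l - 1 - 1 = l - 2" by simp
  have 2: "l - 2 + 1 = l - 1" using l by simp
  show "1 \<le> j \<Longrightarrow> j + 2 < l \<Longrightarrow> x 0 = 0 \<Longrightarrow> reflect_coords (Type_D l) j x = x(j := x (j - 1) + x (Suc j) - x j)"
    unfolding reflect_coords_def by (subst colsum_D[OF l]) (auto simp: le_Suc_eq not_less)
  show "x 0 = 0 \<Longrightarrow> reflect_coords (Type_D l) (l - 2) x = x(l - 2 := x (l - 2 - 1) + (x (l - 1) + x l) - x (l - 2))"
    unfolding reflect_coords_def by (subst colsum_D[OF l]) (use l 2 in \<open>auto simp: le_Suc_eq not_less\<close>)
  show "reflect_coords (Type_D l) (l - 1) x = x(l - 1 := x (l - 2) - x (l - 1))"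
    unfolding reflect_coords_def by (subst colsum_D[OF l]) (use l 1 in auto)
  show "reflect_coords (Type_D l) l x = x(l := x (l - 2) - x l)"
    unfolding reflect_coords_def by (subst colsum_D[OF l]) (use l in auto)
qed

text \<open>On simple-root coordinates an ascending or descending run of reflections is a cyclic shift of
  the \<open>\<epsilon>\<close>-coordinates \<open>x m - x (m - 1)\<close>.\<close>

lemma fold_reflect_ascending:
  assumes adj: "\<And>j x. 1 \<le> j \<Longrightarrow> j \<le> t \<Longrightarrow> x 0 = 0 \<Longrightarrow> x (Suc r) = 0 \<Longrightarrow>
      reflect_coords X j x = x(j := x (j - 1) + x (Suc j) - x j)"
    and x: "x 0 = 0" "x (Suc r) = 0" and t: "t \<le> r"
  shows "fold (reflect_coords X) [1..<Suc t] x = (\<lambda>m. if 1 \<le> m \<and> m \<le> t then x (Suc m) - x 1 else x m)"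
  using adj t
proof (induction t)
  case (Suc t)
  let ?y = "\<lambda>m. if 1 \<le> m \<and> m \<le> t then x (Suc m) - x 1 else x m"
  have "fold (reflect_coords X) [1..<Suc (Suc t)] x = reflect_coords X (Suc t) ?y"
    using Suc by simp
  also have "\<dots> = ?y(Suc t := ?y t + ?y (Suc (Suc t)) - ?y (Suc t))"
    using Suc.prems x by (subst Suc.prems(1)) auto
  also have "\<dots> = (\<lambda>m. if 1 \<le> m \<and> m \<le> Suc t then x (Suc m) - x 1 else x m)"
    using x by (cases "t = 0") (auto simp: fun_eq_iff le_Suc_eq)
  finally show ?case .
qed (auto simp: fun_eq_iff)

text \<open>The term \<open>e\<close> stands for the neighbours of the top node \<open>b\<close>
  outside the run: a multiple bond in types B and C, a fork in type D.\<close>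

lemma fold_reflect_descending:
  assumes adj: "\<And>j x. 1 \<le> j \<Longrightarrow> j < b \<Longrightarrow> x 0 = 0 \<Longrightarrow>
      reflect_coords X j x = x(j := x (j - 1) + x (Suc j) - x j)"
    and top: "1 \<le> b \<Longrightarrow> reflect_coords X b x = x(b := x (b - 1) + e - x b)"
    and x: "x 0 = 0" and a: "1 \<le> a" "a \<le> Suc b"
  shows "fold (reflect_coords X) (rev [a..<Suc b]) x = (\<lambda>m. if a \<le> m \<and> m \<le> b then x (m - 1) + e - x b else x m)"
  using a(2,1)
proof (induction a rule: inc_induct)
  case base
  show ?case by (auto simp: fun_eq_iff)
next
  case (step a)
  let ?y = "\<lambda>m. if Suc a \<le> m \<and> m \<le> b then x (m - 1) + e - x b else x m"
  have "fold (reflect_coords X) (rev [a..<Suc b]) x = reflect_coords X a (fold (reflect_coords X) (rev [Suc a..<Suc b]) x)"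
    using step.hyps by (simp add: upt_conv_Cons del: upt_Suc)
  also have "fold (reflect_coords X) (rev [Suc a..<Suc b]) x = ?y" using step.IH by simp
  also have "reflect_coords X a ?y = (\<lambda>m. if a \<le> m \<and> m \<le> b then x (m - 1) + e - x b else x m)"
  proof (cases "a = b")
    case True
    have "?y = x" using True by (auto simp: fun_eq_iff)
    thus ?thesis using top True step.prems by (auto simp: fun_eq_iff)
  next
    case False
    hence "a < b" using step.hyps by simp
    hence "reflect_coords X a ?y = ?y(a := ?y (a - 1) + ?y (Suc a) - ?y a)"
      using adj[of a ?y] step.prems x by simp
    thus ?thesis using \<open>a < b\<close> step.prems by (auto simp: fun_eq_iff)
  qed
  finally show ?case .
qed

text \<open>\<open>fold\<close> applies the first letter first and so computes w^-1. The fact behind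
  the definition is that w^-1 sends \<alpha>_i to -\<theta> and the other simple roots to the simple
  roots except \<alpha>_i'; only the signs are kept.\<close>

definition permutes_simple_roots :: "dynkin \<Rightarrow> nat \<Rightarrow> nat list \<Rightarrow> bool" where
  "permutes_simple_roots X i l \<longleftrightarrow> (\<exists>i'\<in>{1..dynkin_rank X}. fold (reflect_coords X) l (unit i) i' < 0 \<and>
    (\<forall>j\<in>{1..dynkin_rank X} - {i}. fold (reflect_coords X) l (unit j) i' = 0 \<and>
      (\<exists>m\<in>{1..dynkin_rank X}. 0 < fold (reflect_coords X) l (unit j) m)))"

text \<open>One pass through the nodes is a Coxeter element. It rotates the cycle \<alpha>_l, ...,
  \<alpha>_1, -\<theta> of the extended diagram, \<open>neg\<close> being -\<theta>; after
  \<open>i\<close> passes -\<theta> has become \<alpha>_(l+1-i), the node i'.\<close>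

lemma sigma_word_A:
  assumes i: "i \<in> {1..l}"
  shows "permutes_simple_roots (Type_A l) i (sigma_word (Type_A l) i)"
proof -
  define C where "C = fold (reflect_coords (Type_A l)) [1..<l + 1]"
  have C: "C x = (\<lambda>m. if 1 \<le> m \<and> m \<le> l then x (Suc m) - x 1 else x m)" if "x 0 = 0" "x (Suc l) = 0" for x
    unfolding C_def Suc_eq_plus1[symmetric]
    by (rule fold_reflect_ascending[where r = l]) (use that reflect_coords_A in auto)
  define neg where "neg = (\<lambda>m. if 1 \<le> m \<and> m \<le> l then - 1 else 0 :: int)"
  have unit: "C (unit j) = unit (j - 1)" if "2 \<le> j" "j \<le> l" for j
    using that by (subst C) (auto simp: fun_eq_iff)
  have unit1: "C (unit 1) = neg"
    using i by (subst C) (auto simp: fun_eq_iff neg_def)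
  have negC: "C neg = unit l"
    using i by (subst C) (auto simp: fun_eq_iff neg_def)
  have pow: "(C ^^ n) (unit j) = (if n < j then unit (j - n) else if n = j then neg else unit (l + 1 + j - n))"
    if j: "1 \<le> j" "j \<le> l" and n: "n \<le> l" for n j
    using n
  proof (induction n)
    case (Suc n)
    have step: "(C ^^ Suc n) (unit j)
        = C (if n < j then unit (j - n) else if n = j then neg else unit (l + 1 + j - n))"
      using Suc by simp
    consider "Suc n < j" | "j - n = 1" "n < j" | "n = j" | "j < n" by linarith
    thus ?case
    proof cases
      case 1
      thus ?thesis unfolding step using j unit[of "j - n"] by simp
    next
      case 2
      hence "\<not> Suc n < j" "Suc n = j" by simp_all
      thus ?thesis unfolding step 2(1) using 2(2) unit1 by simp
    next
      case 3
      thus ?thesis unfolding step using j negC by simp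
    next
      case 4
      thus ?thesis unfolding step using j Suc.prems unit[of "l + 1 + j - n"] by simp
    qed
  qed (use j in simp)
  have word: "fold (reflect_coords (Type_A l)) (sigma_word (Type_A l) i) = C ^^ i"
  proof -
    have "fold (reflect_coords (Type_A l)) (concat (replicate n [1..<l + 1])) = C ^^ n" for n
      by (induction n) (simp_all add: C_def funpow_Suc_right del: upt_Suc funpow.simps)
    thus ?thesis by simp
  qed
  show ?thesis
    unfolding permutes_simple_roots_def word
  proof (rule bexI[of _ "l + 1 - i"], intro conjI ballI)
    show "(C ^^ i) (unit i) (l + 1 - i) < 0" using i by (auto simp: pow neg_def)
    fix j assume j: "j \<in> {1..dynkin_rank (Type_A l)} - {i}"
    thus "(C ^^ i) (unit j) (l + 1 - i) = 0" using i by (auto simp: pow)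
    show "\<exists>m\<in>{1..dynkin_rank (Type_A l)}. 0 < (C ^^ i) (unit j) m"
      using i j by (intro bexI[of _ "if i < j then j - i else l + 1 + j - i"]) (auto simp: pow)
  qed (use i in auto)
qed

text \<open>The palindromic word is the reflection in \<epsilon>_1 = \<alpha>_1 + ... + \<alpha>_l,
  which fixes all simple roots except \<alpha>_1.\<close>

lemma sigma_word_B:
  assumes l: "2 \<le> l"
  shows "permutes_simple_roots (Type_B l) 1 (sigma_word (Type_B l) 1)"
proof -
  let ?R = "reflect_coords (Type_B l)"
  obtain n where n: "l = Suc n" "1 \<le> n" using l by (cases l) auto
  have word: "fold ?R (sigma_word (Type_B l) 1) x
      = (\<lambda>m. if m = 1 then - x 1 else if 2 \<le> m \<and> m \<le> l then x m - 2 * x 1 else x m)"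
    if x: "x 0 = 0" "x (Suc l) = 0" for x
  proof -
    let ?y = "\<lambda>m. if 1 \<le> m \<and> m \<le> n then x (Suc m) - x 1 else x m"
    let ?z = "?y(l := x l - 2 * x 1)"
    have "fold ?R [1..<Suc n] x = ?y"
      by (rule fold_reflect_ascending[where r = l]) (use x n reflect_coords_B in auto)
    moreover have "?R l ?y = ?z"
      using n l by (subst reflect_coords_B(2)) (auto simp: fun_eq_iff)
    moreover have "fold ?R (rev [1..<Suc n]) ?z
        = (\<lambda>m. if 1 \<le> m \<and> m \<le> n then ?z (m - 1) + ?z l - ?z n else ?z m)"
    proof (rule fold_reflect_descending)
      show "?R n ?z = ?z(n := ?z (n - 1) + ?z l - ?z n)"
        using n x by (subst reflect_coords_B(1)) auto
    qed (use n x reflect_coords_B in auto)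
    moreover have "fold ?R (sigma_word (Type_B l) 1) x
        = fold ?R (rev [1..<Suc n]) (?R l (fold ?R [1..<Suc n] x))"
      by (simp add: n del: upt_Suc)
    ultimately have "fold ?R (sigma_word (Type_B l) 1) x
        = (\<lambda>m. if 1 \<le> m \<and> m \<le> n then ?z (m - 1) + ?z l - ?z n else ?z m)" by metis
    also have "\<dots> = (\<lambda>m. if m = 1 then - x 1 else if 2 \<le> m \<and> m \<le> l then x m - 2 * x 1 else x m)"
      using n x by (auto simp: fun_eq_iff le_Suc_eq)
    finally show ?thesis .
  qed
  show ?thesis
    unfolding permutes_simple_roots_def
  proof (rule bexI[of _ 1], intro conjI ballI)
    show "fold ?R (sigma_word (Type_B l) 1) (unit 1) 1 < 0" by (subst word) (use l in auto)
    fix j assume j: "j \<in> {1..dynkin_rank (Type_B l)} - {1}"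
    show "fold ?R (sigma_word (Type_B l) 1) (unit j) 1 = 0" by (subst word) (use l j in auto)
    show "\<exists>m\<in>{1..dynkin_rank (Type_B l)}. 0 < fold ?R (sigma_word (Type_B l) 1) (unit j) m"
      by (rule bexI[of _ j]; (subst word)?) (use l j in auto)
  qed (use l in auto)
qed

lemma sigma_word_C:
  assumes l: "2 \<le> l"
  shows "permutes_simple_roots (Type_C l) l (sigma_word (Type_C l) l)"
proof -
  let ?R = "reflect_coords (Type_C l)"
  define B where "B m = fold ?R (rev [m..<l + 1])" for m
  obtain n where n: "l = Suc n" "1 \<le> n" using l by (cases l) auto
  have B: "B m y = (\<lambda>p. if m \<le> p \<and> p \<le> n then y (p - 1) + y n - 2 * y l
      else if p = l then y n - y l else y p)"
    if y: "y 0 = 0" and m: "1 \<le> m" "m \<le> l" for m y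
  proof -
    let ?z = "y(l := y n - y l)"
    have "B m y = fold ?R (rev [m..<Suc n]) (?R l y)"
      using m n by (simp add: B_def)
    also have "?R l y = ?z" using n l by (subst reflect_coords_C(3)) auto
    also have "fold ?R (rev [m..<Suc n]) ?z
        = (\<lambda>p. if m \<le> p \<and> p \<le> n then ?z (p - 1) + 2 * ?z l - ?z n else ?z p)"
    proof (rule fold_reflect_descending)
      show "?R n ?z = ?z(n := ?z (n - 1) + 2 * ?z l - ?z n)"
        using reflect_coords_C(2)[of l ?z] l n y by simp
    qed (use n m y reflect_coords_C in auto)
    also have "\<dots> = (\<lambda>p. if m \<le> p \<and> p \<le> n then y (p - 1) + y n - 2 * y l
      else if p = l then y n - y l else y p)"
      using n m by (auto simp: fun_eq_iff)
    finally show ?thesis .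
  qed
  text \<open>\<open>Z x p\<close> is the sum of the first \<open>p\<close> of the \<open>\<epsilon>\<close>-coordinates of \<open>x\<close>. The first \<open>t\<close> blocks move
    \<open>\<epsilon>\<^sub>a\<close> to \<open>\<epsilon>\<^sub>a\<^sub>+\<^sub>t\<close> if \<open>a + t \<le> l\<close>, and to \<open>- \<epsilon>\<^sub>l\<^sub>+\<^sub>1\<^sub>-\<^sub>a\<close> otherwise.\<close>
  define Z where "Z x p = (if p = l then 2 * x l else x p)" for x :: "nat \<Rightarrow> int" and p
  define S where "S t x p = (if p = 0 \<or> l < p then 0 else if p = l then Z x (l - t) - x l
      else if p \<le> t then Z x (l - p) - 2 * x l else Z x (p - t) + Z x (l - t) - 2 * x l)"
    for t and x :: "nat \<Rightarrow> int" and p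
  have blocks: "fold ?R (concat (map (\<lambda>m. rev [m..<l + 1]) [1..<t + 1])) x = S t x"
    if x: "x 0 = 0" "\<And>p. l < p \<Longrightarrow> x p = 0" and t: "t \<le> l" for t x
    using t
  proof (induction t)
    case 0
    show ?case using x by (auto simp: fun_eq_iff S_def Z_def)
  next
    case (Suc t)
    have "fold ?R (concat (map (\<lambda>m. rev [m..<l + 1]) [1..<Suc t + 1])) x = B (Suc t) (S t x)"
      using Suc by (simp add: B_def)
    also have "\<dots> = (\<lambda>p. if Suc t \<le> p \<and> p \<le> n then S t x (p - 1) + S t x n - 2 * S t x l
      else if p = l then S t x n - S t x l else S t x p)"
      by (rule B) (use Suc.prems in \<open>auto simp: S_def\<close>)
    also have "\<dots> = S (Suc t) x"
    proof
      fix p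
      have n_val: "S t x n = Z x (n - t) + Z x (l - t) - 2 * x l"
        using n Suc.prems x(1) by (cases "t = n") (auto simp: S_def Z_def)
      have l_val: "S t x l = Z x (l - t) - x l" using n by (simp add: S_def)
      have lt: "l - Suc t = n - t" using n by simp
      consider "p = 0 \<or> l < p" | "p = l" | "1 \<le> p" "p \<le> t" "p \<le> n" | "p = Suc t" "p \<le> n"
        | "Suc t < p" "p \<le> n" using n by linarith
      thus "(if Suc t \<le> p \<and> p \<le> n then S t x (p - 1) + S t x n - 2 * S t x l
        else if p = l then S t x n - S t x l else S t x p) = S (Suc t) x p"
      proof cases
        case 1
        thus ?thesis using n by (auto simp: S_def)
      next
        case 2
        thus ?thesis unfolding n_val l_val using n lt by (simp add: S_def)
      next
        case 3
        thus ?thesis using n by (simp add: S_def)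
      next
        case 4
        thus ?thesis unfolding n_val l_val using n lt
          by (cases "t = 0") (simp_all add: S_def Z_def)
      next
        case 5
        then obtain p' where "p = Suc p'" by (cases p) auto
        with 5 show ?thesis unfolding n_val l_val using n lt by (simp add: S_def)
      qed
    qed
    finally show ?case .
  qed
  have word: "fold ?R (sigma_word (Type_C l) l) x = S l x" if "x 0 = 0" "\<And>p. l < p \<Longrightarrow> x p = 0" for x
    using blocks[of x l] that by simp
  \<comment> \<open>For j < l the word sends \<alpha>_j to \<alpha>_(l-j), so \<alpha>_l is the
    simple root that is missed.\<close>
  show ?thesis
    unfolding permutes_simple_roots_def
  proof (rule bexI[of _ l], intro conjI ballI)
    show "fold ?R (sigma_word (Type_C l) l) (unit l) l < 0" by (subst word) (use l in \<open>auto simp: S_def Z_def\<close>)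
    fix j assume j: "j \<in> {1..dynkin_rank (Type_C l)} - {l}"
    show "fold ?R (sigma_word (Type_C l) l) (unit j) l = 0"
      by (subst word) (use l j in \<open>auto simp: S_def Z_def\<close>)
    show "\<exists>m\<in>{1..dynkin_rank (Type_C l)}. 0 < fold ?R (sigma_word (Type_C l) l) (unit j) m"
      by (rule bexI[of _ "l - j"]; (subst word)?) (use l j in \<open>auto simp: S_def Z_def\<close>)
  qed (use l in auto)
qed

text \<open>The element changes the signs of \<epsilon>_1 and \<epsilon>_l, so beyond \<alpha>_1 it
  only exchanges \<alpha>_(l-1) and \<alpha>_l.\<close>

lemma sigma_word_D_vector:
  assumes l: "3 \<le> l"
  shows "permutes_simple_roots (Type_D l) 1 (sigma_word (Type_D l) 1)"
proof -
  let ?R = "reflect_coords (Type_D l)"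
  obtain n where n: "l = Suc (Suc (Suc n))" by (rule that[of "l - 3"]) (use l in simp)
  have word: "fold ?R (sigma_word (Type_D l) 1) x
      = (\<lambda>m. if m = 1 then - x 1 else if 2 \<le> m \<and> m \<le> Suc n then x m - 2 * x 1
          else if m = Suc (Suc n) then x l - x 1 else if m = l then x (Suc (Suc n)) - x 1 else x m)"
    if x: "x 0 = 0" "x (Suc l) = 0" for x
  proof -
    have R: "?R (Suc n) y = y(Suc n := y n + (y (Suc (Suc n)) + y l) - y (Suc n))"
      "?R (Suc (Suc n)) y = y(Suc (Suc n) := y (Suc n) - y (Suc (Suc n)))"
      "?R l y = y(l := y (Suc n) - y l)" if "y 0 = 0" for y
      using reflect_coords_D(2-4)[OF l, of y] that n by simp_all
    \<comment> \<open>\<open>y\<close> is the result of the ascending run below the fork,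
      \<open>z\<close> that of the three reflections at l - 2, l - 1 and l.\<close>
    define y where "y m = (if 1 \<le> m \<and> m \<le> n then x (Suc m) - x 1 else x m)" for m
    define z where "z = y(Suc n := x (Suc (Suc n)) + x l - x 1, Suc (Suc n) := x l - x 1,
      l := x (Suc (Suc n)) - x 1)"
    have y: "y 0 = 0" "y n + (y (Suc (Suc n)) + y l) - y (Suc n) = x (Suc (Suc n)) + x l - x 1"
      "y (Suc (Suc n)) = x (Suc (Suc n))" "y l = x l"
      using x n by (cases n; simp add: y_def)+
    have z: "z 0 = 0" "z (Suc n) = x (Suc (Suc n)) + x l - x 1" "z (Suc (Suc n)) = x l - x 1"
      "z l = x (Suc (Suc n)) - x 1"
      using y n by (auto simp: z_def)
    have "fold ?R [1..<Suc n] x = y"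
      unfolding y_def by (rule fold_reflect_ascending[where r = l]) (use x n reflect_coords_D(1)[OF l] in auto)
    moreover have "?R (Suc n) y = y(Suc n := x (Suc (Suc n)) + x l - x 1)"
      using R(1)[of y, OF y(1)] y(2) by simp
    moreover have "?R (Suc (Suc n)) (y(Suc n := x (Suc (Suc n)) + x l - x 1))
        = y(Suc n := x (Suc (Suc n)) + x l - x 1, Suc (Suc n) := x l - x 1)"
      using R(2)[of "y(Suc n := x (Suc (Suc n)) + x l - x 1)"] y by simp
    moreover have "?R l (y(Suc n := x (Suc (Suc n)) + x l - x 1, Suc (Suc n) := x l - x 1)) = z"
      using R(3)[of "y(Suc n := x (Suc (Suc n)) + x l - x 1, Suc (Suc n) := x l - x 1)"] y n
      by (simp add: z_def)
    moreover have "fold ?R (rev [1..<Suc (Suc n)]) z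
        = (\<lambda>m. if 1 \<le> m \<and> m \<le> Suc n then z (m - 1) + (z (Suc (Suc n)) + z l) - z (Suc n) else z m)"
    proof (rule fold_reflect_descending)
      show "?R (Suc n) z = z(Suc n := z (Suc n - 1) + (z (Suc (Suc n)) + z l) - z (Suc n))"
        using R(1)[of z, OF z(1)] by simp
    qed (use n z reflect_coords_D(1)[OF l] in auto)
    moreover have "sigma_word (Type_D l) 1 = [1..<Suc n] @ [Suc n, Suc (Suc n), l] @ rev [1..<Suc (Suc n)]"
      by (simp add: n)
    ultimately have "fold ?R (sigma_word (Type_D l) 1) x
        = (\<lambda>m. if 1 \<le> m \<and> m \<le> Suc n then z (m - 1) + (z (Suc (Suc n)) + z l) - z (Suc n) else z m)"
      by (simp del: upt_Suc sigma_word.simps)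
    also have "\<dots> = (\<lambda>m. if m = 1 then - x 1 else if 2 \<le> m \<and> m \<le> Suc n then x m - 2 * x 1
          else if m = Suc (Suc n) then x l - x 1 else if m = l then x (Suc (Suc n)) - x 1 else x m)"
    proof
      fix m
      consider "m = 0" | "m = 1" | p where "m = Suc p" "1 \<le> p" "p \<le> n" | "m = Suc (Suc n)" | "m = l" | "l < m"
      proof -
        assume *: "m = 0 \<Longrightarrow> thesis" "m = 1 \<Longrightarrow> thesis" "\<And>p. m = Suc p \<Longrightarrow> 1 \<le> p \<Longrightarrow> p \<le> n \<Longrightarrow> thesis"
          "m = Suc (Suc n) \<Longrightarrow> thesis" "m = l \<Longrightarrow> thesis" "l < m \<Longrightarrow> thesis"
        show thesis
        proof (cases m)
          case (Suc p)
          have "p = 0 \<or> 1 \<le> p \<and> p \<le> n \<or> m = Suc (Suc n) \<or> m = l \<or> l < m" using Suc n by linarith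
          thus ?thesis using * Suc by auto
        qed (rule *(1))
      qed
      thus "(if 1 \<le> m \<and> m \<le> Suc n then z (m - 1) + (z (Suc (Suc n)) + z l) - z (Suc n) else z m)
        = (if m = 1 then - x 1 else if 2 \<le> m \<and> m \<le> Suc n then x m - 2 * x 1
          else if m = Suc (Suc n) then x l - x 1 else if m = l then x (Suc (Suc n)) - x 1 else x m)"
      proof cases
        case 3
        hence "z p = x (Suc p) - x 1" using n by (simp add: z_def y_def)
        thus ?thesis using 3 z by simp
      next
        case 6
        hence "z m = x m" using n by (simp add: z_def y_def)
        thus ?thesis using 6 n by simp
      qed (use n x z in auto)
    qed
    finally show ?thesis .
  qed
  show ?thesis
    unfolding permutes_simple_roots_def
  proof (rule bexI[of _ 1], intro conjI ballI)
    show "fold ?R (sigma_word (Type_D l) 1) (unit 1) 1 < 0" by (subst word) (use l in auto)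
    fix j assume j: "j \<in> {1..dynkin_rank (Type_D l)} - {1}"
    show "fold ?R (sigma_word (Type_D l) 1) (unit j) 1 = 0" by (subst word) (use l j in auto)
    show "\<exists>m\<in>{1..dynkin_rank (Type_D l)}. 0 < fold ?R (sigma_word (Type_D l) 1) (unit j) m"
      by (rule bexI[of _ "if j = l then Suc (Suc n) else if j = Suc (Suc n) then l else j"]; (subst word)?)
         (use n j in auto)
  qed (use l in auto)
qed

lemma sigma_word_D_spin:
  assumes l: "3 \<le> l"
  shows "permutes_simple_roots (Type_D l) (l - 1) (D_spin_word l)"
proof -
  let ?R = "reflect_coords (Type_D l)"
  obtain n where n: "l = Suc (Suc n)" "1 \<le> n" using l by (cases l; cases "l - 1") auto
  have R: "?R n y = y(n := y (n - 1) + (y (Suc n) + y l) - y n)"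
    "?R (Suc n) y = y(Suc n := y n - y (Suc n))" "?R l y = y(l := y n - y l)" if "y 0 = 0" for y
    using reflect_coords_D(2-4)[OF l, of y] that n by simp_all
  text \<open>As in type \<open>C\<close>, with \<open>Z x p\<close> a partial sum of \<open>\<epsilon>\<close>-coordinates and \<open>S t x\<close> the result of \<open>t\<close> blocks.\<close>
  define Z where "Z x p = (if p = l then 2 * x l else if p = Suc n then x (Suc n) + x l else x p)"
    for x :: "nat \<Rightarrow> int" and p
  define S where "S t x p = (if p = 0 \<or> l < p then 0
      else if p = Suc n then Z x (if odd t then Suc n - t else l - t) - x (Suc n)
      else if p = l then Z x (if odd t then l - t else Suc n - t) - x (Suc n)
      else if p \<le> t then Z x (l - p) - 2 * x (Suc n) else Z x (p - t) + Z x (l - t) - 2 * x (Suc n))"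
    for t and x :: "nat \<Rightarrow> int" and p
  have block: "fold ?R (D_block l m) y = (\<lambda>p. if p = a then y n - y a
      else if m \<le> p \<and> p \<le> n then y (p - 1) + y b - y a else y p)"
    if y: "y 0 = 0" and m: "1 \<le> m" "m \<le> Suc n"
      and ab: "(a, b) = (if odd m then (Suc n, l) else (l, Suc n))" for m y a b
  proof -
    let ?z = "y(a := y n - y a)"
    have "fold ?R (D_block l m) y = fold ?R (rev [m..<Suc n]) (?R a y)"
      using ab n by (auto simp: D_block_def)
    also have "?R a y = ?z" using R(2,3)[of y, OF y] ab by (auto split: if_splits)
    also have "fold ?R (rev [m..<Suc n]) ?z
        = (\<lambda>p. if m \<le> p \<and> p \<le> n then ?z (p - 1) + (?z (Suc n) + ?z l) - ?z n else ?z p)"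
    proof (rule fold_reflect_descending)
      show "?R n ?z = ?z(n := ?z (n - 1) + (?z (Suc n) + ?z l) - ?z n)"
        using R(1)[of ?z] y ab n by (auto split: if_splits)
    qed (use n m y ab reflect_coords_D(1)[OF l] in \<open>auto split: if_splits\<close>)
    also have "\<dots> = (\<lambda>p. if p = a then y n - y a
      else if m \<le> p \<and> p \<le> n then y (p - 1) + y b - y a else y p)"
      using ab n by (auto simp: fun_eq_iff split: if_splits)
    finally show ?thesis .
  qed
  have blocks: "fold ?R (concat (map (D_block l) [1..<Suc t])) x = (if t = 0 then x else S t x)"
    if x: "x 0 = 0" "\<And>p. l < p \<Longrightarrow> x p = 0" and t: "t \<le> Suc n" for t x
    using t
  proof (induction t)
    case (Suc t)
    let ?y = "if t = 0 then x else S t x"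
    \<comment> \<open>\<open>a\<close> is the fork node at which block t + 1 begins,
      \<open>b\<close> the other one; they alternate with the parity.\<close>
    define a where "a = (if odd (Suc t) then Suc n else l)"
    define b where "b = (if odd (Suc t) then l else Suc n)"
    have y0: "?y 0 = 0" using x by (simp add: S_def)
    have ab: "(a, b) = (if odd (Suc t) then (Suc n, l) else (l, Suc n))" by (simp add: a_def b_def)
    have "fold ?R (concat (map (D_block l) [1..<Suc (Suc t)])) x = fold ?R (D_block l (Suc t)) ?y"
      using Suc by simp
    also have "\<dots> = (\<lambda>p. if p = a then ?y n - ?y a
      else if Suc t \<le> p \<and> p \<le> n then ?y (p - 1) + ?y b - ?y a else ?y p)"
      by (rule block[where a = a and b = b]) (use y0 Suc.prems ab in auto)
    also have "\<dots> = S (Suc t) x"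
    proof (cases "t = 0")
      case True
      thus ?thesis using n x by (auto simp: fun_eq_iff S_def Z_def a_def b_def)
    next
      case False
      have n_val: "S t x n = Z x (n - t) + Z x (l - t) - 2 * x (Suc n)"
        using n Suc.prems x(1) by (cases "t = n") (auto simp: S_def Z_def)
      have a_val: "S t x a = Z x (l - t) - x (Suc n)" and b_val: "S t x b = Z x (Suc n - t) - x (Suc n)"
        using n by (auto simp: S_def a_def b_def)
      have lt: "l - Suc t = Suc n - t" using n by simp
      show ?thesis
      proof
        fix p
        have "p = 0 \<or> l < p \<or> p = l \<or> p = Suc n \<or> 1 \<le> p \<and> p \<le> t \<and> p \<le> n
            \<or> p = Suc t \<and> p \<le> n \<or> Suc t < p \<and> p \<le> n"
          using n by linarith
        hence "(p = 0 \<or> l < p) \<or> p = a \<or> p = b \<or> 1 \<le> p \<and> p \<le> t \<and> p \<le> n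
            \<or> p = Suc t \<and> p \<le> n \<or> Suc t < p \<and> p \<le> n"
          unfolding a_def b_def by presburger
        then consider "p = 0" | "p = a" | "p = b" | "1 \<le> p" "p \<le> t" "p \<le> n"
          | "p = Suc t" "p \<le> n" | "Suc t < p" "p \<le> n" | "l < p"
          by (elim disjE conjE)
        thus "(if p = a then ?y n - ?y a
          else if Suc t \<le> p \<and> p \<le> n then ?y (p - 1) + ?y b - ?y a else ?y p) = S (Suc t) x p"
        proof cases
          case 1
          thus ?thesis using n False by (auto simp: S_def a_def)
        next
          case 2
          thus ?thesis using False n_val a_val n by (simp add: S_def a_def)
        next
          case 3
          thus ?thesis using False b_val n by (simp add: S_def a_def b_def)
        next
          case 4
          thus ?thesis using n False by (simp add: S_def a_def)
        next
          case 5
          moreover have "p \<noteq> a" using 5 n by (auto simp: a_def)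
          moreover have "S t x t = Z x (l - t) - 2 * x (Suc n)" using 5 n False by (simp add: S_def)
          ultimately show ?thesis using False a_val b_val n lt by (simp add: S_def)
        next
          case 6
          then obtain p' where p': "p = Suc p'" "t < p'" by (cases p) auto
          moreover have "p \<noteq> a" using 6 n by (auto simp: a_def)
          moreover have "S t x p' = Z x (p' - t) + Z x (l - t) - 2 * x (Suc n)" using 6 p' n by (simp add: S_def)
          ultimately show ?thesis using 6 False a_val b_val n lt by (simp add: S_def)
        next
          case 7
          thus ?thesis using n False by (auto simp: S_def a_def)
        qed
      qed
    qed
    finally show ?case by simp
  qed simp
  \<comment> \<open>The last letter is the block for m = l - 1, whose descending run is
    empty.\<close>
  have "D_spin_word l = concat (map (D_block l) [1..<Suc (Suc n)])"
    using n by (simp add: D_spin_word_def D_block_def)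
  hence word: "fold ?R (D_spin_word l) x = S (Suc n) x" if "x 0 = 0" "\<And>p. l < p \<Longrightarrow> x p = 0" for x
    using blocks[of x "Suc n"] that by simp
  show ?thesis
    unfolding permutes_simple_roots_def
  proof (rule bexI[of _ "if odd (Suc n) then Suc n else l"], intro conjI ballI)
    show "fold ?R (D_spin_word l) (unit (l - 1)) (if odd (Suc n) then Suc n else l) < 0"
      by (subst word) (use n in \<open>auto simp: S_def Z_def\<close>)
    fix j assume j: "j \<in> {1..dynkin_rank (Type_D l)} - {l - 1}"
    show "fold ?R (D_spin_word l) (unit j) (if odd (Suc n) then Suc n else l) = 0"
      by (subst word) (use n j in \<open>auto simp: S_def Z_def\<close>)
    \<comment> \<open>\<alpha>_1 goes to the fork node other than i', \<alpha>_l to \<alpha>_1, and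
      the remaining \<alpha>_j to \<alpha>_(l-j).\<close>
    show "\<exists>m\<in>{1..dynkin_rank (Type_D l)}. 0 < fold ?R (D_spin_word l) (unit j) m"
      by (rule bexI[of _ "if j = 1 then if odd (Suc n) then l else Suc n else if j = l then 1 else l - j"];
          (subst word)?)
         (use n j in \<open>auto simp: S_def Z_def\<close>)
  qed (use n in auto)
qed

lemma D_spin_word_subset: "3 \<le> l \<Longrightarrow> set (D_spin_word l) \<subseteq> {1..l}"
  by (auto simp: D_spin_word_def D_block_def)

text \<open>Exchanging the two fork nodes is a diagram automorphism, so it intertwines the
  reflections.\<close>

lemma permutes_simple_roots_D_mirror:
  assumes l: "3 \<le> l" and w: "set w \<subseteq> {1..l}" and p: "permutes_simple_roots (Type_D l) (l - 1) w"
  shows "permutes_simple_roots (Type_D l) l (map (\<lambda>j. if j = l - 1 then l else if j = l then l - 1 else j) w)"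
proof -
  define \<tau> where "\<tau> j = (if j = l - 1 then l else if j = l then l - 1 else j)" for j
  have \<tau>: "\<tau> (\<tau> j) = j" "\<tau> j \<in> {1..l} \<longleftrightarrow> j \<in> {1..l}" for j using l by (auto simp: \<tau>_def)
  let ?R = "reflect_coords (Type_D l)"
  have colsum: "colsum (Type_D l) (\<tau> j) (x \<circ> \<tau>) = colsum (Type_D l) j x" if j: "j \<in> {1..l}" for j x
  proof -
    have tj: "1 \<le> \<tau> j" "\<tau> j \<le> l" using j \<tau>(2)[of j] by auto
    have jl: "1 \<le> j" "j \<le> l" using j by auto
    consider "j = l" | "j = l - 1" | "j = l - 2" | "j + 2 < l" using j by fastforce
    thus ?thesis
      unfolding colsum_D[OF l tj] colsum_D[OF l jl]
    proof cases
      case 4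
      hence "\<tau> j = j" "\<tau> (j - 1) = j - 1" "\<tau> (j + 1) = j + 1" "j \<noteq> l - 2" by (auto simp: \<tau>_def)
      with 4 show "2 * (x \<circ> \<tau>) (\<tau> j) - (if 1 < \<tau> j \<and> \<tau> j < l then (x \<circ> \<tau>) (\<tau> j - 1) else 0)
          - (if \<tau> j + 1 < l then (x \<circ> \<tau>) (\<tau> j + 1) else 0) - (if \<tau> j = l then (x \<circ> \<tau>) (l - 2) else 0)
          - (if \<tau> j = l - 2 then (x \<circ> \<tau>) l else 0)
        = 2 * x j - (if 1 < j \<and> j < l then x (j - 1) else 0) - (if j + 1 < l then x (j + 1) else 0)
          - (if j = l then x (l - 2) else 0) - (if j = l - 2 then x l else 0)"
        by simp
    qed (use l in \<open>auto simp: \<tau>_def Suc_diff_Suc numeral_2_eq_2\<close>)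
  qed
  have step: "?R (\<tau> j) (x \<circ> \<tau>) = ?R j x \<circ> \<tau>" if j: "j \<in> {1..l}" for j x
    unfolding reflect_coords_def colsum[OF j] using \<tau>(1) by (auto simp: fun_eq_iff)
  have fold_mirror: "fold ?R (map \<tau> w) (x \<circ> \<tau>) = fold ?R w x \<circ> \<tau>" if "set w \<subseteq> {1..l}" for w x
    using that by (induction w arbitrary: x) (simp_all add: step)
  have unit: "unit j \<circ> \<tau> = unit (\<tau> j)" for j
    using \<tau>(1) by (auto simp: fun_eq_iff)
  have F: "fold ?R (map \<tau> w) (unit j) m = fold ?R w (unit (\<tau> j)) (\<tau> m)" for j m
    using fold_mirror[OF w, of "unit (\<tau> j)"] by (simp add: unit \<tau>(1))
  obtain i' where i': "i' \<in> {1..l}" "fold ?R w (unit (l - 1)) i' < 0"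
    "\<And>j. j \<in> {1..l} - {l - 1} \<Longrightarrow> fold ?R w (unit j) i' = 0"
    "\<And>j. j \<in> {1..l} - {l - 1} \<Longrightarrow> \<exists>m\<in>{1..l}. 0 < fold ?R w (unit j) m"
    using p unfolding permutes_simple_roots_def dynkin_rank.simps by metis
  have "permutes_simple_roots (Type_D l) l (map \<tau> w)"
    unfolding permutes_simple_roots_def dynkin_rank.simps
  proof (rule bexI[of _ "\<tau> i'"], intro conjI ballI)
    show "fold ?R (map \<tau> w) (unit l) (\<tau> i') < 0"
    proof -
      have "\<tau> l = l - 1" using l by (simp add: \<tau>_def)
      thus ?thesis using i'(2) by (simp add: F \<tau>(1))
    qed
    fix j assume "j \<in> {1..l} - {l}"
    hence j: "\<tau> j \<in> {1..l} - {l - 1}" using \<tau>(2)[of j] l by (auto simp: \<tau>_def split: if_splits)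
    show "fold ?R (map \<tau> w) (unit j) (\<tau> i') = 0" using i'(3)[OF j] by (simp add: F \<tau>(1))
    obtain m where m: "m \<in> {1..l}" "0 < fold ?R w (unit (\<tau> j)) m" using i'(4)[OF j] by blast
    show "\<exists>m\<in>{1..l}. 0 < fold ?R (map \<tau> w) (unit j) m"
      by (rule bexI[of _ "\<tau> m"]) (use m \<tau>(2)[of m] in \<open>simp_all add: F \<tau>(1)\<close>)
  qed (use i'(1) \<tau>(2)[of i'] in simp)
  thus ?thesis unfolding \<tau>_def .
qed

text \<open>By evaluation on the simple roots; i' is the opposite end of the long chain.\<close>

lemma sigma_word_E6:
  assumes "i \<in> {1, 6}"
  shows "permutes_simple_roots Type_E6 i (sigma_word Type_E6 i)"
proof -
  have "permutes_simple_roots Type_E6 1 (sigma_word Type_E6 1)"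
    unfolding permutes_simple_roots_def dynkin_rank.simps numeral_nodes
    by (rule bexI[of _ 6]) (simp_all add: reflect_coords_E6 insert_Diff_if del: One_nat_def)
  moreover have "permutes_simple_roots Type_E6 6 (sigma_word Type_E6 6)"
    unfolding permutes_simple_roots_def dynkin_rank.simps numeral_nodes
    by (rule bexI[of _ 1]) (simp_all add: reflect_coords_E6 insert_Diff_if del: One_nat_def)
  ultimately show ?thesis using assms by auto
qed

lemma sigma_word_E7: "permutes_simple_roots Type_E7 7 (sigma_word Type_E7 7)"
  unfolding permutes_simple_roots_def dynkin_rank.simps numeral_nodes
  by (rule bexI[of _ 7]) (simp_all add: reflect_coords_E7 insert_Diff_if del: One_nat_def)

lemma sigma_word_permutes:
  assumes "valid_dynkin X" "i \<in> minuscule_nodes X"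
  shows "permutes_simple_roots X i (sigma_word X i)"
proof (cases X)
  case (Type_D l)
  have l: "3 \<le> l" using assms(1) Type_D by simp
  consider "i = 1" | "i = l - 1" "i \<noteq> 1" | "i = l" "i \<noteq> 1" "i \<noteq> l - 1"
    using assms(2) Type_D l by fastforce
  thus ?thesis
  proof cases
    case 1
    thus ?thesis using sigma_word_D_vector[OF l] Type_D by simp
  next
    case 2
    thus ?thesis using sigma_word_D_spin[OF l] Type_D by simp
  next
    case 3
    thus ?thesis
      using permutes_simple_roots_D_mirror[OF l D_spin_word_subset[OF l] sigma_word_D_spin[OF l]] Type_D
      by simp
  qed
qed (use assms sigma_word_A sigma_word_B sigma_word_C sigma_word_E6 sigma_word_E7 in
  \<open>auto simp del: sigma_word.simps\<close>)

lemma sigma_word_subset: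
  assumes "valid_dynkin X" "i \<in> minuscule_nodes X"
  shows "set (sigma_word X i) \<subseteq> {1..dynkin_rank X}"
proof (cases X)
  case (Type_D l)
  have l: "3 \<le> l" using assms(1) Type_D by simp
  show ?thesis using D_spin_word_subset[OF l] l Type_D by (auto simp: subset_iff)
qed (use assms in auto)


section \<open>Highest weight vectors of the twisted module\<close>

text \<open>Gives the image of \<theta> from the images of the simple roots.\<close>

lemma fold_reflect_sum:
  assumes "finite J"
  shows "fold (reflect_coords X) l (\<lambda>m. \<Sum>j\<in>J. c j * y j m) = (\<lambda>m. \<Sum>j\<in>J. c j * fold (reflect_coords X) l (y j) m)"
proof (induction l arbitrary: y)
  case (Cons s l)
  have "reflect_coords X s (\<lambda>m. \<Sum>j\<in>J. c j * y j m) = (\<lambda>m. \<Sum>j\<in>J. c j * reflect_coords X s (y j) m)"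
  proof
    fix m
    have "(\<Sum>n=1..dynkin_rank X. (\<Sum>j\<in>J. c j * y j n) * cartan_entry X n s)
        = (\<Sum>j\<in>J. c j * (\<Sum>n=1..dynkin_rank X. y j n * cartan_entry X n s))"
      unfolding sum_distrib_left sum_distrib_right
      by (subst sum.swap) (simp add: mult.assoc)
    thus "reflect_coords X s (\<lambda>m. \<Sum>j\<in>J. c j * y j m) m = (\<Sum>j\<in>J. c j * reflect_coords X s (y j) m)"
      by (simp add: reflect_coords_def sum_subtractf right_diff_distrib)
  qed
  thus ?case using Cons.IH by simp
qed simp

context chevalley
begin

lemma foldr_reflection_add:
  "foldr (simple_reflection G) l (\<lambda>h. \<mu> h + \<nu> h)
    = (\<lambda>h. foldr (simple_reflection G) l \<mu> h + foldr (simple_reflection G) l \<nu> h)"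
  by (induction l) (simp_all add: simple_reflection_def fun_eq_iff algebra_simps)

lemma foldr_reflection_inverse:
  "set l \<subseteq> nodes \<Longrightarrow> foldr (simple_reflection G) (rev l) (foldr (simple_reflection G) l \<mu>) = \<mu>"
  by (induction l) (simp_all add: simple_reflection_twice)

text \<open>\<open>foldr\<close> over the reversed word and \<open>fold\<close> over the word apply
  the letters in the same order.\<close>

lemma foldr_reflection_lc:
  "set l \<subseteq> nodes \<Longrightarrow> foldr (simple_reflection G) (rev l) (lc x) = lc (fold (reflect_coords X) l x)"
  by (induction l arbitrary: x) (simp_all add: lc_reflect[symmetric])

lemma lc_coweight:
  assumes "i \<in> nodes"
  shows "lc x (fundamental_coweight G i) = of_int (x i)"
proof -
  have "lc x (fundamental_coweight G i) = (\<Sum>j\<in>nodes. if j = i then of_int (x j) else 0)"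
    unfolding lc_def using fundamental_coweight(2)[OF assms] by (intro sum.cong) auto
  thus ?thesis using assms by simp
qed

text \<open>By invariance \<beta>(h') times the form is the form of [h, h'] with \<open>a\<close>,
  which is 0. This removes the level term from the twisted action of E_j(0).\<close>

lemma form_cartan_root:
  assumes a: "a \<in> root_space G \<beta>" and h: "h \<in> cartan G" "h' \<in> cartan G" "\<beta> h' \<noteq> 0"
  shows "inv_form G h a = 0"
proof -
  have lin: "clinear (inv_form G x)" for x
    using invariant_form unfolding normalized_invariant_form_def cbilinear_def by blast
  have lin': "clinear (\<lambda>x. inv_form G x y)" for y
    using invariant_form unfolding normalized_invariant_form_def cbilinear_def by blast
  have "inv_form G (br h h') a = inv_form G h (br h' a)"
    using invariant_form unfolding normalized_invariant_form_def by blast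
  hence "\<beta> h' * inv_form G h a = 0"
    using cartan_abelian[OF h(1,2)] root_spaceD[OF a h(2)] lin[of h] clinear_zero[OF lin']
    by (simp add: clinear_iff scaleC_complex_def)
  thus ?thesis using h(3) by simp
qed

text \<open>The certificate of the type bounds the coefficient above; the maximality of \<theta>
  bounds it below.\<close>

lemma highest_root_coweight:
  assumes valid: "valid_dynkin X" and i: "i \<in> minuscule_nodes X"
    and t: "lc t \<in> roots G" "\<And>j. j \<in> nodes \<Longrightarrow> 1 \<le> t j" "\<And>j. 0 \<le> t j"
      "\<And>j. j \<notin> nodes \<Longrightarrow> t j = 0"
  shows "t i = 1"
proof -
  have rank: "nodes = {1..dynkin_rank X}" by (simp add: rank_eq)
  from positive_coweight[OF valid] obtain f where
    f: "(\<forall>j\<in>nodes. 0 \<le> f j) \<and> (\<forall>k\<in>nodes. 0 < (\<Sum>j\<in>nodes. cartan_entry X k j * f j))"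
    unfolding rank by (elim exE)
  from minuscule_bound[OF valid i] obtain P where
    P: "(\<forall>j\<in>nodes. P (unit j)) \<and> (\<forall>j\<in>nodes. \<forall>x. P x \<longrightarrow> P (reflect_coords X j x)) \<and> (\<forall>x. P x \<longrightarrow> x i \<le> 1)"
    unfolding rank coefficient_le_1_def by (elim exE)
  have "P t"
    by (rule positive_root_induct[where f = f and P = P]) (use f P t in \<open>simp_all\<close>)
  hence "t i \<le> 1" using P by blast
  moreover have "i \<in> nodes" using minuscule_nodes_subset[OF valid] i unfolding rank by blast
  ultimately show ?thesis using t(2)[of i] by simp
qed

end

context dominant_mod
begin

lemma not_weight_sigma:
  assumes l: "set l \<subseteq> nodes" and v: "v \<in> wsp (\<lambda>h. foldr (simple_reflection G) l \<mu> h + lc x h)"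
    and pos: "m \<in> nodes" "0 < fold (reflect_coords X) l x m"
  shows "v = 0"
proof (rule ccontr)
  assume v0: "v \<noteq> 0"
  have "set (rev l) \<subseteq> nodes" using l by simp
  from reflect_weights[OF this v v0] obtain u where
    u: "u \<in> wsp (foldr (simple_reflection G) (rev l) (\<lambda>h. foldr (simple_reflection G) l \<mu> h + lc x h))" "u \<noteq> 0"
    by blast
  have "u = 0"
    by (rule not_weight_above[where x = "fold (reflect_coords X) l x" and i = m, OF u(1) _ pos])
       (simp add: foldr_reflection_add foldr_reflection_inverse[OF l] foldr_reflection_lc[OF l])
  thus False using u(2) by blast
qed

end

theorem theorem4p1:
  fixes X :: dynkin
    and G :: "('g::complex_vector) chevalley_data"
    and k i :: nat
    and lam :: "'g \<Rightarrow> complex"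
    and actW :: "'g \<Rightarrow> 'w::complex_vector \<Rightarrow> 'w"
    and actV :: "'g affine \<Rightarrow> 'v::complex_vector \<Rightarrow> 'v" and \<iota> :: "'w \<Rightarrow> 'v"
    and actM :: "'g affine \<Rightarrow> 'm::complex_vector \<Rightarrow> 'm" and q :: "'v \<Rightarrow> 'm"
    and actV0 :: "'g affine \<Rightarrow> 'v0::complex_vector \<Rightarrow> 'v0" and \<iota>0 :: "complex \<Rightarrow> 'v0"
    and actM0 :: "'g affine \<Rightarrow> 'm0::complex_vector \<Rightarrow> 'm0" and q0 :: "'v0 \<Rightarrow> 'm0"
    and vac \<omega> :: 'm0 and c :: complex
    and Y :: "'m0 \<Rightarrow> int \<Rightarrow> 'm0 \<Rightarrow> 'm0"
    and YM :: "'m0 \<Rightarrow> int \<Rightarrow> 'm \<Rightarrow> 'm"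
    and v :: 'm
  assumes g: "simple_lie_algebra_of_type X G"
    and k: "0 < k"
    and lam: "lam \<in> dominant_integral G" "Re (dual_form G lam (highest_root G)) \<le> real k"
    and i: "i \<in> minuscule_nodes X"
    \<comment> \<open>\<open>L(lam)\<close>, \<open>V(k, lam)\<close> and \<open>L(k, lam)\<close>\<close>
    and L: "irreducible_highest_weight_module G lam actW"
    and V: "induced_module G (of_nat k) actW actV \<iota>"
    and M: "irreducible_quotient G actV actM q"
    \<comment> \<open>\<open>L(k, 0)\<close>, with \<open>L(0)\<close> the trivial module \<open>\<complex>\<close>\<close>
    and V0: "induced_module G (of_nat k) (\<lambda>_ _. 0 :: complex) actV0 \<iota>0"
    and M0: "irreducible_quotient G actV0 actM0 q0"
    \<comment> \<open>the vertex operator algebra \<open>L(k, 0)\<close> and its module \<open>L(k, lam)\<close>\<close>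
    and vac: "vac = q0 (\<iota>0 1)"
    and Y: "vertex_operator_algebra Y vac \<omega> c" "extends_affine_action actM0 vac actM0 Y"
    and YM: "voa_module Y vac \<omega> c YM" "extends_affine_action actM0 vac actM YM"
    and v: "v \<in> range (q \<circ> \<iota>)" "affine_highest_weight_vector G actM v"
  shows "(\<exists>u. weyl_translate G actM (range (q \<circ> \<iota>)) lam (sigma_word X i) v u) \<and>
    (\<forall>u. weyl_translate G actM (range (q \<circ> \<iota>)) lam (sigma_word X i) v u \<longrightarrow>
       affine_highest_weight_vector G
         (twisted_affine_action (of_nat k) actM0 vac YM (fundamental_coweight G i)) u)"
proof -
  interpret chevalley X G by (rule chevalley.intro[OF g])
  have valid: "valid_dynkin X" using g unfolding simple_lie_algebra_of_type_def by blast
  have rank: "nodes = {1..dynkin_rank X}" by (simp add: rank_eq)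
  have i_node: "i \<in> nodes" using minuscule_nodes_subset[OF valid] i unfolding rank by blast
  obtain w0 where w0: "w0 \<noteq> 0" "\<forall>h\<in>cartan G. actW h w0 = lam h *\<^sub>C w0"
      "\<forall>j\<in>nodes. actW (E j) w0 = 0" and irr: "irreducible_module br actW"
    using L unfolding irreducible_highest_weight_module_def by blast
  have W: "lie_module br actW" using irr unfolding irreducible_module_def by blast
  interpret W: weight_mod X G actW
    by (intro weight_mod.intro chevalley_axioms lie_mod.intro[OF W])
  interpret W: dominant_mod X G actW lam w0
  proof unfold_locales
    show "\<exists>n::nat. lam (H j) = of_nat n" if "j \<in> nodes" for j
      using lam(1) that unfolding dominant_integral_def by blast
  qed (use irr w0 in \<open>auto simp: W.wsp_def\<close>)

  interpret M: lie_mod "affine_bracket G" actM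
    by (intro lie_mod.intro) (use M irreducible_quotient_def in blast)
  let ?j = "\<lambda>w. q (\<iota> w)"
  have W0: "actW 0 w = 0" for w by simp
  note j_lin = top_linear[OF V M W0] and j0 = loop_0_on_top[OF V M W0]
    and jpos = loop_pos_on_top[OF V M W0]
  \<comment> \<open>The kernel is a submodule of the irreducible L(\<lambda>), and not everything
    because the nonzero \<open>v\<close> lies in the image.\<close>
  have j_inj: "w = 0" if "?j w = 0" for w
  proof -
    have "submodule actW {w. ?j w = 0}"
      unfolding submodule_def complex_vector.subspace_def
      using j_lin clinear_zero[OF j_lin] j0[symmetric] by (auto simp: clinear_iff)
    hence "{w. ?j w = 0} = {0} \<or> {w. ?j w = 0} = UNIV"
      using irr unfolding irreducible_module_def by blast
    moreover have "{w. ?j w = 0} \<noteq> UNIV"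
      using v unfolding affine_highest_weight_vector_def by auto
    ultimately show ?thesis using that by blast
  qed
  have j_eq: "w = w'" if "?j w = ?j w'" for w w'
    using j_inj[of "w - w'"] that clinear_diff[OF j_lin, of w w'] by simp
  have j_scale: "?j (a *\<^sub>C w) = a *\<^sub>C ?j w" for a w using j_lin by (simp add: clinear_iff)
  have weight_space: "weight_space G actM (range (q \<circ> \<iota>)) \<nu> = ?j ` W.wsp \<nu>" for \<nu>
  proof -
    have "?j w \<in> weight_space G actM (range (q \<circ> \<iota>)) \<nu> \<longleftrightarrow> w \<in> W.wsp \<nu>" for w
      unfolding weight_space_def W.wsp_def by (auto simp: j0 j_scale[symmetric] dest: j_eq)
    moreover have "weight_space G actM (range (q \<circ> \<iota>)) \<nu> \<subseteq> range ?j"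
      unfolding weight_space_def by auto
    ultimately show ?thesis by blast
  qed

  \<comment> \<open>\<open>v\<close> comes without a specified weight, but a singular vector of
    L(\<lambda>) can only have weight \<lambda>.\<close>
  have v_weight: "v \<in> weight_space G actM (range (q \<circ> \<iota>)) lam - {0}"
  proof -
    obtain w where w: "v = ?j w" using v(1) by auto
    have v0: "v \<noteq> 0" and "\<forall>h\<in>cartan G. \<exists>a. actM (loop_elem h 0) v = a *\<^sub>C v"
      and sing: "\<forall>j\<in>nodes. actM (loop_elem (E j) 0) v = 0"
      using v(2) unfolding affine_highest_weight_vector_def by blast+
    then obtain \<nu> where \<nu>: "\<forall>h\<in>cartan G. actM (loop_elem h 0) v = \<nu> h *\<^sub>C v"
      by metis
    have ww: "w \<in> W.wsp \<nu>"
      unfolding W.wsp_def using \<nu> w j0 j_scale j_eq by auto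
    have wE: "actW (E j) w = 0" if "j \<in> nodes" for j
      using sing that w j0 j_inj by auto
    have "w \<noteq> 0" using v0 w clinear_zero[OF j_lin] by auto
    hence "\<nu> h = lam h" if "h \<in> cartan G" for h
      using W.singular_weight[OF ww _ wE that] by blast
    hence "w \<in> W.wsp lam" using ww W.wsp_cong[of \<nu> lam] by blast
    thus ?thesis unfolding weight_space using w v0 by blast
  qed

  let ?l = "sigma_word X i" and ?H = "fundamental_coweight G i"
  have l: "set ?l \<subseteq> nodes" using sigma_word_subset[OF valid i] unfolding rank .
  obtain i' where i': "i' \<in> nodes" "fold (reflect_coords X) ?l (unit i) i' < 0"
    "\<And>j. j \<in> nodes \<Longrightarrow> j \<noteq> i \<Longrightarrow> fold (reflect_coords X) ?l (unit j) i' = 0"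
    "\<And>j. j \<in> nodes \<Longrightarrow> j \<noteq> i \<Longrightarrow> \<exists>m\<in>nodes. 0 < fold (reflect_coords X) ?l (unit j) m"
    using sigma_word_permutes[OF valid i] unfolding rank permutes_simple_roots_def by blast
  obtain t where t: "highest_root G = lc t" "lc t \<in> roots G" "\<And>j. j \<in> nodes \<Longrightarrow> 1 \<le> t j"
    "\<And>j. 0 \<le> t j" "\<And>j. j \<notin> nodes \<Longrightarrow> t j = 0"
    using highest_root_lc by metis
  have ti: "t i = 1" by (rule highest_root_coweight[OF valid i t(2-5)])
  have t_sum: "t = (\<lambda>m. \<Sum>j\<in>nodes. t j * unit j m)"
    using t(5) by (auto simp: fun_eq_iff if_distrib cong: if_cong)
  have "fold (reflect_coords X) ?l t i' = (\<Sum>j\<in>nodes. t j * fold (reflect_coords X) ?l (unit j) i')"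
    by (subst t_sum, subst fold_reflect_sum) simp_all
  also have "\<dots> = (\<Sum>j\<in>{i}. t j * fold (reflect_coords X) ?l (unit j) i')"
    by (rule sum.mono_neutral_right) (use i_node i'(3) in auto)
  finally have theta_neg: "fold (reflect_coords X) ?l t i' < 0" using i'(2) ti by simp
  \<comment> \<open>Negation is written as a one-term sum, so that \<open>fold_reflect_sum\<close>
    applies.\<close>
  have minus_t: "(\<lambda>m. - t m) = (\<lambda>m. \<Sum>j\<in>{0::nat}. - 1 * t m)" by simp
  have theta_pos: "0 < fold (reflect_coords X) ?l (\<lambda>m. - t m) i'"
    unfolding minus_t fold_reflect_sum[OF finite.intros(2)[OF finite.emptyI], where c = "\<lambda>_. - 1" and y = "\<lambda>_. t"]
    using theta_neg by simp

  \<comment> \<open>The vacuum lies in the copy of the trivial module, so the modes n = 0 kill it as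
    well.\<close>
  have vac_loop: "actM0 (loop_elem a n) vac = 0" if "0 \<le> n" for a n
    using loop_0_on_top[OF V0 M0] loop_pos_on_top[OF V0 M0] clinear_zero[OF top_linear[OF V0 M0]] that
    unfolding vac by (cases "n = 0") auto
  have vac_central: "actM0 central_elem vac = of_nat k *\<^sub>C vac"
    unfolding vac by (rule central_on_top[OF V0 M0]) simp
  have act0: "lie_module (affine_bracket G) actM0"
    using M0 unfolding irreducible_quotient_def by blast
  have form: "cbilinear (inv_form G)"
    using invariant_form unfolding normalized_invariant_form_def by blast
  have YM_lin: "clinear (\<lambda>a. YM a n w)" and YM_vac: "YM vac n w = (if n = - 1 then w else 0)" for n w
    using YM(1) unfolding voa_module_def cbilinear_def by blast+
  have twisted: "twisted_affine_action (of_nat k) actM0 vac YM h (loop_elem a n) u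
      = actM (loop_elem a (n + d)) u + (if n = 0 then (of_nat k * inv_form G h a) *\<^sub>C u else 0)"
    if "br h a = of_int d *\<^sub>C a" for h a d n u
    by (rule twisted_action_loop[OF lie form act0 vac_loop vac_central YM_lin YM_vac YM(2) that])

  have "affine_highest_weight_vector G (twisted_affine_action (of_nat k) actM0 vac YM ?H) u"
    if u: "weyl_translate G actM (range (q \<circ> \<iota>)) lam ?l v u" for u
  proof -
    obtain w where w: "u = ?j w" "w \<in> W.wsp (foldr (simple_reflection G) ?l lam)" "w \<noteq> 0"
      using u clinear_zero[OF j_lin] unfolding weyl_translate_def weyl_action_def weight_space by auto
    have H: "?H \<in> cartan G" by (rule fundamental_coweight(1)[OF i_node])
    have "u \<noteq> 0" using w j_inj[of w] by auto
    moreover have "\<exists>a. twisted_affine_action (of_nat k) actM0 vac YM ?H (loop_elem h 0) u = a *\<^sub>C u"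
      if h: "h \<in> cartan G" for h
    proof -
      have "br ?H h = of_int 0 *\<^sub>C h" using cartan_abelian[OF H h] by simp
      from twisted[OF this, of 0 u] have "twisted_affine_action (of_nat k) actM0 vac YM ?H (loop_elem h 0) u
          = actM (loop_elem h 0) u + (of_nat k * inv_form G ?H h) *\<^sub>C u" by simp
      also have "actM (loop_elem h 0) u = foldr (simple_reflection G) ?l lam h *\<^sub>C u"
        unfolding w(1) j0 W.wspD[OF w(2) h] by (rule j_scale)
      finally show ?thesis by (metis complex_vector.scale_left_distrib)
    qed
    moreover have "twisted_affine_action (of_nat k) actM0 vac YM ?H central_elem u = of_nat k *\<^sub>C u"
      by (simp add: twisted_affine_action_def central_elem_def)
    moreover have "twisted_affine_action (of_nat k) actM0 vac YM ?H (loop_elem (F_theta G) 1) u = 0"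
    proof -
      \<comment> \<open>Here d = -\<theta>(H) = -1 and n = 1, so the level term, which occurs at n =
        0, is absent.\<close>
      have "br ?H (F_theta G) = of_int (- 1) *\<^sub>C F_theta G"
        using root_spaceD[OF F_theta H] lc_coweight[OF i_node] by (simp add: t(1) ti)
      from twisted[OF this, of 1 u] have "twisted_affine_action (of_nat k) actM0 vac YM ?H (loop_elem (F_theta G) 1) u
          = ?j (actW (F_theta G) w)" by (simp add: w(1) j0)
      moreover have "actW (F_theta G) w = 0"
      proof (rule W.not_weight_sigma[where x = "\<lambda>m. - t m" and m = i', OF l _ i'(1) theta_pos])
        show "actW (F_theta G) w \<in> W.wsp (\<lambda>h. foldr (simple_reflection G) ?l lam h + lc (\<lambda>m. - t m) h)"
          using W.act_wsp[OF F_theta w(2)] by (simp add: t(1) lc_minus)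
      qed
      ultimately show ?thesis using clinear_zero[OF j_lin] by simp
    qed
    moreover have "twisted_affine_action (of_nat k) actM0 vac YM ?H (loop_elem (E j) 0) u = 0"
      if j: "j \<in> nodes" for j
    proof -
      have "br ?H (E j) = of_int (if j = i then 1 else 0) *\<^sub>C E j"
        using root_spaceD[OF E_root[OF j] H] fundamental_coweight(2)[OF i_node j] by auto
      moreover have "inv_form G ?H (E j) = 0"
        by (rule form_cartan_root[OF E_root[OF j] H H_cartan[OF j]]) (simp add: root_coroot_self[OF j])
      ultimately have *: "twisted_affine_action (of_nat k) actM0 vac YM ?H (loop_elem (E j) 0) u
          = actM (loop_elem (E j) (if j = i then 1 else 0)) u"
        using twisted[of ?H "E j" "if j = i then 1 else 0" 0 u] by simp
      show ?thesis
      proof (cases "j = i")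
        case True
        thus ?thesis using * w(1) jpos[of 1] by simp
      next
        case False
        obtain m where m: "m \<in> nodes" "0 < fold (reflect_coords X) ?l (unit j) m" using i'(4)[OF j False] by blast
        have "actW (E j) w = 0"
        proof (rule W.not_weight_sigma[where x = "unit j" and m = m, OF l _ m])
          show "actW (E j) w \<in> W.wsp (\<lambda>h. foldr (simple_reflection G) ?l lam h + lc (unit j) h)"
            using W.act_wsp[OF E_root[OF j] w(2)] by (simp add: lc_unit[OF j])
        qed
        thus ?thesis using * w(1) False clinear_zero[OF j_lin] by (simp add: j0)
      qed
    qed
    ultimately show ?thesis unfolding affine_highest_weight_vector_def by blast
  qed
  \<comment> \<open>The reflected weight does occur in L(\<lambda>), so the statement about all
    \<open>u\<close> is not vacuous.\<close>
  moreover obtain w where w: "w \<in> W.wsp (foldr (simple_reflection G) ?l lam)" "w \<noteq> 0"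
    using W.reflect_weights[OF l W.w(1,2)] by blast
  hence "weyl_translate G actM (range (q \<circ> \<iota>)) lam ?l v (?j w)"
    unfolding weyl_translate_def weyl_action_def using v_weight j_inj[of w] weight_space by blast
  ultimately show ?thesis by blast
qed

end
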